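(* Let $\widetilde{\mathcal D}$ be tangent to a codimension-one foliation $\mathcal F$ of $M^{n+1}$, and let there exist global orthogonal biregular foliated coordinates $(x_0,x_1,\dots,x_n)$ with the leaves of $\mathcal F$ given by $\{x_0=c\}$. Then for any set of constants $(y_i)_{1\le i\le n}$ such that $y_1+\dots+y_n=0$ there exists a metric $g$ on $M$, critical for the action $J_\Omega(g)=\int_\Omega\mathrm S_{\rm mix}(g)\,d\mathrm{vol}_g$ with respect to both $\bar g^\perp$- and $\bar g^\top$-variations for all open relatively compact $\Omega\subset M$, such that $\widetilde{\mathcal D}$ is minimal with principal curvatures $(y_i)_{1\le i\le n}$.
   Context: Biregular foliated coordinates: the leaves are the level sets $\{x_0=c\}$ and the curves orthogonal to the leaves are $\{x_i=c_i,\ i>0\}$; orthogonal means the metric is diagonal in them. The principal curvatures are the eigenvalues of the Weingarten operator $A_N(X)=-\nabla_XN$ ($X\in\widetilde{\mathcal D}$), $N$ a unit normal of $\mathcal F$; minimal (harmonic) means $\operatorname{tr}A_N=0$. For a pseudo-Riemannian metric non-degenerate on $\widetilde{\mathcal D}$, $\mathcal D$ is the orthogonal complement of $\widetilde{\mathcal D}$ for that metric (rank $p=1$), and $\mathrm S_{\rm mix}=\sum_{a}K(E_a\wedge N)$ is the sum of sectional curvatures, $\{E_a\}$ a local orthonormal frame of $\widetilde{\mathcal D}$, $N$ a unit normal. Variations are smooth families $g_t$ ($|t|<\varepsilon$, $g_0=g$) of pseudo-Riemannian metrics non-degenerate on $\widetilde{\mathcal D}$. A $g^\perp$-variation satisfies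 $g_t(X,Y)=g(X,Y)$ for $X,Y\in\widetilde{\mathcal D}$; a $g^\top$-variation satisfies $g_t(X,Y)=g(X,Y)$ for $X,Y\in\mathcal D$ and keeps $\widetilde{\mathcal D},\mathcal D$ orthogonal. Given a $g^\perp$-variation $g_t$ with support contained in $\Omega$, let $\mathcal D(t)$ be the $g_t$-orthogonal complement of $\widetilde{\mathcal D}$; the associated $\bar g^\perp$-variation is $\bar g_t=\phi^\perp_t\,g_t|_{\mathcal D(t)\times\mathcal D(t)}+g|_{\widetilde{\mathcal D}\times\widetilde{\mathcal D}}$ (with respect to $TM=\widetilde{\mathcal D}\oplus\mathcal D(t)$), $\phi_t^\perp=(\mathrm{Vol}(\Omega,g_t)/\mathrm{Vol}(\Omega,g))^{-2/p}$ with $p=1$. Given a $g^\top$-variation $g_t$ with support contained in $\Omega$, the associated $\bar g^\top$-variation is $\bar g_t=g|_{\mathcal D\times\mathcal D}+\phi^\top_t\,g_t|_{\widetilde{\mathcal D}\times\widetilde{\mathcal D}}$, $\phi_t^\top=(\mathrm{Vol}(\Omega,g_t)/\mathrm{Vol}(\Omega,g))^{-2/n}$. $g$ is critical with respect to a class of variations if $\frac{d}{dt}J_\Omega(\bar g_t)|_{t=0}=0$ for all of them. *)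

theory Defs
  imports "HOL-Analysis.Analysis"
begin

text \<open>
  A manifold with global coordinates $(x_0,\dots,x_n)$ is identified, through these coordinates,
  with an open set \<open>M\<close> of \<^typ>\<open>real ^ 'n option\<close>, where \<open>n = CARD('n)\<close>: the index \<^term>\<open>None\<close>
  stands for $0$ and the indices \<^term>\<open>Some i\<close> for $1,\dots,n$. Tangent vectors and (0,2)-tensors
  are given by their components in the coordinate frame; a metric is the field of its Gram matrices.
  Only the values of a field on \<open>M\<close> matter.
\<close>

type_synonym 'm metric = "real ^ 'm \<Rightarrow> real ^ 'm ^ 'm"

subsection \<open>Smooth functions\<close>

fun Ck_on :: "nat \<Rightarrow> 'a::euclidean_space set \<Rightarrow> ('a \<Rightarrow> real) \<Rightarrow> bool" where
  "Ck_on 0 S f \<longleftrightarrow> continuous_on S f"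
| "Ck_on (Suc k) S f \<longleftrightarrow> (\<forall>x\<in>S. f differentiable at x) \<and>
     (\<forall>b\<in>Basis. Ck_on k S (\<lambda>x. frechet_derivative f (at x) b))"

text \<open>The set \<open>S\<close> is always open below.\<close>

definition smooth_on :: "'a::euclidean_space set \<Rightarrow> ('a \<Rightarrow> real) \<Rightarrow> bool" where
  "smooth_on S f \<longleftrightarrow> (\<forall>k. Ck_on k S f)"

subsection \<open>Metrics, Levi-Civita connection, curvature\<close>

definition gform :: "real ^ 'm::finite ^ 'm \<Rightarrow> real ^ 'm \<Rightarrow> real ^ 'm \<Rightarrow> real" where
  "gform G v w = v \<bullet> (G *v w)"

definition pseudo_riemannian_metric :: "(real ^ 'm) set \<Rightarrow> 'm::finite metric \<Rightarrow> bool" where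
  "pseudo_riemannian_metric M g \<longleftrightarrow>
     (\<forall>i j. smooth_on M (\<lambda>x. g x $ i $ j)) \<and>
     (\<forall>x\<in>M. transpose (g x) = g x \<and> invertible (g x))"

definition riemannian_metric :: "(real ^ 'm) set \<Rightarrow> 'm::finite metric \<Rightarrow> bool" where
  "riemannian_metric M g \<longleftrightarrow>
     pseudo_riemannian_metric M g \<and> (\<forall>x\<in>M. \<forall>v. v \<noteq> 0 \<longrightarrow> gform (g x) v v > 0)"

definition orthogonal_coordinates :: "(real ^ 'm) set \<Rightarrow> 'm::finite metric \<Rightarrow> bool" where
  "orthogonal_coordinates M g \<longleftrightarrow> (\<forall>x\<in>M. \<forall>i j. i \<noteq> j \<longrightarrow> g x $ i $ j = 0)"

definition pd :: "'m::finite \<Rightarrow> (real ^ 'm \<Rightarrow> real) \<Rightarrow> real ^ 'm \<Rightarrow> real" where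
  "pd i f x = frechet_derivative f (at x) (axis i 1)"

text \<open>\<open>christoffel g k i j\<close> is $\Gamma^k_{ij}$.\<close>

definition christoffel :: "'m::finite metric \<Rightarrow> 'm \<Rightarrow> 'm \<Rightarrow> 'm \<Rightarrow> real ^ 'm \<Rightarrow> real" where
  "christoffel g k i j x = (1/2) * (\<Sum>l\<in>UNIV. matrix_inv (g x) $ k $ l *
     (pd i (\<lambda>z. g z $ j $ l) x + pd j (\<lambda>z. g z $ i $ l) x - pd l (\<lambda>z. g z $ i $ j) x))"

text \<open>\<open>cov_deriv g x X Y\<close> is $\nabla_X Y$ at \<open>x\<close>, for a tangent vector \<open>X\<close> and a vector field \<open>Y\<close>.\<close>

definition cov_deriv ::
  "'m::finite metric \<Rightarrow> real ^ 'm \<Rightarrow> real ^ 'm \<Rightarrow> (real ^ 'm \<Rightarrow> real ^ 'm) \<Rightarrow> real ^ 'm" where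
  "cov_deriv g x X Y = (\<chi> k. frechet_derivative (\<lambda>z. Y z $ k) (at x) X +
     (\<Sum>i\<in>UNIV. \<Sum>j\<in>UNIV. christoffel g k i j x * X $ i * Y x $ j))"

text \<open>$R(X,Y)Z$ with the convention
  $R(X,Y) = \nabla_X\nabla_Y - \nabla_Y\nabla_X - \nabla_{[X,Y]}$.\<close>

definition riemann ::
  "'m::finite metric \<Rightarrow> real ^ 'm \<Rightarrow> real ^ 'm \<Rightarrow> real ^ 'm \<Rightarrow> real ^ 'm \<Rightarrow> real ^ 'm" where
  "riemann g x X Y Z = (\<chi> l. \<Sum>i\<in>UNIV. \<Sum>j\<in>UNIV. \<Sum>k\<in>UNIV.
     (pd i (christoffel g l j k) x - pd j (christoffel g l i k) x +
      (\<Sum>m\<in>UNIV. christoffel g l i m x * christoffel g m j k x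
              - christoffel g l j m x * christoffel g m i k x)) * X $ i * Y $ j * Z $ k)"

definition sectional_curvature ::
  "'m::finite metric \<Rightarrow> real ^ 'm \<Rightarrow> real ^ 'm \<Rightarrow> real ^ 'm \<Rightarrow> real" where
  "sectional_curvature g x X Y = gform (g x) (riemann g x X Y Y) X /
     (gform (g x) X X * gform (g x) Y Y - (gform (g x) X Y)\<^sup>2)"

subsection \<open>The foliation by the level sets of $x_0$\<close>

text \<open>The distribution tangent to the leaves $\{x_0=c\}$, and its orthogonal complement.\<close>

definition leaf_dist :: "(real ^ 'n::finite option) set" where
  "leaf_dist = {v. v $ None = 0}"

definition normal_dist :: "'n::finite option metric \<Rightarrow> real ^ 'n option \<Rightarrow> (real ^ 'n option) set" where
  "normal_dist g x = {v. \<forall>w\<in>leaf_dist. gform (g x) v w = 0}"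

definition nondegenerate_on_leaves ::
  "(real ^ 'n option) set \<Rightarrow> 'n::finite option metric \<Rightarrow> bool" where
  "nondegenerate_on_leaves M g \<longleftrightarrow> (\<forall>x\<in>M. leaf_dist \<inter> normal_dist g x = {0})"

definition orthonormal_leaf_frame ::
  "'n::finite option metric \<Rightarrow> real ^ 'n option \<Rightarrow> ('n \<Rightarrow> real ^ 'n option) \<Rightarrow> bool" where
  "orthonormal_leaf_frame g x E \<longleftrightarrow>
     (\<forall>a. E a \<in> leaf_dist \<and> \<bar>gform (g x) (E a) (E a)\<bar> = 1) \<and>
     (\<forall>a b. a \<noteq> b \<longrightarrow> gform (g x) (E a) (E b) = 0)"

definition unit_normal :: "'n::finite option metric \<Rightarrow> real ^ 'n option \<Rightarrow> real ^ 'n option \<Rightarrow> bool" where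
  "unit_normal g x N \<longleftrightarrow> N \<in> normal_dist g x \<and> \<bar>gform (g x) N N\<bar> = 1"

text \<open>The sum does not depend on the chosen orthonormal frame.\<close>

definition S_mix :: "'n::finite option metric \<Rightarrow> real ^ 'n option \<Rightarrow> real" where
  "S_mix g x = (SOME s. \<exists>E N. orthonormal_leaf_frame g x E \<and> unit_normal g x N \<and>
     s = (\<Sum>a\<in>UNIV. sectional_curvature g x (E a) N))"

subsection \<open>Extrinsic geometry of the leaves\<close>

definition unit_normal_field ::
  "(real ^ 'n option) set \<Rightarrow> 'n::finite option metric \<Rightarrow> (real ^ 'n option \<Rightarrow> real ^ 'n option) \<Rightarrow> bool"
where
  "unit_normal_field M g N \<longleftrightarrow>
     (\<forall>k. smooth_on M (\<lambda>x. N x $ k)) \<and> (\<forall>x\<in>M. unit_normal g x (N x))"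

definition weingarten ::
  "'n::finite option metric \<Rightarrow> (real ^ 'n option \<Rightarrow> real ^ 'n option) \<Rightarrow> real ^ 'n option \<Rightarrow>
   real ^ 'n option \<Rightarrow> real ^ 'n option" where
  "weingarten g N x X = - cov_deriv g x X N"

text \<open>The family \<open>y\<close> lists the eigenvalues of the Weingarten operator on \<^term>\<open>leaf_dist\<close>, each
  repeated according to the dimension of its eigenspace.\<close>

definition has_principal_curvatures ::
  "'n::finite option metric \<Rightarrow> (real ^ 'n option \<Rightarrow> real ^ 'n option) \<Rightarrow> real ^ 'n option \<Rightarrow>
   ('n \<Rightarrow> real) \<Rightarrow> bool" where
  "has_principal_curvatures g N x y \<longleftrightarrow>
     (\<forall>r. dim {X \<in> leaf_dist. weingarten g N x X = r *\<^sub>R X} = card {i. y i = r})"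

text \<open>Trace of the Weingarten operator on \<^term>\<open>leaf_dist\<close>, computed in the basis
  $\partial_1,\dots,\partial_n$.\<close>

definition minimal_at ::
  "'n::finite option metric \<Rightarrow> (real ^ 'n option \<Rightarrow> real ^ 'n option) \<Rightarrow> real ^ 'n option \<Rightarrow> bool" where
  "minimal_at g N x \<longleftrightarrow> (\<Sum>i\<in>UNIV. weingarten g N x (axis (Some i) 1) $ Some i) = 0"

subsection \<open>The action\<close>

definition vol_density :: "'m::finite metric \<Rightarrow> real ^ 'm \<Rightarrow> real" where
  "vol_density g x = sqrt \<bar>det (g x)\<bar>"

definition Vol :: "(real ^ 'm) set \<Rightarrow> 'm::finite metric \<Rightarrow> real" where
  "Vol \<Omega> g = (LINT x:\<Omega>|lborel. vol_density g x)"

definition J_action :: "(real ^ 'n option) set \<Rightarrow> 'n::finite option metric \<Rightarrow> real" where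
  "J_action \<Omega> g = (LINT x:\<Omega>|lborel. S_mix g x * vol_density g x)"

subsection \<open>Variations\<close>

definition relatively_compact_in :: "'a::topological_space set \<Rightarrow> 'a set \<Rightarrow> bool" where
  "relatively_compact_in M \<Omega> \<longleftrightarrow> \<Omega> \<subseteq> M \<and> compact (closure \<Omega>) \<and> closure \<Omega> \<subseteq> M"

text \<open>Smooth families $g_t$, $|t|<\varepsilon$, of metrics non-degenerate on the leaves, with
  $g_0 = g$; the support (closure in \<open>M\<close> of the set where $g_t\neq g$ for some $t$) is contained
  in \<open>\<Omega>\<close>.\<close>

definition variation ::
  "(real ^ 'n option) set \<Rightarrow> (real ^ 'n option) set \<Rightarrow> 'n::finite option metric \<Rightarrow>
   real \<Rightarrow> (real \<Rightarrow> 'n option metric) \<Rightarrow> bool" where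
  "variation M \<Omega> g \<epsilon> G \<longleftrightarrow> \<epsilon> > 0 \<and>
     (\<forall>x\<in>M. G 0 x = g x) \<and>
     (\<forall>i j. smooth_on ({-\<epsilon><..<\<epsilon>} \<times> M) (\<lambda>(t, x). G t x $ i $ j)) \<and>
     (\<forall>t\<in>{-\<epsilon><..<\<epsilon>}. pseudo_riemannian_metric M (G t) \<and> nondegenerate_on_leaves M (G t)) \<and>
     M \<inter> closure {x \<in> M. \<exists>t\<in>{-\<epsilon><..<\<epsilon>}. G t x \<noteq> g x} \<subseteq> \<Omega>"

definition perp_variation ::
  "(real ^ 'n option) set \<Rightarrow> (real ^ 'n option) set \<Rightarrow> 'n::finite option metric \<Rightarrow>
   real \<Rightarrow> (real \<Rightarrow> 'n option metric) \<Rightarrow> bool" where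
  "perp_variation M \<Omega> g \<epsilon> G \<longleftrightarrow> variation M \<Omega> g \<epsilon> G \<and>
     (\<forall>t\<in>{-\<epsilon><..<\<epsilon>}. \<forall>x\<in>M. \<forall>X\<in>leaf_dist. \<forall>Y\<in>leaf_dist.
        gform (G t x) X Y = gform (g x) X Y)"

definition top_variation ::
  "(real ^ 'n option) set \<Rightarrow> (real ^ 'n option) set \<Rightarrow> 'n::finite option metric \<Rightarrow>
   real \<Rightarrow> (real \<Rightarrow> 'n option metric) \<Rightarrow> bool" where
  "top_variation M \<Omega> g \<epsilon> G \<longleftrightarrow> variation M \<Omega> g \<epsilon> G \<and>
     (\<forall>t\<in>{-\<epsilon><..<\<epsilon>}. \<forall>x\<in>M.
        (\<forall>X\<in>normal_dist g x. \<forall>Y\<in>normal_dist g x. gform (G t x) X Y = gform (g x) X Y) \<and>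
        (\<forall>X\<in>leaf_dist. \<forall>Y\<in>normal_dist g x. gform (G t x) X Y = 0))"

text \<open>Components of \<open>v\<close> in the splitting of the tangent space into \<^term>\<open>leaf_dist\<close> and its
  \<open>h\<close>-orthogonal complement.\<close>

definition leaf_part :: "'n::finite option metric \<Rightarrow> real ^ 'n option \<Rightarrow> real ^ 'n option \<Rightarrow> real ^ 'n option" where
  "leaf_part h x v = (THE u. u \<in> leaf_dist \<and> v - u \<in> normal_dist h x)"

definition normal_part :: "'n::finite option metric \<Rightarrow> real ^ 'n option \<Rightarrow> real ^ 'n option \<Rightarrow> real ^ 'n option" where
  "normal_part h x v = v - leaf_part h x v"

text \<open>$\phi = (\mathrm{Vol}(\Omega,h)/\mathrm{Vol}(\Omega,g))^{-2/k}$, where \<open>k\<close> is the rank of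
  the rescaled distribution.\<close>

definition vol_factor :: "nat \<Rightarrow> (real ^ 'm) set \<Rightarrow> 'm::finite metric \<Rightarrow> 'm metric \<Rightarrow> real" where
  "vol_factor k \<Omega> g h = (Vol \<Omega> h / Vol \<Omega> g) powr (- 2 / real k)"

text \<open>The associated metrics; \<open>h\<close> is the member $g_t$ of the variation. The first one uses the
  splitting orthogonal for \<open>h\<close>, the second one the splitting orthogonal for \<open>g\<close>.\<close>

definition bar_perp ::
  "(real ^ 'n option) set \<Rightarrow> 'n::finite option metric \<Rightarrow> 'n option metric \<Rightarrow> 'n option metric" where
  "bar_perp \<Omega> g h x = (\<chi> i j.
     vol_factor 1 \<Omega> g h * gform (h x) (normal_part h x (axis i 1)) (normal_part h x (axis j 1)) +
     gform (g x) (leaf_part h x (axis i 1)) (leaf_part h x (axis j 1)))"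

definition bar_top ::
  "(real ^ 'n option) set \<Rightarrow> 'n::finite option metric \<Rightarrow> 'n option metric \<Rightarrow> 'n option metric" where
  "bar_top \<Omega> g h x = (\<chi> i j.
     gform (g x) (normal_part g x (axis i 1)) (normal_part g x (axis j 1)) +
     vol_factor CARD('n) \<Omega> g h *
       gform (h x) (leaf_part g x (axis i 1)) (leaf_part g x (axis j 1)))"

definition critical_perp ::
  "(real ^ 'n option) set \<Rightarrow> (real ^ 'n option) set \<Rightarrow> 'n::finite option metric \<Rightarrow> bool" where
  "critical_perp M \<Omega> g \<longleftrightarrow> (\<forall>\<epsilon> G. perp_variation M \<Omega> g \<epsilon> G \<longrightarrow>
     ((\<lambda>t. J_action \<Omega> (bar_perp \<Omega> g (G t))) has_real_derivative 0) (at 0))"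

definition critical_top ::
  "(real ^ 'n option) set \<Rightarrow> (real ^ 'n option) set \<Rightarrow> 'n::finite option metric \<Rightarrow> bool" where
  "critical_top M \<Omega> g \<longleftrightarrow> (\<forall>\<epsilon> G. top_variation M \<Omega> g \<epsilon> G \<longrightarrow>
     ((\<lambda>t. J_action \<Omega> (bar_top \<Omega> g (G t))) has_real_derivative 0) (at 0))"

end

theory Submission
  imports Defs
begin

text \<open>
  The metric is $g = dx_0^2 + \sum_i e^{-2y_ix_0}dx_i^2$ with unit normal $N = \partial_0$; since
  $\sum_i y_i = 0$ its volume density is $1$. For any metric and any vector field $N$,
  $\mathrm{Ric}(N,N) = \mathrm{div}(\nabla_NN - N\,\mathrm{div}N)
    + (\mathrm{div}N)^2 - \mathrm{tr}((\nabla N)^2)$,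
  and $\mathrm S_{\rm mix} = \mathrm{Ric}(N,N)$ for the unit normal $N$ of the leaves. For the metrics
  $\bar g_t$ the field under the divergence vanishes outside the support of $g_t$, although $\bar g_t$
  itself is rescaled on all of $\Omega$. So $J_\Omega(\bar g_t)$ is the integral of an expression in first
  derivatives. It equals $-|\Omega|\sum_i y_i^2 + O(t^2)$: the terms linear in the perturbation of the
  shape operator are derivatives of compactly supported functions, and the volume normalisation
  cancels the linear term coming from the volume density.
\<close>

section \<open>Calculus of smooth functions\<close>

text \<open>Neither an Euler-Lagrange equation nor differentiation under the integral is used: the
  pointwise data are Lipschitz in t uniformly on the compact closure of \<Omega>, and a bound |J(t)
  - J(0)| <= C t^2 already gives the derivative 0. The normalisation acts on all of \<Omega>, so the
  boundary terms must vanish by properties that survive a constant rescaling of either factor: off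
  the support the curves orthogonal to the leaves are geodesics and the leaves are minimal. The
  latter rests on y_1 + ... + y_n = 0. The two kinds of variation present opposite difficulties.
  With fixed leaf metric the shape operator is explicit in lapse and shift, but the lapse \<alpha>
  enters as 1/\<alpha>; replacing this by 2 - \<alpha> costs only second order and produces the
  volume. With fixed normal direction the volume cancels exactly, but the shape operator solves a
  linear system with the perturbed leaf metric as matrix, which has to be inverted with uniform
  bounds. The metrics of a variation are only pseudo-Riemannian; positivity is recovered for small
  t.\<close>

lemma frechet_derivative_cong_open:
  assumes "open S" "x \<in> S" "\<And>z. z \<in> S \<Longrightarrow> f z = g z"
  shows "frechet_derivative f (at x) = frechet_derivative g (at x)"
    and "f differentiable at x \<longleftrightarrow> g differentiable at x"
proof -
  have "(f has_derivative D) (at x) \<longleftrightarrow> (g has_derivative D) (at x)" for D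
    using assms by (metis has_derivative_transform_within_open)
  then show "frechet_derivative f (at x) = frechet_derivative g (at x)"
    and "f differentiable at x \<longleftrightarrow> g differentiable at x"
    by (auto simp: frechet_derivative_def differentiable_def)
qed

lemma Ck_on_cong:
  assumes "open S" "\<And>x. x \<in> S \<Longrightarrow> f x = g x"
  shows "Ck_on k S f \<longleftrightarrow> Ck_on k S g"
  using assms(2)
proof (induction k arbitrary: f g)
  case 0
  then show ?case by (simp cong: continuous_on_cong)
next
  case (Suc k)
  note fd = frechet_derivative_cong_open[OF \<open>open S\<close> _ Suc.prems]
  have "Ck_on k S (\<lambda>x. frechet_derivative f (at x) b) \<longleftrightarrow>
    Ck_on k S (\<lambda>x. frechet_derivative g (at x) b)" for b
    by (rule Suc.IH) (simp add: fd)
  then show ?case by (simp add: fd)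
qed

text \<open>Continuity is demanded only at level 0 of \<open>Ck_on\<close>, so lowering the class
  concerns the derivatives of all orders and needs induction; the base case is continuity of
  differentiable functions.\<close>

lemma Ck_on_SucD: "Ck_on (Suc k) S f \<Longrightarrow> Ck_on k S f"
proof (induction k arbitrary: f)
  case 0
  then show ?case
    by (auto intro!: continuous_at_imp_continuous_on differentiable_imp_continuous_within)
next
  case (Suc k)
  from Suc.prems show ?case by (subst Ck_on.simps) (auto intro: Suc.IH)
qed

lemma Ck_on_const: "Ck_on k S (\<lambda>x. c)"
  by (induction k arbitrary: c) auto

lemma Ck_on_linear:
  assumes "bounded_linear f"
  shows "Ck_on k S f"
proof (cases k)
  case 0
  then show ?thesis using assms by (simp add: linear_continuous_on)
next
  case (Suc m)
  have d: "(f has_derivative f) (at x)" for x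
    using assms by (rule bounded_linear_imp_has_derivative)
  show ?thesis unfolding Suc
    using d by (auto simp: frechet_derivative_at[OF d, symmetric] differentiable_def intro: Ck_on_const)
qed

lemma Ck_on_add:
  assumes "open S" "Ck_on k S f" "Ck_on k S g"
  shows "Ck_on k S (\<lambda>x. f x + g x)"
  using assms(2-)
proof (induction k arbitrary: f g)
  case 0
  then show ?case by (auto intro: continuous_intros)
next
  case (Suc k)
  have d: "((\<lambda>x. f x + g x) has_derivative
      (\<lambda>b. frechet_derivative f (at x) b + frechet_derivative g (at x) b)) (at x)" if "x \<in> S" for x
    using Suc.prems that by (auto intro!: has_derivative_add simp: frechet_derivative_works[symmetric])
  have "Ck_on k S (\<lambda>x. frechet_derivative (\<lambda>x. f x + g x) (at x) b)" if "b \<in> Basis" for b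
  proof (subst Ck_on_cong[OF \<open>open S\<close>])
    show "frechet_derivative (\<lambda>x. f x + g x) (at x) b
      = frechet_derivative f (at x) b + frechet_derivative g (at x) b" if "x \<in> S" for x
      by (simp add: frechet_derivative_at[OF d[OF that], symmetric])
  qed (use Suc that in auto)
  then show ?case using d by (auto simp: differentiable_def)
qed

lemma Ck_on_mult:
  assumes "open S" "Ck_on k S f" "Ck_on k S g"
  shows "Ck_on k S (\<lambda>x. f x * g x :: real)"
  using assms(2-)
proof (induction k arbitrary: f g)
  case 0
  then show ?case by (auto intro: continuous_intros)
next
  case (Suc k)
  have d: "((\<lambda>x. f x * g x) has_derivative
      (\<lambda>b. f x * frechet_derivative g (at x) b + frechet_derivative f (at x) b * g x)) (at x)"
    if "x \<in> S" for x
    using Suc.prems that by (auto intro!: has_derivative_mult simp: frechet_derivative_works[symmetric])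
  have "Ck_on k S (\<lambda>x. frechet_derivative (\<lambda>x. f x * g x) (at x) b)" if "b \<in> Basis" for b
  proof (subst Ck_on_cong[OF \<open>open S\<close>])
    show "frechet_derivative (\<lambda>x. f x * g x) (at x) b
      = f x * frechet_derivative g (at x) b + frechet_derivative f (at x) b * g x" if "x \<in> S" for x
      by (simp add: frechet_derivative_at[OF d[OF that], symmetric])
    show "Ck_on k S (\<lambda>x. f x * frechet_derivative g (at x) b + frechet_derivative f (at x) b * g x)"
      using Suc.prems that Suc.prems[THEN Ck_on_SucD]
      by (intro Ck_on_add Suc.IH \<open>open S\<close>) auto
  qed
  then show ?case using d by (auto simp: differentiable_def)
qed

text \<open>Induction on \<open>k\<close>: the derivative of \<open>\<phi> \<circ> f\<close> contains \<open>\<phi>' \<circ> f\<close>, which is assumed to be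
  of class \<open>k\<close> whenever \<open>\<phi> \<circ> f\<close> is.\<close>

lemma Ck_on_compose_real:
  fixes f :: "'a::euclidean_space \<Rightarrow> real"
  assumes "open S"
    and f: "\<And>k. Ck_on k S f"
    and D: "\<And>x. x \<in> S \<Longrightarrow> (\<phi> has_real_derivative \<phi>' (f x)) (at (f x))"
    and IH: "\<And>k. Ck_on k S (\<lambda>x. \<phi> (f x)) \<Longrightarrow> Ck_on k S (\<lambda>x. \<phi>' (f x))"
  shows "Ck_on k S (\<lambda>x. \<phi> (f x))"
proof -
  have fdiff: "(f has_derivative frechet_derivative f (at x)) (at x)" if "x \<in> S" for x
    using f[of 1] that by (auto simp: frechet_derivative_works[symmetric])
  have d: "((\<lambda>x. \<phi> (f x)) has_derivative (\<lambda>b. frechet_derivative f (at x) b * \<phi>' (f x))) (at x)"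
    if "x \<in> S" for x
    using has_derivative_compose[OF fdiff[OF that] D[OF that, unfolded has_field_derivative_def]]
    by (simp add: mult.commute)
  show ?thesis
  proof (induction k)
    case 0
    show ?case unfolding Ck_on.simps
      by (intro continuous_at_imp_continuous_on ballI has_derivative_continuous[OF d])
  next
    case (Suc k)
    have "Ck_on k S (\<lambda>x. frechet_derivative (\<lambda>x. \<phi> (f x)) (at x) b)" if "b \<in> Basis" for b
    proof (subst Ck_on_cong[OF \<open>open S\<close>])
      show "frechet_derivative (\<lambda>x. \<phi> (f x)) (at x) b = frechet_derivative f (at x) b * \<phi>' (f x)"
        if "x \<in> S" for x
        by (simp add: frechet_derivative_at[OF d[OF that], symmetric])
      show "Ck_on k S (\<lambda>x. frechet_derivative f (at x) b * \<phi>' (f x))"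
        using f[of "Suc k"] that by (intro Ck_on_mult IH Suc.IH \<open>open S\<close>) auto
    qed
    then show ?case using d by (auto simp: differentiable_def)
  qed
qed

section \<open>Closure properties of smooth functions\<close>

lemma smooth_on_cong:
  assumes "open S" "\<And>x. x \<in> S \<Longrightarrow> f x = g x"
  shows "smooth_on S f \<longleftrightarrow> smooth_on S g"
  using Ck_on_cong[OF assms] by (simp add: smooth_on_def)

lemma smooth_on_const: "smooth_on S (\<lambda>x. c)"
  by (simp add: smooth_on_def Ck_on_const)

lemma smooth_on_linear: "bounded_linear f \<Longrightarrow> smooth_on S f"
  by (simp add: smooth_on_def Ck_on_linear)

lemma smooth_on_add:
  "open S \<Longrightarrow> smooth_on S f \<Longrightarrow> smooth_on S g \<Longrightarrow> smooth_on S (\<lambda>x. f x + g x)"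
  by (simp add: smooth_on_def Ck_on_add)

lemma smooth_on_mult:
  "open S \<Longrightarrow> smooth_on S f \<Longrightarrow> smooth_on S g \<Longrightarrow> smooth_on S (\<lambda>x. f x * g x)"
  by (simp add: smooth_on_def Ck_on_mult)

lemma smooth_on_diff:
  assumes "open S" "smooth_on S f" "smooth_on S g"
  shows "smooth_on S (\<lambda>x. f x - g x)"
  using smooth_on_add[OF assms(1,2) smooth_on_mult[OF assms(1) smooth_on_const[of _ "-1"] assms(3)]]
  by simp

lemma smooth_on_minus:
  assumes "open S" "smooth_on S f"
  shows "smooth_on S (\<lambda>x. - f x)"
  using smooth_on_mult[OF assms(1) smooth_on_const[of _ "-1"] assms(2)] by simp

lemma smooth_on_sum:
  assumes "open S" "\<And>i. i \<in> A \<Longrightarrow> smooth_on S (f i)"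
  shows "smooth_on S (\<lambda>x. \<Sum>i\<in>A. f i x)"
  using assms(2)
  by (induction A rule: infinite_finite_induct) (auto intro: smooth_on_const smooth_on_add[OF assms(1)])

lemma smooth_on_prod:
  assumes "open S" "\<And>i. i \<in> A \<Longrightarrow> smooth_on S (f i)"
  shows "smooth_on S (\<lambda>x. \<Prod>i\<in>A. f i x)"
  using assms(2)
  by (induction A rule: infinite_finite_induct) (auto intro: smooth_on_const smooth_on_mult[OF assms(1)])

lemma smooth_on_inverse:
  assumes "open S" "smooth_on S f" "\<And>x. x \<in> S \<Longrightarrow> f x \<noteq> 0"
  shows "smooth_on S (\<lambda>x. inverse (f x))"
  unfolding smooth_on_def
proof
  fix k
  show "Ck_on k S (\<lambda>x. inverse (f x))"
  proof (rule Ck_on_compose_real[where \<phi> = inverse and f = f and \<phi>' = "\<lambda>r. -1 * (inverse r * inverse r)"])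
    show "Ck_on k S (\<lambda>x. -1 * (inverse (f x) * inverse (f x)))"
      if "Ck_on k S (\<lambda>x. inverse (f x))" for k
      using that by (intro Ck_on_mult Ck_on_const \<open>open S\<close>)
    show "(inverse has_real_derivative -1 * (inverse (f x) * inverse (f x))) (at (f x))"
      if "x \<in> S" for x
      using assms(3)[OF that] by (auto intro!: derivative_eq_intros)
  qed (use assms(1,2) in \<open>auto simp: smooth_on_def\<close>)
qed

lemma smooth_on_divide:
  assumes "open S" "smooth_on S f" "smooth_on S g" "\<And>x. x \<in> S \<Longrightarrow> g x \<noteq> 0"
  shows "smooth_on S (\<lambda>x. f x / g x)"
  unfolding divide_inverse by (intro smooth_on_mult smooth_on_inverse assms)

lemma smooth_on_exp:
  assumes "open S" "smooth_on S f"
  shows "smooth_on S (\<lambda>x. exp (f x))"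
  unfolding smooth_on_def
proof
  show "Ck_on k S (\<lambda>x. exp (f x))" for k
    by (rule Ck_on_compose_real[where \<phi> = exp and f = f and \<phi>' = exp])
      (use assms in \<open>auto simp: smooth_on_def\<close>)
qed

text \<open>$\sqrt r' = \frac12 r^{-1} \sqrt r$ for $r > 0$.\<close>

lemma smooth_on_sqrt:
  assumes "open S" "smooth_on S f" "\<And>x. x \<in> S \<Longrightarrow> f x > 0"
  shows "smooth_on S (\<lambda>x. sqrt (f x))"
  unfolding smooth_on_def
proof
  fix k
  have inv: "Ck_on k S (\<lambda>x. inverse (f x))" for k
    using smooth_on_inverse[OF assms(1,2)] assms(3) by (force simp: smooth_on_def)
  show "Ck_on k S (\<lambda>x. sqrt (f x))"
  proof (rule Ck_on_compose_real[where \<phi> = sqrt and f = f and \<phi>' = "\<lambda>r. 1/2 * (inverse r * sqrt r)"])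
    show "Ck_on k S (\<lambda>x. 1/2 * (inverse (f x) * sqrt (f x)))"
      if "Ck_on k S (\<lambda>x. sqrt (f x))" for k
      using that inv by (intro Ck_on_mult Ck_on_const \<open>open S\<close>)
    show "(sqrt has_real_derivative 1/2 * (inverse (f x) * sqrt (f x))) (at (f x))"
      if "x \<in> S" for x
      using assms(3)[OF that]
      by (auto intro!: derivative_eq_intros simp: field_simps)
  qed (use assms(1,2) in \<open>auto simp: smooth_on_def\<close>)
qed

lemma smooth_on_coord: "smooth_on S (\<lambda>x::real^'m. x $ i)"
  by (intro smooth_on_linear bounded_linear_vec_nth)

lemma smooth_on_differentiable: "smooth_on S f \<Longrightarrow> x \<in> S \<Longrightarrow> f differentiable at x"
  unfolding smooth_on_def using Ck_on.simps(2) by blast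

lemma smooth_on_continuous: "smooth_on S f \<Longrightarrow> continuous_on S f"
  unfolding smooth_on_def using Ck_on.simps(1) by blast

lemma smooth_on_frechet_derivative:
  "smooth_on S f \<Longrightarrow> b \<in> Basis \<Longrightarrow> smooth_on S (\<lambda>x. frechet_derivative f (at x) b)"
  unfolding smooth_on_def using Ck_on.simps(2) by blast

lemma smooth_on_pd: "smooth_on S f \<Longrightarrow> smooth_on S (pd i f)"
  unfolding pd_def[abs_def] by (rule smooth_on_frechet_derivative) auto

lemmas smooth_intros = smooth_on_const smooth_on_add smooth_on_mult smooth_on_diff
  smooth_on_minus smooth_on_sum smooth_on_coord smooth_on_pd

subsection \<open>Partial derivatives\<close>

lemma pd_has_derivative: "(f has_derivative f') (at x) \<Longrightarrow> pd i f x = f' (axis i 1)"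
  unfolding pd_def by (simp add: frechet_derivative_at[symmetric])

lemma pd_cong:
  "open S \<Longrightarrow> x \<in> S \<Longrightarrow> (\<And>z. z \<in> S \<Longrightarrow> f z = g z) \<Longrightarrow> pd i f x = pd i g x"
  unfolding pd_def using frechet_derivative_cong_open(1) by metis

lemma pd_const [simp]: "pd i (\<lambda>x. c) x = 0"
  by (simp add: pd_def)

lemma pd_add:
  assumes "f differentiable at x" "g differentiable at x"
  shows "pd i (\<lambda>x. f x + g x) x = pd i f x + pd i g x"
  using pd_has_derivative[OF has_derivative_add, of f _ x g] assms
  by (simp add: frechet_derivative_works pd_def)

lemma pd_diff:
  assumes "f differentiable at x" "g differentiable at x"
  shows "pd i (\<lambda>x. f x - g x) x = pd i f x - pd i g x"
  using pd_has_derivative[OF has_derivative_diff, of f _ x g] assms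
  by (simp add: frechet_derivative_works pd_def)

lemma pd_mult:
  assumes "f differentiable at x" "g differentiable at x"
  shows "pd i (\<lambda>x. f x * g x) x = f x * pd i g x + pd i f x * g x"
  using pd_has_derivative[OF has_derivative_mult, of f _ x g] assms
  by (simp add: frechet_derivative_works pd_def)

lemma pd_sum:
  assumes "\<And>j. j \<in> A \<Longrightarrow> f j differentiable at x"
  shows "pd i (\<lambda>x. \<Sum>j\<in>A. f j x) x = (\<Sum>j\<in>A. pd i (f j) x)"
  using pd_has_derivative[OF has_derivative_sum, of A f "\<lambda>j. frechet_derivative (f j) (at x)" x] assms
  by (simp add: frechet_derivative_works pd_def)

lemma pd_cmult:
  assumes "f differentiable at x"
  shows "pd i (\<lambda>x. c * f x) x = c * pd i f x"
  using pd_mult[of "\<lambda>x. c" x f i] assms by simp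

lemma pd_coord: "pd i (\<lambda>x. x $ j) x = (if i = j then 1 else 0)"
  by (subst pd_has_derivative[OF bounded_linear_imp_has_derivative[OF bounded_linear_vec_nth]])
    (simp add: axis_def eq_commute)

lemma pd_real_compose:
  assumes "f differentiable at x" "(\<phi> has_real_derivative D) (at (f x))"
  shows "pd i (\<lambda>x. \<phi> (f x)) x = D * pd i f x"
proof -
  have "(f has_derivative frechet_derivative f (at x)) (at x)"
    using assms(1) by (simp add: frechet_derivative_works)
  from has_derivative_compose[OF this assms(2)[unfolded has_field_derivative_def]]
  have "((\<lambda>x. \<phi> (f x)) has_derivative (\<lambda>b. D * frechet_derivative f (at x) b)) (at x)" .
  from pd_has_derivative[OF this] show ?thesis by (simp add: pd_def)
qed

text \<open>The chain rule along a line gives access to one-variable mean value estimates: for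
  second differences, for Lipschitz bounds in the parameter t, and for difference quotients under an
  integral.\<close>

lemma frechet_derivative_line:
  fixes f :: "'a::euclidean_space \<Rightarrow> real"
  assumes "f differentiable at (x + s *\<^sub>R u)"
  shows "((\<lambda>s. f (x + s *\<^sub>R u)) has_real_derivative frechet_derivative f (at (x + s *\<^sub>R u)) u) (at s)"
proof -
  have l: "linear (frechet_derivative f (at (x + s *\<^sub>R u)))"
    using assms by (rule linear_frechet_derivative)
  have "((\<lambda>s. x + s *\<^sub>R u) has_derivative (\<lambda>h. h *\<^sub>R u)) (at s)"
    by (auto intro!: derivative_eq_intros)
  moreover have "(f has_derivative frechet_derivative f (at (x + s *\<^sub>R u))) (at (x + s *\<^sub>R u))"
    using assms by (simp add: frechet_derivative_works)
  ultimately have "((\<lambda>s. f (x + s *\<^sub>R u)) has_derivative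
      (\<lambda>h. frechet_derivative f (at (x + s *\<^sub>R u)) (h *\<^sub>R u))) (at s)"
    by (rule has_derivative_compose)
  moreover have "(\<lambda>h. frechet_derivative f (at (x + s *\<^sub>R u)) (h *\<^sub>R u))
      = (*) (frechet_derivative f (at (x + s *\<^sub>R u)) u)"
    by (rule ext) (simp add: linear_scale[OF l])
  ultimately show ?thesis
    by (simp only: has_field_derivative_def)
qed

text \<open>The second difference $f(x+hu+hv)-f(x+hu)-f(x+hv)+f(x)$ is $h^2$ times the mixed
  derivative at a nearby point, in either order of differentiation.\<close>

lemma second_difference:
  fixes f :: "'a::euclidean_space \<Rightarrow> real"
  assumes ball: "ball x r \<subseteq> S" and f: "\<And>z. z \<in> S \<Longrightarrow> f differentiable at z"
    and fu: "\<And>z. z \<in> S \<Longrightarrow> (\<lambda>z. frechet_derivative f (at z) u) differentiable at z"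
    and h: "h > 0" "h * (norm u + norm v) < r"
  shows "\<exists>p. dist x p \<le> h * (norm u + norm v) \<and>
    f (x + h *\<^sub>R u + h *\<^sub>R v) - f (x + h *\<^sub>R u) - f (x + h *\<^sub>R v) + f x
      = h\<^sup>2 * frechet_derivative (\<lambda>z. frechet_derivative f (at z) u) (at p) v"
proof -
  have near: "dist x (x + s *\<^sub>R u + t *\<^sub>R v) \<le> h * (norm u + norm v)"
    if "0 \<le> s" "s \<le> h" "0 \<le> t" "t \<le> h" for s t
  proof -
    have "norm (s *\<^sub>R u + t *\<^sub>R v) \<le> s * norm u + t * norm v"
      using norm_triangle_ineq[of "s *\<^sub>R u" "t *\<^sub>R v"] that by simp
    also have "\<dots> \<le> h * norm u + h * norm v"
      using that by (intro add_mono mult_right_mono) auto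
    finally have "norm (s *\<^sub>R u + t *\<^sub>R v) \<le> h * (norm u + norm v)"
      by (simp only: distrib_left)
    moreover have "dist x (x + w) = norm w" for w
      by (metis add_diff_cancel_left' dist_commute dist_norm)
    ultimately show ?thesis by (simp only: add.assoc)
  qed
  have inS: "x + s *\<^sub>R u + t *\<^sub>R v \<in> S" if "0 \<le> s" "s \<le> h" "0 \<le> t" "t \<le> h" for s t
    using le_less_trans[OF near[OF that] h(2)] ball by (meson mem_ball subsetD)
  \<comment> \<open>\<open>\<phi> h - \<phi> 0\<close> is the second difference. The mean value
    theorem for \<open>\<phi>\<close> turns it into a difference of u-derivatives at two points that
    differ by \<open>h *\<^sub>R v\<close>; applied to \<open>\<psi>\<close> below, it produces the
    mixed derivative.\<close>
  define \<phi> where "\<phi> s = f ((x + h *\<^sub>R v) + s *\<^sub>R u) - f (x + s *\<^sub>R u)" for s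
  define \<phi>' where "\<phi>' s = frechet_derivative f (at ((x + h *\<^sub>R v) + s *\<^sub>R u)) u
    - frechet_derivative f (at (x + s *\<^sub>R u)) u" for s
  have "(\<phi> has_real_derivative \<phi>' s) (at s)" if s: "0 \<le> s" "s \<le> h" for s
  proof -
    have "x + h *\<^sub>R v + s *\<^sub>R u \<in> S" "x + s *\<^sub>R u \<in> S"
      using inS[OF s, of h] inS[OF s, of 0] h(1) by (simp_all add: ac_simps)
    then show ?thesis
      unfolding \<phi>_def[abs_def] \<phi>'_def by (intro DERIV_diff frechet_derivative_line f)
  qed
  from MVT2[OF \<open>h > 0\<close>, of \<phi> \<phi>', OF this]
  obtain \<xi> where \<xi>: "\<xi> > 0" "\<xi> < h" and 1: "\<phi> h - \<phi> 0 = h * \<phi>' \<xi>"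
    by auto
  define \<psi> where "\<psi> t = frechet_derivative f (at ((x + \<xi> *\<^sub>R u) + t *\<^sub>R v)) u" for t
  define \<psi>' where "\<psi>' t = frechet_derivative (\<lambda>z. frechet_derivative f (at z) u)
    (at ((x + \<xi> *\<^sub>R u) + t *\<^sub>R v)) v" for t
  have "(\<psi> has_real_derivative \<psi>' t) (at t)" if "0 \<le> t" "t \<le> h" for t
    unfolding \<psi>_def[abs_def] \<psi>'_def
    by (rule frechet_derivative_line[where f = "\<lambda>z. frechet_derivative f (at z) u"])
      (use \<xi> that in \<open>auto intro!: fu inS\<close>)
  from MVT2[OF \<open>h > 0\<close>, of \<psi> \<psi>', OF this]
  obtain \<eta> where \<eta>: "\<eta> > 0" "\<eta> < h" and 2: "\<psi> h - \<psi> 0 = h * \<psi>' \<eta>"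
    by auto
  have "\<phi>' \<xi> = \<psi> h - \<psi> 0"
    unfolding \<phi>'_def \<psi>_def by (simp add: ac_simps)
  then have "\<phi> h - \<phi> 0 = h\<^sup>2 *
     frechet_derivative (\<lambda>z. frechet_derivative f (at z) u) (at (x + \<xi> *\<^sub>R u + \<eta> *\<^sub>R v)) v"
    unfolding 1 2 \<psi>'_def by (simp add: power2_eq_square)
  moreover have "\<phi> h - \<phi> 0
      = f (x + h *\<^sub>R u + h *\<^sub>R v) - f (x + h *\<^sub>R u) - f (x + h *\<^sub>R v) + f x"
    unfolding \<phi>_def by (simp add: ac_simps)
  moreover have "dist x (x + \<xi> *\<^sub>R u + \<eta> *\<^sub>R v) \<le> h * (norm u + norm v)"
    using \<xi> \<eta> by (intro near) auto
  ultimately show ?thesis by (auto intro!: exI[of _ "x + \<xi> *\<^sub>R u + \<eta> *\<^sub>R v"])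
qed

text \<open>Both mixed derivatives take, at two points close to \<open>x\<close>, the same value:
  the second difference divided by the square of \<open>h\<close>. By continuity they cannot differ
  at \<open>x\<close>.\<close>

lemma pd_commute:
  fixes f :: "real ^ 'm::finite \<Rightarrow> real"
  assumes "open S" "smooth_on S f" "x \<in> S"
  shows "pd i (pd j f) x = pd j (pd i f) x"
proof (rule ccontr)
  define u v :: "real^'m" where "u = axis j 1" and "v = axis i 1"
  define A B where "A = pd i (pd j f)" and "B = pd j (pd i f)"
  assume "pd i (pd j f) x \<noteq> pd j (pd i f) x"
  then have e: "\<bar>A x - B x\<bar> / 2 > 0" (is "?e > 0") by (simp add: A_def B_def)
  have "continuous_on S A" "continuous_on S B"
    unfolding A_def B_def by (intro smooth_on_continuous smooth_on_pd assms)+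
  then have "isCont A x" "isCont B x"
    using assms by (auto simp: continuous_on_eq_continuous_at)
  then obtain d1 d2 where d: "d1 > 0" "d2 > 0"
    "\<And>z. dist z x < d1 \<Longrightarrow> dist (A z) (A x) < ?e" "\<And>z. dist z x < d2 \<Longrightarrow> dist (B z) (B x) < ?e"
    unfolding continuous_at_eps_delta using e by (metis dist_real_def)
  obtain r where r: "r > 0" "ball x r \<subseteq> S" using assms open_contains_ball by blast
  define m where "m = min r (min d1 d2)"
  have m: "m > 0" using r d by (simp add: m_def)
  \<comment> \<open>The intermediate points lie within \<open>h * (norm u + norm v) = m / 2\<close>
    of \<open>x\<close>, hence inside all three balls.\<close>
  define h where "h = m / 4"
  have n2: "norm u + norm v = 2" by (simp add: u_def v_def)
  have h: "h > 0" "h * (norm u + norm v) < r" "h * (norm u + norm v) < d1"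
    "h * (norm u + norm v) < d2" "h * (norm v + norm u) < r"
    using m unfolding n2 add.commute[of "norm v" "norm u"] by (auto simp: h_def m_def)
  have fS: "\<And>z. z \<in> S \<Longrightarrow> f differentiable at z"
    using assms smooth_on_differentiable by blast
  have fd: "(\<lambda>z. frechet_derivative f (at z) (axis k 1)) differentiable at z" if "z \<in> S" for z k
    using smooth_on_differentiable[OF smooth_on_pd[OF assms(2)] that, of k] by (simp add: pd_def[abs_def])
  let ?D = "f (x + h *\<^sub>R u + h *\<^sub>R v) - f (x + h *\<^sub>R u) - f (x + h *\<^sub>R v) + f x"
  obtain p where p: "dist x p \<le> h * (norm u + norm v)" "?D = h\<^sup>2 * A p"
    using second_difference[OF r(2) fS, of u h v] fd h
    by (auto simp: A_def pd_def[abs_def] u_def v_def)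
  obtain q where q: "dist x q \<le> h * (norm v + norm u)"
    "f (x + h *\<^sub>R v + h *\<^sub>R u) - f (x + h *\<^sub>R v) - f (x + h *\<^sub>R u) + f x = h\<^sup>2 * B q"
    using second_difference[OF r(2) fS, of v h u] fd h
    by (auto simp: B_def pd_def[abs_def] u_def v_def)
  have "h\<^sup>2 * A p = h\<^sup>2 * B q"
    using p(2) q(2) by (simp add: algebra_simps)
  then have "A p = B q" using h by simp
  moreover have "dist (A p) (A x) < ?e" "dist (B q) (B x) < ?e"
    using d(3)[of p] d(4)[of q] p(1) q(1) h(3,4) by (simp_all add: dist_commute add.commute)
  moreover have "\<not> (\<bar>c - a\<bar> < \<bar>a - b\<bar> / 2 \<and> \<bar>c - b\<bar> < \<bar>a - b\<bar> / 2)" for a b c :: real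
    using abs_triangle_ineq4[of "c - b" "c - a"] by auto
  ultimately show False by (metis dist_real_def)
qed

subsection \<open>Families of functions\<close>

lemma smooth_on_slice_pd:
  fixes F :: "real \<times> (real ^ 'm::finite) \<Rightarrow> real"
  assumes "smooth_on (T \<times> M) F" "t \<in> T" "x \<in> M"
  shows "pd i (\<lambda>x. F (t, x)) x = frechet_derivative F (at (t, x)) (0, axis i 1)"
proof -
  have "F differentiable at (t, x)"
    using assms smooth_on_differentiable by blast
  then have "(F has_derivative frechet_derivative F (at (t, x))) (at (t, x))"
    by (simp add: frechet_derivative_works)
  moreover have "((\<lambda>x. (t, x)) has_derivative (\<lambda>h. (0, h))) (at x)"
    by (auto intro!: derivative_eq_intros)
  ultimately have "((\<lambda>x. F (t, x)) has_derivative (\<lambda>h. frechet_derivative F (at (t, x)) (0, h))) (at x)"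
    using has_derivative_compose[of "\<lambda>x. (t, x)" _ x UNIV F] by simp
  then show ?thesis by (rule pd_has_derivative)
qed

text \<open>The perturbation of the shape operator involves first space derivatives of g_t. Their
  joint smoothness in t and x is what allows Lipschitz bounds in t for them too.\<close>

lemma smooth_on_joint_pd:
  fixes F :: "real \<times> (real ^ 'm::finite) \<Rightarrow> real"
  assumes "open T" "open M" "smooth_on (T \<times> M) F"
  shows "smooth_on (T \<times> M) (\<lambda>(t, x). pd i (\<lambda>x. F (t, x)) x)"
proof -
  have "(0, axis i 1) \<in> (Basis :: (real \<times> (real ^ 'm)) set)"
    by (auto simp: Basis_prod_def)
  from smooth_on_frechet_derivative[OF assms(3) this] show ?thesis
    by (rule smooth_on_cong[THEN iffD1, rotated 2])
      (auto simp: smooth_on_slice_pd[OF assms(3)] open_Times assms)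
qed

text \<open>The t-derivative is continuous, hence bounded on the compact set of all (t, x) with |t|
  <= \<epsilon>/2 and x in \<open>C\<close>. Halving \<epsilon> keeps this set inside the open
  domain; the constant is uniform in x, which the later integration needs.\<close>

lemma smooth_family_lipschitz:
  fixes F :: "real \<times> (real ^ 'm::finite) \<Rightarrow> real"
  assumes "smooth_on ({-\<epsilon><..<\<epsilon>} \<times> M) F" "\<epsilon> > 0" "compact C" "C \<subseteq> M"
  shows "\<exists>L\<ge>0. \<forall>t x. \<bar>t\<bar> \<le> \<epsilon> / 2 \<and> x \<in> C \<longrightarrow> \<bar>F (t, x) - F (0, x)\<bar> \<le> L * \<bar>t\<bar>"
proof -
  define P where "P z = frechet_derivative F (at z) (1, 0)" for z
  have "(1, 0) \<in> (Basis :: (real \<times> (real ^ 'm)) set)"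
    by (auto simp: Basis_prod_def)
  then have "continuous_on ({-\<epsilon><..<\<epsilon>} \<times> M) P"
    unfolding P_def by (intro smooth_on_continuous smooth_on_frechet_derivative assms)
  then have "continuous_on ({-\<epsilon>/2..\<epsilon>/2} \<times> C) P"
    by (rule continuous_on_subset) (use assms in auto)
  then have "compact (P ` ({-\<epsilon>/2..\<epsilon>/2} \<times> C))"
    by (intro compact_continuous_image compact_Times assms) auto
  then obtain L where L: "L > 0" "\<And>t x. t \<in> {-\<epsilon>/2..\<epsilon>/2} \<Longrightarrow> x \<in> C \<Longrightarrow> \<bar>P (t, x)\<bar> \<le> L"
    using bounded_pos[of "P ` ({-\<epsilon>/2..\<epsilon>/2} \<times> C)"] by (force dest: compact_imp_bounded)
  have "\<bar>F (t, x) - F (0, x)\<bar> \<le> L * \<bar>t\<bar>" if "\<bar>t\<bar> \<le> \<epsilon> / 2" "x \<in> C" for t x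
  proof -
    have d: "((\<lambda>s. F (s, x)) has_real_derivative P (s, x)) (at s within {-\<epsilon>/2..\<epsilon>/2})"
      if "s \<in> {-\<epsilon>/2..\<epsilon>/2}" for s
    proof -
      have "F differentiable at (s, x)"
        using assms that \<open>x \<in> C\<close> by (auto intro!: smooth_on_differentiable[OF assms(1)])
      then show ?thesis
        using frechet_derivative_line[of F "(0, x)" s "(1, 0)"]
        by (auto simp: P_def intro: has_field_derivative_at_within)
    qed
    have "norm (F (t, x) - F (0, x)) \<le> L * norm (t - 0)"
      by (rule field_differentiable_bound[OF _ d]) (use L that assms(2) in auto)
    then show ?thesis by simp
  qed
  then show ?thesis using L by (intro exI[of _ L]) auto
qed

section \<open>Integration over relatively compact sets\<close>

text \<open>Integrability comes from the compact closure of \<Omega>, on which \<open>f\<close> is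
  still continuous because the closure stays inside \<open>M\<close>.\<close>

lemma relatively_compact_integrable:
  fixes f :: "'a::euclidean_space \<Rightarrow> real"
  assumes "relatively_compact_in M \<Omega>" "open \<Omega>" "continuous_on M f"
  shows "set_integrable lborel \<Omega> f"
proof -
  have "continuous_on (closure \<Omega>) f"
    using assms continuous_on_subset by (auto simp: relatively_compact_in_def)
  then have "set_integrable lborel (closure \<Omega>) f"
    unfolding set_integrable_def using assms
    by (intro borel_integrable_compact) (auto simp: relatively_compact_in_def)
  then show ?thesis
    by (rule set_integrable_subset) (use assms closure_subset in auto)
qed

lemma relatively_compact_emeasure:
  assumes "relatively_compact_in M (\<Omega> :: 'a::euclidean_space set)" "open \<Omega>"
  shows "emeasure lborel \<Omega> < \<infinity>"
proof -
  have "emeasure lborel \<Omega> \<le> emeasure lborel (closure \<Omega>)"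
    by (intro emeasure_mono closure_subset) auto
  also have "\<dots> < \<infinity>"
    using assms by (intro emeasure_compact_finite) (auto simp: relatively_compact_in_def)
  finally show ?thesis .
qed

lemma set_integral_bound:
  fixes f :: "'a::euclidean_space \<Rightarrow> real"
  assumes "relatively_compact_in M \<Omega>" "open \<Omega>" "set_integrable lborel \<Omega> f"
    and "\<And>x. x \<in> \<Omega> \<Longrightarrow> \<bar>f x\<bar> \<le> C"
  shows "\<bar>LINT x:\<Omega>|lborel. f x\<bar> \<le> C * measure lborel \<Omega>"
proof -
  have c: "set_integrable lborel \<Omega> (\<lambda>x. C)"
    by (rule relatively_compact_integrable[OF assms(1,2)]) (intro continuous_intros)
  have "\<bar>LINT x:\<Omega>|lborel. f x\<bar> \<le> (LINT x:\<Omega>|lborel. \<bar>f x\<bar>)"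
    using set_integral_norm_bound[OF assms(3)] by simp
  also have "\<dots> \<le> (LINT x:\<Omega>|lborel. C)"
    using assms c by (intro set_integral_mono set_integrable_abs) auto
  also have "\<dots> = C * measure lborel \<Omega>"
    using relatively_compact_emeasure[OF assms(1,2)] assms(2)
    by (subst set_integral_const) auto
  finally show ?thesis .
qed

text \<open>The integral of the difference quotient vanishes by translation invariance.\<close>

lemma integral_pd_compact_support:
  fixes f :: "real ^ 'm::finite \<Rightarrow> real"
  assumes "open M" "smooth_on M f" "compact K" "K \<subseteq> \<Omega>" "\<Omega> \<subseteq> M" "open \<Omega>"
    and zero: "\<And>x. x \<in> M - K \<Longrightarrow> f x = 0"
  shows "(LINT x:\<Omega>|lborel. pd i f x) = 0"
proof -
  define e :: "real^'m" where "e = axis i 1"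
  have ne: "norm e = 1" by (simp add: e_def)
  \<comment> \<open>The extension by zero is differentiable everywhere: \<open>M\<close> and
    \<open>- K\<close> are open and cover the space, and \<open>F\<close> agrees with
    \<open>f\<close> on the first and with 0 on the second.\<close>
  define F where "F x = (if x \<in> M then f x else 0)" for x
  define F' where "F' x = (if x \<in> K then pd i f x else 0)" for x
  have KM: "K \<subseteq> M" using assms by auto
  have openK: "open (- K)" using \<open>compact K\<close> by (simp add: compact_imp_closed open_Compl)
  have F0: "F x = 0" if "x \<notin> K" for x using zero that by (auto simp: F_def)
  have pd0: "pd i f x = 0" if "x \<in> M - K" for x
  proof -
    have "pd i f x = pd i (\<lambda>x. 0) x"
      by (rule pd_cong[of "M \<inter> - K"]) (use that openK zero \<open>open M\<close> in auto)
    then show ?thesis by simp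
  qed
  have FD: "F differentiable at x \<and> pd i F x = F' x" for x
  proof (cases "x \<in> K")
    case True
    then have x: "x \<in> M" using KM by auto
    have "F differentiable at x \<longleftrightarrow> f differentiable at x" "pd i F x = pd i f x"
      using frechet_derivative_cong_open[OF \<open>open M\<close> x, of F f]
      by (auto simp: F_def pd_def)
    then show ?thesis using True x smooth_on_differentiable[OF assms(2)] by (simp add: F'_def)
  next
    case False
    have "F differentiable at x \<longleftrightarrow> (\<lambda>x. 0 :: real) differentiable at x" "pd i F x = pd i (\<lambda>x. 0) x"
      using frechet_derivative_cong_open[OF openK, of x F "\<lambda>x. 0"] False F0
      by (auto simp: pd_def)
    then show ?thesis using False by (simp add: F'_def)
  qed
  have Fline: "((\<lambda>s. F (x + s *\<^sub>R e)) has_real_derivative F' (x + s *\<^sub>R e)) (at s)" for x s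
    using frechet_derivative_line[of F x s e] FD[of "x + s *\<^sub>R e"] by (simp add: pd_def e_def)
  have "continuous_on K (pd i f)"
    using smooth_on_continuous[OF smooth_on_pd[OF assms(2)]] KM continuous_on_subset by blast
  then have "bounded (pd i f ` K)"
    using \<open>compact K\<close> compact_continuous_image compact_imp_bounded by blast
  then obtain L where L: "L > 0" "\<And>x. x \<in> K \<Longrightarrow> \<bar>pd i f x\<bar> \<le> L"
    unfolding bounded_pos by auto
  have F'L: "\<bar>F' x\<bar> \<le> L" for x using L by (auto simp: F'_def)
  have lip: "\<bar>F (x + h *\<^sub>R e) - F x\<bar> \<le> L * \<bar>h\<bar>" for x h
  proof -
    have "norm (F (x + h *\<^sub>R e) - F (x + 0 *\<^sub>R e)) \<le> L * norm (h - 0)"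
      by (rule field_differentiable_bound[of UNIV _ "\<lambda>s. F' (x + s *\<^sub>R e)"])
        (use F'L Fline in \<open>auto intro: has_field_derivative_at_within\<close>)
    then show ?thesis by simp
  qed
  have Fcont: "continuous_on UNIV F"
    using FD by (intro continuous_at_imp_continuous_on) (auto intro: differentiable_imp_continuous_within)
  then have Fmeas[measurable]: "F \<in> borel_measurable borel" by (rule borel_measurable_continuous_onI)
  have Fint: "integrable lborel F"
  proof -
    have "integrable lborel (\<lambda>x. indicator K x *\<^sub>R F x)"
      by (intro borel_integrable_compact \<open>compact K\<close>) (use Fcont continuous_on_subset in blast)
    also have "(\<lambda>x. indicator K x *\<^sub>R F x) = F"
      by (rule ext) (use F0 in \<open>auto simp: indicator_def\<close>)
    finally show ?thesis .
  qed
  define h where "h n = 1 / (real n + 1)" for n :: nat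
  have h: "0 < h n" "h n \<le> 1" for n by (auto simp: h_def)
  have hne: "h n \<noteq> 0" for n using h(1)[of n] by simp
  have hlim: "h \<longlonglongrightarrow> 0" unfolding h_def
    using LIMSEQ_inverse_real_of_nat by (simp add: inverse_eq_divide add.commute)
  define q where "q n x = (F (x + h n *\<^sub>R e) - F x) / h n" for n x
  have plus: "distr lborel borel (\<lambda>x. x + a) = lborel" for a :: "real^'m"
  proof -
    have "(\<lambda>x. x + a) = (+) a" by (rule ext) (rule add.commute)
    then show ?thesis using lborel_distr_plus[of a] by simp
  qed
  have trans: "integrable lborel (\<lambda>x. F (x + a))" "(LINT x|lborel. F (x + a)) = (LINT x|lborel. F x)" for a
  proof -
    have "integrable (distr lborel borel (\<lambda>x. x + a)) F \<longleftrightarrow> integrable lborel (\<lambda>x. F (x + a))"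
      by (rule integrable_distr_eq) auto
    then show "integrable lborel (\<lambda>x. F (x + a))" using Fint by (simp add: plus)
    have "(LINT x|distr lborel borel (\<lambda>x. x + a). F x) = (LINT x|lborel. F (x + a))"
      by (rule integral_distr) auto
    then show "(LINT x|lborel. F (x + a)) = (LINT x|lborel. F x)" by (simp add: plus)
  qed
  have q0: "(LINT x|lborel. q n x) = 0" for n
    unfolding q_def using trans Fint by simp
  \<comment> \<open>All steps \<open>h n\<close> lie in (0, 1], so this compact set contains the
    supports of all difference quotients; \<open>L\<close> times its indicator is an integrable
    majorant for them.\<close>
  define K' where "K' = (\<lambda>(x, s). x + s *\<^sub>R e) ` (K \<times> {-1..0})"
  have "continuous_on (K \<times> {-1..0}) (\<lambda>(x, s). x + s *\<^sub>R e)"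
    unfolding case_prod_beta' by (intro continuous_intros)
  then have cK': "compact K'" unfolding K'_def
    using compact_Times[OF \<open>compact K\<close> compact_Icc] by (rule compact_continuous_image)
  have K': "x \<in> K'" if "x + h n *\<^sub>R e \<in> K \<or> x \<in> K" for n x
    using that
  proof
    assume "x + h n *\<^sub>R e \<in> K"
    then have "(x + h n *\<^sub>R e, - h n) \<in> K \<times> {-1..0}" using h[of n] by auto
    from imageI[OF this, of "\<lambda>(x, s). x + s *\<^sub>R e"] show ?thesis
      unfolding K'_def by simp
  next
    assume "x \<in> K"
    then have "(x, 0) \<in> K \<times> {-1..0::real}" by auto
    from imageI[OF this, of "\<lambda>(x, s). x + s *\<^sub>R e"] show ?thesis
      unfolding K'_def by simp
  qed
  have qb: "norm (q n x) \<le> L * indicator K' x" for n x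
  proof (cases "x \<in> K'")
    case True
    have "\<bar>F (x + h n *\<^sub>R e) - F x\<bar> \<le> L * h n"
      using lip[of x "h n"] h(1)[of n] by simp
    then have "\<bar>F (x + h n *\<^sub>R e) - F x\<bar> / h n \<le> L"
      using h[of n] by (simp add: pos_divide_le_eq)
    then have "\<bar>q n x\<bar> \<le> L" using h(1)[of n] by (simp add: q_def)
    then show ?thesis using True by simp
  next
    case False
    have "F (x + h n *\<^sub>R e) = 0" "F x = 0"
      by (rule F0, use K' False in blast)+
    then show ?thesis using False by (simp add: q_def)
  qed
  have qlim: "(\<lambda>n. q n x) \<longlonglongrightarrow> F' x" for x
  proof -
    have "((\<lambda>s. (F (x + s *\<^sub>R e) - F x) / s) \<longlongrightarrow> F' x) (at 0)"
      using Fline[of x 0] by (simp add: DERIV_def)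
    then have "(\<lambda>n. (F (x + h n *\<^sub>R e) - F x) / h n) \<longlonglongrightarrow> F' x"
      by (rule filterlim_compose) (use hlim hne in \<open>auto simp: filterlim_at\<close>)
    then show ?thesis by (simp only: q_def)
  qed
  have qmeas: "q n \<in> borel_measurable borel" for n
    unfolding q_def[abs_def] by measurable
  have F'meas: "F' \<in> borel_measurable borel"
    by (rule borel_measurable_LIMSEQ_real[OF qlim qmeas])
  have wint: "integrable lborel (\<lambda>x. L * indicator K' x)"
    using cK' emeasure_compact_finite[OF cK']
    by (intro integrable_mult_right integrable_real_indicator)
      (auto intro: borel_closed compact_imp_closed)
  have "(\<lambda>n. LINT x|lborel. q n x) \<longlonglongrightarrow> (LINT x|lborel. F' x)"
    by (rule integral_dominated_convergence[OF _ _ wint])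
      (use F'meas qmeas qlim qb in auto)
  then have "(LINT x|lborel. F' x) = 0"
    unfolding q0 using LIMSEQ_unique tendsto_const by blast
  moreover have "(LINT x:\<Omega>|lborel. pd i f x) = (LINT x|lborel. F' x)"
    unfolding set_lebesgue_integral_def
    by (intro Bochner_Integration.integral_cong)
      (use pd0 assms(4,5) in \<open>auto simp: F'_def indicator_def\<close>)
  ultimately show ?thesis by simp
qed

lemma relatively_compact_integrable_smooth:
  "relatively_compact_in M \<Omega> \<Longrightarrow> open \<Omega> \<Longrightarrow> smooth_on M f \<Longrightarrow> set_integrable lborel \<Omega> f"
  by (intro relatively_compact_integrable smooth_on_continuous)

lemma relatively_compact_integral_const:
  fixes c :: real and \<Omega> :: "'a::euclidean_space set"
  assumes "relatively_compact_in M \<Omega>" "open \<Omega>"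
  shows "(LINT x:\<Omega>|lborel. c) = c * measure lborel \<Omega>"
  using relatively_compact_emeasure[OF assms] assms(2) by (simp add: set_integral_const)

lemma set_integral_near_measure:
  fixes f :: "'a::euclidean_space \<Rightarrow> real"
  assumes \<Omega>: "relatively_compact_in M \<Omega>" "open \<Omega>" and f: "set_integrable lborel \<Omega> f"
    and near: "\<And>x. x \<in> \<Omega> \<Longrightarrow> \<bar>f x - 1\<bar> \<le> \<tau>"
  shows "\<bar>(LINT x:\<Omega>|lborel. f x) - measure lborel \<Omega>\<bar> \<le> \<tau> * measure lborel \<Omega>"
proof -
  have 1: "set_integrable lborel \<Omega> (\<lambda>x. 1 :: real)"
    by (rule relatively_compact_integrable[OF \<Omega>]) (intro continuous_intros)
  show ?thesis
    using set_integral_bound[OF \<Omega> set_integral_diff(1)[OF f 1] near]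
    by (simp add: set_integral_diff(2)[OF f 1] relatively_compact_integral_const[OF \<Omega>])
qed

text \<open>This form, with constant weights and a direction for each summand, serves three times:
  for the divergence term in the action and for the linear terms of both kinds of variation.\<close>

lemma integral_sum_pd_compact_support:
  fixes f :: "'k \<Rightarrow> real ^ 'm::finite \<Rightarrow> real"
  assumes M: "open M" and f: "\<And>i. smooth_on M (f i)" and K: "compact K" "K \<subseteq> \<Omega>"
    and \<Omega>: "relatively_compact_in M \<Omega>" "open \<Omega>" and zero: "\<And>i x. x \<in> M - K \<Longrightarrow> f i x = 0"
  shows "(LINT x:\<Omega>|lborel. (\<Sum>i\<in>I. a i * pd (p i) (f i) x)) = 0"
proof -
  have "\<Omega> \<subseteq> M" using \<Omega> by (simp add: relatively_compact_in_def)
  then have 0: "(LINT x:\<Omega>|lborel. pd (p i) (f i) x) = 0" for i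
    by (rule integral_pd_compact_support[OF M f K _ \<Omega>(2) zero])
  have "set_integrable lborel \<Omega> (\<lambda>x. a i * pd (p i) (f i) x)" for i
    by (intro relatively_compact_integrable_smooth[OF \<Omega>] smooth_on_mult smooth_on_const smooth_on_pd f M)
  then have "(LINT x:\<Omega>|lborel. (\<Sum>i\<in>I. a i * pd (p i) (f i) x))
      = (\<Sum>i\<in>I. (LINT x:\<Omega>|lborel. a i * pd (p i) (f i) x))"
    unfolding set_lebesgue_integral_def set_integrable_def scaleR_sum_right
    by (intro Bochner_Integration.integral_sum)
  then show ?thesis by (simp add: 0)
qed

text \<open>From |sqrt r - 1| * |sqrt r + 1| = |r - 1|, where the second factor is at least 1. It
  carries Lipschitz bounds over from the squared lapse to the lapse and from the determinant to the
  volume density.\<close>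

lemma sqrt_minus_1_bound:
  assumes "r \<ge> 0"
  shows "\<bar>sqrt r - 1\<bar> \<le> \<bar>r - 1\<bar>"
proof -
  have "\<bar>sqrt r - 1\<bar> * 1 \<le> \<bar>sqrt r - 1\<bar> * \<bar>sqrt r + 1\<bar>"
    using assms by (intro mult_left_mono) auto
  also have "\<dots> = \<bar>r - 1\<bar>"
    using assms unfolding abs_mult[symmetric] by (simp add: algebra_simps)
  finally show ?thesis by simp
qed

section \<open>Determinants and inverse matrices\<close>

lemma sum_UNIV_option:
  fixes f :: "'n::finite option \<Rightarrow> 'b::comm_monoid_add"
  shows "(\<Sum>i\<in>UNIV. f i) = f None + (\<Sum>i\<in>UNIV. f (Some i))"
  by (simp add: UNIV_option_conv sum.reindex)

lemma prod_UNIV_option: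
  fixes f :: "'n::finite option \<Rightarrow> 'b::comm_monoid_mult"
  shows "(\<Prod>i\<in>UNIV. f i) = f None * (\<Prod>i\<in>UNIV. f (Some i))"
  by (simp add: UNIV_option_conv prod.reindex)

lemma matrix_inv_mult:
  fixes A :: "real^'m::finite^'m"
  assumes "invertible A"
  shows matrix_mult_inv_right: "A ** matrix_inv A = mat 1"
    and matrix_mult_inv_left: "matrix_inv A ** A = mat 1"
  using someI_ex[OF assms[unfolded invertible_def]] by (simp_all add: matrix_inv_def)

lemma matrix_inv_sums:
  fixes A :: "real^'m::finite^'m"
  assumes "invertible A"
  shows "(\<Sum>k\<in>UNIV. A $ i $ k * matrix_inv A $ k $ j) = (if i = j then 1 else 0)"
    and "(\<Sum>k\<in>UNIV. matrix_inv A $ i $ k * A $ k $ j) = (if i = j then 1 else 0)"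
proof -
  have "(A ** matrix_inv A) $ i $ j = (mat 1 :: real^'m^'m) $ i $ j"
    "(matrix_inv A ** A) $ i $ j = (mat 1 :: real^'m^'m) $ i $ j"
    by (simp_all only: matrix_mult_inv_right[OF assms] matrix_mult_inv_left[OF assms])
  then show "(\<Sum>k\<in>UNIV. A $ i $ k * matrix_inv A $ k $ j) = (if i = j then 1 else 0)"
    and "(\<Sum>k\<in>UNIV. matrix_inv A $ i $ k * A $ k $ j) = (if i = j then 1 else 0)"
    by (simp_all add: matrix_matrix_mult_def mat_def)
qed

lemma matrix_inv_symmetric:
  fixes A :: "real^'m::finite^'m"
  assumes "invertible A" "transpose A = A"
  shows "matrix_inv A $ i $ j = matrix_inv A $ j $ i"
proof -
  have "transpose (matrix_inv A) ** A = mat 1"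
    using arg_cong[OF matrix_mult_inv_right[OF assms(1)], of transpose] assms(2)
    by (simp add: matrix_transpose_mul)
  then have "transpose (matrix_inv A) ** A ** matrix_inv A = matrix_inv A"
    by simp
  then have "transpose (matrix_inv A) = matrix_inv A"
    by (simp only: matrix_mul_assoc[symmetric] matrix_mult_inv_right[OF assms(1)] matrix_mul_rid)
  then have "transpose (matrix_inv A) $ j $ i = matrix_inv A $ j $ i" by simp
  then show ?thesis by (simp add: transpose_def)
qed

text \<open>Cramer's rule makes the entries of the inverse quotients of determinants, that is,
  rational functions of the entries; smoothness of the inverse metric and of the Christoffel symbols
  follows from it.\<close>

lemma matrix_inv_cramer:
  fixes A :: "real^'m::finite^'m"
  assumes "invertible A"
  shows "matrix_inv A $ k $ l
    = det (\<chi> i j. if j = k then (if i = l then 1 else 0) else A $ i $ j) / det A"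
proof -
  have "A *v (\<chi> r. matrix_inv A $ r $ l) = (\<chi> i. if i = l then 1 else 0)"
    by (simp add: vec_eq_iff matrix_vector_mult_def matrix_inv_sums(1)[OF assms])
  moreover have "det A \<noteq> 0" using assms by (simp add: invertible_det_nz)
  ultimately have "(\<chi> r. matrix_inv A $ r $ l) = (\<chi> k. det (\<chi> i j. if j = k
      then (\<chi> i. if i = l then 1 else 0) $ i else A $ i $ j) / det A)"
    using cramer[of A "\<chi> r. matrix_inv A $ r $ l" "\<chi> i. if i = l then 1 else 0"] by blast
  then have "(\<chi> r. matrix_inv A $ r $ l) $ k = (\<chi> k. det (\<chi> i j. if j = k
      then (\<chi> i. if i = l then 1 else 0) $ i else A $ i $ j) / det A) $ k"
    by (rule arg_cong)
  then show ?thesis by (simp only: vec_lambda_beta)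
qed

lemma smooth_on_det:
  fixes A :: "'a::euclidean_space \<Rightarrow> real^'m::finite^'m"
  assumes "open S" "\<And>i j. smooth_on S (\<lambda>x. A x $ i $ j)"
  shows "smooth_on S (\<lambda>x. det (A x))"
  unfolding det_def
  by (intro smooth_on_sum smooth_on_mult smooth_on_prod smooth_on_const assms)

lemma smooth_on_matrix_inv:
  fixes A :: "'a::euclidean_space \<Rightarrow> real^'m::finite^'m"
  assumes "open S" "\<And>i j. smooth_on S (\<lambda>x. A x $ i $ j)" "\<And>x. x \<in> S \<Longrightarrow> invertible (A x)"
  shows "smooth_on S (\<lambda>x. matrix_inv (A x) $ k $ l)"
proof -
  have "smooth_on S (\<lambda>x. det (\<chi> i j. if j = k then (if i = l then 1 else 0) else A x $ i $ j)
      / det (A x))"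
  proof (intro smooth_on_divide smooth_on_det assms)
    show "smooth_on S (\<lambda>x. (\<chi> i j. if j = k then (if i = l then 1 else 0) else A x $ i $ j) $ i $ j)"
      for i j
      by (cases "j = k"; cases "i = l") (simp_all add: smooth_on_const assms)
    show "det (A x) \<noteq> 0" if "x \<in> S" for x
      using assms(3)[OF that] by (simp add: invertible_det_nz)
  qed
  then show ?thesis
    by (rule smooth_on_cong[THEN iffD1, rotated 2]) (simp_all add: matrix_inv_cramer assms)
qed

lemma differentiable_det:
  fixes A :: "'a::real_normed_vector \<Rightarrow> real^'m::finite^'m"
  assumes "\<And>i j. (\<lambda>z. A z $ i $ j) differentiable at x"
  shows "(\<lambda>z. det (A z)) differentiable at x"
proof -
  have "(\<lambda>z. \<Prod>i\<in>UNIV. A z $ i $ p i) differentiable at x" for p :: "'m \<Rightarrow> 'm"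
  proof -
    have "((\<lambda>z. A z $ i $ p i) has_derivative frechet_derivative (\<lambda>z. A z $ i $ p i) (at x)) (at x)" for i
      using assms by (simp add: frechet_derivative_works[symmetric])
    then show ?thesis by (intro differentiableI[OF has_derivative_prod])
  qed
  then show ?thesis
    unfolding det_def by (intro differentiable_sum differentiable_mult differentiable_const) auto
qed

text \<open>A permutation other than the identity moves at least two indices, \<open>a\<close> and
  \<open>p a\<close>. In each term of the product rule one factor is differentiated, and at the
  identity matrix one of the remaining factors vanishes. Only the identity permutation contributes,
  and it gives the trace.\<close>

lemma pd_det_identity:
  fixes A :: "real^'k::finite \<Rightarrow> real^'m::finite^'m"
  assumes d: "\<And>i j. (\<lambda>z. A z $ i $ j) differentiable at x" and 1: "A x = mat 1"
  shows "pd l (\<lambda>z. det (A z)) x = (\<Sum>i\<in>UNIV. pd l (\<lambda>z. A z $ i $ i) x)"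
proof -
  let ?P = "{p. p permutes (UNIV :: 'm set)}"
  have dp: "((\<lambda>z. \<Prod>i\<in>UNIV. A z $ i $ p i) has_derivative
      (\<lambda>v. \<Sum>i\<in>UNIV. frechet_derivative (\<lambda>z. A z $ i $ p i) (at x) v * (\<Prod>j\<in>UNIV - {i}. A x $ j $ p j))) (at x)"
    for p :: "'m \<Rightarrow> 'm"
    by (rule has_derivative_prod) (use d in \<open>simp add: frechet_derivative_works[symmetric]\<close>)
  have pd_prod: "pd l (\<lambda>z. \<Prod>i\<in>UNIV. A z $ i $ p i) x
      = (\<Sum>i\<in>UNIV. pd l (\<lambda>z. A z $ i $ p i) x * (\<Prod>j\<in>UNIV - {i}. A x $ j $ p j))" for p :: "'m \<Rightarrow> 'm"
    using pd_has_derivative[OF dp[of p], of l] by (simp only: pd_def)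
  have pdp: "pd l (\<lambda>z. \<Prod>i\<in>UNIV. A z $ i $ p i) x = (if p = id then (\<Sum>i\<in>UNIV. pd l (\<lambda>z. A z $ i $ i) x) else 0)"
    if p: "p \<in> ?P" for p
  proof (cases "p = id")
    case True
    then show ?thesis
      by (simp add: pd_prod 1 mat_def)
  next
    case False
    then obtain a where a: "p a \<noteq> a" by (auto simp: fun_eq_iff)
    have "inj p" using p by (simp add: permutes_inj)
    then have a2: "p (p a) \<noteq> p a" using a by (simp add: inj_eq)
    have "(\<Prod>j\<in>UNIV - {i}. A x $ j $ p j) = 0" for i
    proof (rule prod_zero)
      have "a \<in> UNIV - {i} \<or> p a \<in> UNIV - {i}" using a by auto
      moreover have "A x $ a $ p a = 0" "A x $ p a $ p (p a) = 0"
        using a a2 by (simp_all add: 1 mat_def)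
      ultimately show "\<exists>j\<in>UNIV - {i}. A x $ j $ p j = 0" by blast
    qed simp
    then show ?thesis using False by (simp add: pd_prod del: prod_zero_iff)
  qed
  have "pd l (\<lambda>z. det (A z)) x = (\<Sum>p\<in>?P. pd l (\<lambda>z. of_int (sign p) * (\<Prod>i\<in>UNIV. A z $ i $ p i)) x)"
    unfolding det_def
    by (rule pd_sum) (intro derivative_intros, use dp in \<open>auto simp: differentiable_def\<close>)
  also have "\<dots> = (\<Sum>p\<in>?P. if p = id then (\<Sum>i\<in>UNIV. pd l (\<lambda>z. A z $ i $ i) x) else 0)"
  proof (rule sum.cong)
    fix p assume p: "p \<in> ?P"
    have "(\<lambda>z. \<Prod>i\<in>UNIV. A z $ i $ p i) differentiable at x"
      using dp by (auto simp: differentiable_def)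
    then show "pd l (\<lambda>z. of_int (sign p) * (\<Prod>i\<in>UNIV. A z $ i $ p i)) x
        = (if p = id then (\<Sum>i\<in>UNIV. pd l (\<lambda>z. A z $ i $ i) x) else 0)"
      by (auto simp: pd_cmult pdp[OF p] sign_id)
  qed simp
  also have "\<dots> = (\<Sum>i\<in>UNIV. pd l (\<lambda>z. A z $ i $ i) x)"
    by (simp add: permutes_id finite_permutations)
  finally show ?thesis .
qed

text \<open>Jacobi's formula. Multiplying by the constant matrix \<open>matrix_inv (A x)\<close>
  moves the base point to the identity matrix, where the derivative of the determinant is the
  trace.\<close>

lemma pd_det:
  fixes A :: "real^'k::finite \<Rightarrow> real^'m::finite^'m"
  assumes d: "\<And>i j. (\<lambda>z. A z $ i $ j) differentiable at x" and inv: "invertible (A x)"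
  shows "pd l (\<lambda>z. det (A z)) x
    = det (A x) * (\<Sum>i\<in>UNIV. \<Sum>j\<in>UNIV. matrix_inv (A x) $ i $ j * pd l (\<lambda>z. A z $ j $ i) x)"
proof -
  define C where "C z = matrix_inv (A x) ** A z" for z
  have C: "C z $ i $ k = (\<Sum>j\<in>UNIV. matrix_inv (A x) $ i $ j * A z $ j $ k)" for z i k
    by (simp add: C_def matrix_matrix_mult_def)
  have dC: "(\<lambda>z. C z $ i $ k) differentiable at x" for i k
    unfolding C by (intro differentiable_sum ballI differentiable_mult differentiable_const d finite)
  have "det (A z) = det (A x) * det (C z)" for z
  proof -
    have "A z = A x ** C z"
      by (simp add: C_def matrix_mul_assoc matrix_mult_inv_right[OF inv])
    from arg_cong[OF this, of det] show ?thesis by (simp only: det_mul)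
  qed
  then have "(\<lambda>z. det (A z)) = (\<lambda>z. det (A x) * det (C z))"
    by (rule ext)
  then have "pd l (\<lambda>z. det (A z)) x = pd l (\<lambda>z. det (A x) * det (C z)) x"
    by (rule arg_cong)
  also have "\<dots> = det (A x) * pd l (\<lambda>z. det (C z)) x"
    by (rule pd_cmult[OF differentiable_det[OF dC]])
  also have "pd l (\<lambda>z. det (C z)) x = (\<Sum>i\<in>UNIV. pd l (\<lambda>z. C z $ i $ i) x)"
    by (rule pd_det_identity[OF dC]) (simp add: C_def matrix_mult_inv_left[OF inv])
  also have "\<dots> = (\<Sum>i\<in>UNIV. \<Sum>j\<in>UNIV. matrix_inv (A x) $ i $ j * pd l (\<lambda>z. A z $ j $ i) x)"
    unfolding C using d by (simp add: pd_sum pd_cmult)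
  finally show ?thesis .
qed

section \<open>The Ricci curvature of a vector field as a divergence\<close>

lemma gform_sum:
  "gform G v w = (\<Sum>i\<in>UNIV. \<Sum>j\<in>UNIV. G $ i $ j * v $ i * w $ j)"
  by (simp add: gform_def inner_vec_def matrix_vector_mult_def sum_distrib_left mult_ac)

lemma gform_commute:
  assumes "transpose G = G"
  shows "gform G v w = gform G w v"
  unfolding gform_def using assms by (metis dot_lmul_matrix inner_commute transpose_matrix_vector)

lemma gform_add: "gform G (u + v) w = gform G u w + gform G v w"
  "gform G w (u + v) = gform G w u + gform G w v"
  by (simp_all add: gform_def inner_left_distrib inner_right_distrib matrix_vector_right_distrib)

lemma gform_diff: "gform G (u - v) w = gform G u w - gform G v w"
  "gform G w (u - v) = gform G w u - gform G w v"
  by (simp_all add: gform_def inner_diff_left inner_diff_right matrix_vector_mult_diff_distrib)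

lemma gform_scaleR: "gform G (r *\<^sub>R u) w = r * gform G u w" "gform G w (r *\<^sub>R u) = r * gform G w u"
  by (simp_all add: gform_def matrix_vector_mult_scaleR)

lemma gform_zero: "gform G 0 w = 0" "gform G w 0 = 0"
  by (simp_all add: gform_def)

lemma gform_sum_right: "gform G w (\<Sum>i\<in>A. f i) = (\<Sum>i\<in>A. gform G w (f i))"
  by (induction A rule: infinite_finite_induct) (auto simp: gform_add gform_zero)

lemma gform_axis:
  fixes G :: "real^'m::finite^'m"
  shows gform_axis_right: "gform G v (axis i 1) = (\<Sum>k\<in>UNIV. G $ k $ i * v $ k)"
    and gform_axis_left: "gform G (axis i 1) v = (\<Sum>k\<in>UNIV. G $ i $ k * v $ k)"
proof -
  have [simp]: "a * (axis i 1 :: real^'m) $ k = (if k = i then a else 0)"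
    "(\<Sum>k\<in>UNIV. if k = i then f k else 0) = f i" for a :: real and i k :: 'm and f :: "'m \<Rightarrow> real"
    by (simp_all add: axis_def)
  show "gform G v (axis i 1) = (\<Sum>k\<in>UNIV. G $ k $ i * v $ k)"
    by (simp add: gform_sum)
  show "gform G (axis i 1) v = (\<Sum>k\<in>UNIV. G $ i $ k * v $ k)"
    unfolding gform_sum by (subst sum.swap) (simp add: if_distrib[of "\<lambda>a. a * _"] cong: if_cong)
qed

text \<open>The component of index \<open>l\<close> of the covariant derivative of \<open>N\<close>
  in the coordinate direction \<open>k\<close>. Unlike \<open>cov_deriv\<close> it is a scalar
  function of the point, so it can be differentiated again.\<close>

definition cov_diff :: "'m::finite metric \<Rightarrow> (real^'m \<Rightarrow> real^'m) \<Rightarrow> 'm \<Rightarrow> 'm \<Rightarrow> real^'m \<Rightarrow> real" where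
  "cov_diff h N k l x = pd k (\<lambda>z. N z $ l) x + (\<Sum>m\<in>UNIV. christoffel h l k m x * N x $ m)"

text \<open>The trace of X \<mapsto> R(X, Y)Z in components, with Y and Z the coordinate vectors of
  indices \<open>j\<close> and \<open>k\<close>: the coefficients in \<open>riemann\<close> with
  upper index and first lower index contracted.\<close>

definition ricci :: "'m::finite metric \<Rightarrow> 'm \<Rightarrow> 'm \<Rightarrow> real^'m \<Rightarrow> real" where
  "ricci h j k x = (\<Sum>l\<in>UNIV. pd l (christoffel h l j k) x - pd j (christoffel h l l k) x +
      (\<Sum>m\<in>UNIV. christoffel h l l m x * christoffel h m j k x
              - christoffel h l j m x * christoffel h m l k x))"

lemma pseudo_riemannian_metricD:
  assumes "pseudo_riemannian_metric M h"
  shows "smooth_on M (\<lambda>x. h x $ i $ j)"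
    and "x \<in> M \<Longrightarrow> transpose (h x) = h x" and "x \<in> M \<Longrightarrow> invertible (h x)"
    and "x \<in> M \<Longrightarrow> h x $ i $ j = h x $ j $ i"
proof -
  show "smooth_on M (\<lambda>x. h x $ i $ j)" and "x \<in> M \<Longrightarrow> invertible (h x)"
    and t: "x \<in> M \<Longrightarrow> transpose (h x) = h x"
    using assms by (auto simp: pseudo_riemannian_metric_def)
  show "h x $ i $ j = h x $ j $ i" if "x \<in> M"
  proof -
    have "transpose (h x) $ i $ j = h x $ i $ j" using t[OF that] by simp
    then show ?thesis by (simp add: transpose_def)
  qed
qed

section \<open>Christoffel symbols and the derivative of the volume density\<close>

context
  fixes M :: "(real^'m::finite) set" and h :: "'m metric"
  assumes M: "open M" and h: "pseudo_riemannian_metric M h"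
begin

lemma pd_metric_commute: "x \<in> M \<Longrightarrow> pd l (\<lambda>z. h z $ i $ j) x = pd l (\<lambda>z. h z $ j $ i) x"
  by (rule pd_cong[OF M]) (use pseudo_riemannian_metricD(4)[OF h] in auto)

lemma christoffel_commute: "x \<in> M \<Longrightarrow> christoffel h k i j x = christoffel h k j i x"
  unfolding christoffel_def by (simp add: pd_metric_commute[of x _ j i] algebra_simps)

lemma smooth_on_christoffel: "smooth_on M (christoffel h k i j)"
  unfolding christoffel_def[abs_def]
  by (intro smooth_intros smooth_on_matrix_inv M pseudo_riemannian_metricD[OF h])

lemma christoffel_lower:
  assumes "x \<in> M"
  shows "(\<Sum>k\<in>UNIV. h x $ m $ k * christoffel h k i j x)
    = 1/2 * (pd i (\<lambda>z. h z $ j $ m) x + pd j (\<lambda>z. h z $ i $ m) x - pd m (\<lambda>z. h z $ i $ j) x)"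
proof -
  define a where "a l = pd i (\<lambda>z. h z $ j $ l) x + pd j (\<lambda>z. h z $ i $ l) x - pd l (\<lambda>z. h z $ i $ j) x" for l
  have "(\<Sum>k\<in>UNIV. h x $ m $ k * christoffel h k i j x)
      = (\<Sum>k\<in>UNIV. \<Sum>l\<in>UNIV. 1/2 * (h x $ m $ k * matrix_inv (h x) $ k $ l) * a l)"
    unfolding christoffel_def a_def[symmetric] by (simp add: sum_distrib_left mult_ac)
  also have "\<dots> = (\<Sum>l\<in>UNIV. 1/2 * (\<Sum>k\<in>UNIV. h x $ m $ k * matrix_inv (h x) $ k $ l) * a l)"
    by (subst sum.swap) (simp add: sum_distrib_left sum_distrib_right)
  also have "\<dots> = (\<Sum>l\<in>UNIV. if m = l then 1/2 * a l else 0)"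
    by (intro sum.cong) (simp_all add: matrix_inv_sums pseudo_riemannian_metricD(3)[OF h] assms)
  finally show ?thesis by (simp add: a_def)
qed

text \<open>Of the three derivatives in the Christoffel symbol, the first and the last cancel under
  the trace, since the metric and its inverse are symmetric. What remains is half the trace of the
  inverse metric times the derivative of the metric, the expression in Jacobi's formula.\<close>

lemma christoffel_trace:
  assumes "x \<in> M"
  shows "(\<Sum>m\<in>UNIV. christoffel h m m l x)
    = 1/2 * (\<Sum>m\<in>UNIV. \<Sum>p\<in>UNIV. matrix_inv (h x) $ m $ p * pd l (\<lambda>z. h z $ p $ m) x)"
proof -
  define I where "I = matrix_inv (h x)"
  have I: "I $ i $ j = I $ j $ i" for i j
    unfolding I_def by (rule matrix_inv_symmetric) (use pseudo_riemannian_metricD[OF h] assms in auto)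
  have "I $ m $ p * pd p (\<lambda>z. h z $ m $ l) x = I $ p $ m * pd p (\<lambda>z. h z $ l $ m) x" for m p
    by (simp add: I[of m p] pd_metric_commute[OF assms, of p m l])
  then have 1: "(\<Sum>m\<in>UNIV. \<Sum>p\<in>UNIV. I $ m $ p * pd p (\<lambda>z. h z $ m $ l) x)
      = (\<Sum>m\<in>UNIV. \<Sum>p\<in>UNIV. I $ m $ p * pd m (\<lambda>z. h z $ l $ p) x)"
    by (simp only:) (rule sum.swap)
  have 2: "(\<Sum>m\<in>UNIV. 1/2 * (\<Sum>p\<in>UNIV. I $ m $ p * (a m p + b m p - c m p)))
      = 1/2 * ((\<Sum>m\<in>UNIV. \<Sum>p\<in>UNIV. I $ m $ p * a m p) + (\<Sum>m\<in>UNIV. \<Sum>p\<in>UNIV. I $ m $ p * b m p)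
        - (\<Sum>m\<in>UNIV. \<Sum>p\<in>UNIV. I $ m $ p * c m p))" for a b c :: "'m \<Rightarrow> 'm \<Rightarrow> real"
    by (simp only: sum_distrib_left[symmetric] distrib_left right_diff_distrib sum.distrib sum_subtractf)
  show ?thesis
    unfolding christoffel_def I_def[symmetric] 2 1
    by (simp add: pd_metric_commute[OF assms, of l])
qed

context
  assumes det_pos: "\<And>x. x \<in> M \<Longrightarrow> det (h x) > 0"
begin

lemma smooth_on_vol_density: "smooth_on M (vol_density h)"
proof -
  have "smooth_on M (\<lambda>x. sqrt (det (h x)))"
    by (intro smooth_on_sqrt smooth_on_det M pseudo_riemannian_metricD[OF h] det_pos)
  then show ?thesis
    by (rule smooth_on_cong[THEN iffD1, rotated 2]) (use det_pos in \<open>auto simp: vol_density_def M abs_of_pos\<close>)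
qed

text \<open>This makes the ordinary divergence of \<open>vol_density h\<close> times a vector field
  equal to the density times its covariant divergence, so that covariant divergences integrate like
  sums of partial derivatives.\<close>

lemma pd_vol_density:
  assumes x: "x \<in> M"
  shows "pd l (vol_density h) x = vol_density h x * (\<Sum>m\<in>UNIV. christoffel h m m l x)"
proof -
  have d: "(\<lambda>x. det (h x)) differentiable at x"
    by (intro smooth_on_differentiable[OF smooth_on_det[OF M]] pseudo_riemannian_metricD[OF h] x)
  have "pd l (vol_density h) x = pd l (\<lambda>x. sqrt (det (h x))) x"
    by (rule pd_cong[OF M x]) (use det_pos in \<open>auto simp: vol_density_def abs_of_pos\<close>)
  also have "\<dots> = inverse (sqrt (det (h x))) / 2 * pd l (\<lambda>x. det (h x)) x"
    by (rule pd_real_compose[OF d DERIV_real_sqrt]) (rule det_pos[OF x])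
  also have "pd l (\<lambda>x. det (h x)) x = det (h x) * (2 * (\<Sum>m\<in>UNIV. christoffel h m m l x))"
    unfolding christoffel_trace[OF x]
    by (subst pd_det) (auto intro!: smooth_on_differentiable[OF _ x] pseudo_riemannian_metricD[OF h] x)
  also have "inverse (sqrt (det (h x))) / 2 * (det (h x) * (2 * (\<Sum>m\<in>UNIV. christoffel h m m l x)))
      = vol_density h x * (\<Sum>m\<in>UNIV. christoffel h m m l x)"
    using det_pos[OF x] real_sqrt_mult_self[of "det (h x)"] unfolding vol_density_def
    by (simp add: field_simps)
  finally show ?thesis .
qed

end

end

text \<open>With \<open>n k\<close>, \<open>p k l\<close>, \<open>q i k l\<close> standing for $N^k$, $\partial_k N^l$,
  $\partial_i\partial_k N^l$, \<open>G l j k\<close>, \<open>dG i l j k\<close> for $\Gamma^l_{jk}$,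
  $\partial_i\Gamma^l_{jk}$ and \<open>b k l\<close>, \<open>db i k l\<close> for $\nabla_k N^l$, $\partial_i(\nabla_k N^l)$,
  this is the identity
  $\nabla_l(N^k\nabla_kN^l - N^l\nabla_kN^k) + (\nabla_kN^k)^2 - \nabla_lN^k\nabla_kN^l
    = \mathrm{Ric}_{jk}N^jN^k$.\<close>

lemma ricci_identity_algebra:
  fixes n :: "'m::finite \<Rightarrow> real" and p :: "'m \<Rightarrow> 'm \<Rightarrow> real" and q G :: "'m \<Rightarrow> 'm \<Rightarrow> 'm \<Rightarrow> real"
    and dG :: "'m \<Rightarrow> 'm \<Rightarrow> 'm \<Rightarrow> 'm \<Rightarrow> real"
  assumes qs: "\<And>i k l. q i k l = q k i l" and Gs: "\<And>l j k. G l j k = G l k j"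
    and b: "\<And>k l. b k l = p k l + (\<Sum>m\<in>UNIV. G l k m * n m)"
    and db: "\<And>i k l. db i k l = q i k l + (\<Sum>m\<in>UNIV. G l k m * p i m + dG i l k m * n m)"
  shows "(\<Sum>l\<in>UNIV. (\<Sum>m\<in>UNIV. G m m l) * ((\<Sum>k\<in>UNIV. n k * b k l) - n l * (\<Sum>k\<in>UNIV. b k k))
      + ((\<Sum>k\<in>UNIV. n k * db l k l + p l k * b k l) - (n l * (\<Sum>k\<in>UNIV. db l k k) + p l l * (\<Sum>k\<in>UNIV. b k k))))
    + ((\<Sum>k\<in>UNIV. b k k)\<^sup>2 - (\<Sum>l\<in>UNIV. \<Sum>k\<in>UNIV. b l k * b k l))
    = (\<Sum>j\<in>UNIV. \<Sum>k\<in>UNIV. (\<Sum>l\<in>UNIV. dG l l j k - dG j l l k +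
      (\<Sum>m\<in>UNIV. G l l m * G m j k - G l j m * G m l k)) * n j * n k)"
proof -
  define c where "c l = (\<Sum>m\<in>UNIV. G m m l)" for l
  define t where "t = (\<Sum>k\<in>UNIV. b k k)"
  have t: "t = (\<Sum>k\<in>UNIV. p k k) + (\<Sum>l\<in>UNIV. c l * n l)"
  proof -
    have "(\<Sum>k\<in>UNIV. \<Sum>m\<in>UNIV. G k k m * n m) = (\<Sum>l\<in>UNIV. c l * n l)"
      by (subst sum.swap) (simp add: c_def sum_distrib_right)
    then show ?thesis by (simp add: t_def b sum.distrib)
  qed
  \<comment> \<open>The squared divergence of the field is cancelled by exactly the terms that
    contain the factor \<open>t\<close>.\<close>
  have 1: "(\<Sum>l\<in>UNIV. c l * (n l * t) + p l l * t) = t\<^sup>2"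
  proof -
    have "(\<Sum>l\<in>UNIV. c l * (n l * t) + p l l * t) = ((\<Sum>k\<in>UNIV. p k k) + (\<Sum>l\<in>UNIV. c l * n l)) * t"
      unfolding distrib_right sum_distrib_right sum.distrib[symmetric]
      by (intro sum.cong refl) simp
    then show ?thesis by (simp only: t[symmetric] power2_eq_square)
  qed
  have 2: "(\<Sum>l\<in>UNIV. \<Sum>k\<in>UNIV. p l k * b k l) - (\<Sum>l\<in>UNIV. \<Sum>k\<in>UNIV. b l k * b k l)
      = - (\<Sum>l\<in>UNIV. \<Sum>k\<in>UNIV. \<Sum>m\<in>UNIV. G k l m * n m * p k l)
        - (\<Sum>l\<in>UNIV. \<Sum>k\<in>UNIV. \<Sum>m\<in>UNIV. \<Sum>r\<in>UNIV. G k l m * n m * (G l k r * n r))"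
  proof -
    have "(\<Sum>l\<in>UNIV. \<Sum>k\<in>UNIV. p l k * b k l) - (\<Sum>l\<in>UNIV. \<Sum>k\<in>UNIV. b l k * b k l)
      = - (\<Sum>l\<in>UNIV. \<Sum>k\<in>UNIV. (b l k - p l k) * b k l)"
      by (simp add: sum_subtractf left_diff_distrib)
    also have "\<dots> = - (\<Sum>l\<in>UNIV. \<Sum>k\<in>UNIV. (\<Sum>m\<in>UNIV. G k l m * n m) * (p k l + (\<Sum>r\<in>UNIV. G l k r * n r)))"
      by (simp add: b)
    finally show ?thesis
      unfolding distrib_left sum.distrib sum_product by (simp add: sum_distrib_right)
  qed
  have 3: "(\<Sum>l\<in>UNIV. c l * (\<Sum>k\<in>UNIV. n k * b k l))
      = (\<Sum>l\<in>UNIV. \<Sum>k\<in>UNIV. c l * n k * p k l)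
        + (\<Sum>l\<in>UNIV. \<Sum>k\<in>UNIV. \<Sum>r\<in>UNIV. c l * n k * (G l k r * n r))"
    by (simp add: b distrib_left sum.distrib sum_distrib_left mult.assoc)
  have 4: "(\<Sum>l\<in>UNIV. \<Sum>k\<in>UNIV. n k * db l k l)
      = (\<Sum>l\<in>UNIV. \<Sum>k\<in>UNIV. n k * q l k l) + (\<Sum>l\<in>UNIV. \<Sum>k\<in>UNIV. \<Sum>m\<in>UNIV. n k * (G l k m * p l m))
        + (\<Sum>l\<in>UNIV. \<Sum>k\<in>UNIV. \<Sum>m\<in>UNIV. n k * (dG l l k m * n m))"
    by (simp add: db distrib_left sum.distrib sum_distrib_left)
  have 5: "(\<Sum>l\<in>UNIV. n l * (\<Sum>k\<in>UNIV. db l k k))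
      = (\<Sum>l\<in>UNIV. \<Sum>k\<in>UNIV. n l * q l k k) + (\<Sum>l\<in>UNIV. \<Sum>k\<in>UNIV. \<Sum>m\<in>UNIV. n l * (G k k m * p l m))
        + (\<Sum>l\<in>UNIV. \<Sum>k\<in>UNIV. \<Sum>m\<in>UNIV. n l * (dG l k k m * n m))"
    by (simp add: db distrib_left sum.distrib sum_distrib_left)
  \<comment> \<open>Second derivatives of the field cancel by their symmetry. The next two equations
    cancel the terms with one first derivative, leaving expressions that are quadratic in
    \<open>n\<close> without derivatives of \<open>n\<close>.\<close>
  have E1: "(\<Sum>l\<in>UNIV. \<Sum>k\<in>UNIV. n k * q l k l) = (\<Sum>l\<in>UNIV. \<Sum>k\<in>UNIV. n l * q l k k)"
    by (subst sum.swap, intro sum.cong refl) (simp only: qs)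
  have E2: "(\<Sum>l\<in>UNIV. \<Sum>k\<in>UNIV. \<Sum>m\<in>UNIV. n k * (G l k m * p l m))
      = (\<Sum>l\<in>UNIV. \<Sum>k\<in>UNIV. \<Sum>m\<in>UNIV. G k l m * n m * p k l)"
  proof -
    have "(\<Sum>l\<in>UNIV. \<Sum>k\<in>UNIV. \<Sum>m\<in>UNIV. n k * (G l k m * p l m))
        = (\<Sum>l\<in>UNIV. \<Sum>m\<in>UNIV. \<Sum>k\<in>UNIV. n k * (G l k m * p l m))"
      by (rule sum.cong[OF refl]) (rule sum.swap)
    also have "\<dots> = (\<Sum>m\<in>UNIV. \<Sum>l\<in>UNIV. \<Sum>k\<in>UNIV. n k * (G l k m * p l m))"
      by (rule sum.swap)
    also have "\<dots> = (\<Sum>m\<in>UNIV. \<Sum>l\<in>UNIV. \<Sum>k\<in>UNIV. G l m k * n k * p l m)"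
    proof -
      have "n k * (G l k m * p l m) = G l m k * n k * p l m" for l k m
        by (simp add: Gs[of l k m])
      then show ?thesis by (simp only:)
    qed
    finally show ?thesis .
  qed
  have E3: "(\<Sum>l\<in>UNIV. \<Sum>k\<in>UNIV. \<Sum>m\<in>UNIV. n l * (G k k m * p l m)) = (\<Sum>l\<in>UNIV. \<Sum>k\<in>UNIV. c l * n k * p k l)"
  proof -
    have "(\<Sum>l\<in>UNIV. \<Sum>k\<in>UNIV. \<Sum>m\<in>UNIV. n l * (G k k m * p l m))
        = (\<Sum>l\<in>UNIV. \<Sum>m\<in>UNIV. \<Sum>k\<in>UNIV. n l * (G k k m * p l m))"
      by (rule sum.cong[OF refl]) (rule sum.swap)
    also have "\<dots> = (\<Sum>l\<in>UNIV. \<Sum>m\<in>UNIV. c m * n l * p l m)"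
      by (simp add: c_def sum_distrib_left sum_distrib_right mult_ac)
    also have "\<dots> = (\<Sum>m\<in>UNIV. \<Sum>l\<in>UNIV. c m * n l * p l m)"
      by (rule sum.swap)
    finally show ?thesis .
  qed
  have "(\<Sum>l\<in>UNIV. c l * ((\<Sum>k\<in>UNIV. n k * b k l) - n l * t)
      + ((\<Sum>k\<in>UNIV. n k * db l k l + p l k * b k l) - (n l * (\<Sum>k\<in>UNIV. db l k k) + p l l * t)))
      + (t\<^sup>2 - (\<Sum>l\<in>UNIV. \<Sum>k\<in>UNIV. b l k * b k l))
    = (\<Sum>l\<in>UNIV. c l * (\<Sum>k\<in>UNIV. n k * b k l)) + (\<Sum>l\<in>UNIV. \<Sum>k\<in>UNIV. n k * db l k l)
      - (\<Sum>l\<in>UNIV. n l * (\<Sum>k\<in>UNIV. db l k k))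
      + ((\<Sum>l\<in>UNIV. \<Sum>k\<in>UNIV. p l k * b k l) - (\<Sum>l\<in>UNIV. \<Sum>k\<in>UNIV. b l k * b k l))
      + (t\<^sup>2 - (\<Sum>l\<in>UNIV. c l * (n l * t) + p l l * t))"
    by (simp add: right_diff_distrib sum.distrib sum_subtractf)
  also have "\<dots> = (\<Sum>l\<in>UNIV. \<Sum>k\<in>UNIV. \<Sum>m\<in>UNIV. n k * (dG l l k m * n m))
      - (\<Sum>l\<in>UNIV. \<Sum>k\<in>UNIV. \<Sum>m\<in>UNIV. n l * (dG l k k m * n m))
      + (\<Sum>l\<in>UNIV. \<Sum>k\<in>UNIV. \<Sum>r\<in>UNIV. c l * n k * (G l k r * n r))
      - (\<Sum>l\<in>UNIV. \<Sum>k\<in>UNIV. \<Sum>m\<in>UNIV. \<Sum>r\<in>UNIV. G k l m * n m * (G l k r * n r))"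
    unfolding 1 2 3 4 5 E1 E2 E3 by simp
  \<comment> \<open>The four surviving sums are the four groups of terms in the Ricci tensor up to
    renaming of indices; the last one also uses the symmetry \<open>Gs\<close>.\<close>
  also have "(\<Sum>l\<in>UNIV. \<Sum>k\<in>UNIV. \<Sum>m\<in>UNIV. n k * (dG l l k m * n m))
      = (\<Sum>j\<in>UNIV. \<Sum>k\<in>UNIV. \<Sum>l\<in>UNIV. dG l l j k * n j * n k)" (is "_ = ?R1")
  proof -
    have "(\<Sum>l\<in>UNIV. \<Sum>k\<in>UNIV. \<Sum>m\<in>UNIV. n k * (dG l l k m * n m))
        = (\<Sum>k\<in>UNIV. \<Sum>l\<in>UNIV. \<Sum>m\<in>UNIV. n k * (dG l l k m * n m))"
      by (rule sum.swap)
    also have "\<dots> = (\<Sum>k\<in>UNIV. \<Sum>m\<in>UNIV. \<Sum>l\<in>UNIV. n k * (dG l l k m * n m))"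
      by (rule sum.cong[OF refl]) (rule sum.swap)
    finally show ?thesis by (simp add: mult_ac)
  qed
  also have "(\<Sum>l\<in>UNIV. \<Sum>k\<in>UNIV. \<Sum>m\<in>UNIV. n l * (dG l k k m * n m))
      = (\<Sum>j\<in>UNIV. \<Sum>k\<in>UNIV. \<Sum>l\<in>UNIV. dG j l l k * n j * n k)" (is "_ = ?R2")
  proof -
    have "(\<Sum>l\<in>UNIV. \<Sum>k\<in>UNIV. \<Sum>m\<in>UNIV. n l * (dG l k k m * n m))
        = (\<Sum>l\<in>UNIV. \<Sum>m\<in>UNIV. \<Sum>k\<in>UNIV. n l * (dG l k k m * n m))"
      by (rule sum.cong[OF refl]) (rule sum.swap)
    then show ?thesis by (simp add: mult_ac)
  qed
  also have "(\<Sum>l\<in>UNIV. \<Sum>k\<in>UNIV. \<Sum>r\<in>UNIV. c l * n k * (G l k r * n r))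
      = (\<Sum>j\<in>UNIV. \<Sum>k\<in>UNIV. \<Sum>l\<in>UNIV. \<Sum>m\<in>UNIV. G l l m * G m j k * n j * n k)" (is "_ = ?R3")
  proof -
    have "(\<Sum>l\<in>UNIV. \<Sum>k\<in>UNIV. \<Sum>r\<in>UNIV. c l * n k * (G l k r * n r))
        = (\<Sum>k\<in>UNIV. \<Sum>l\<in>UNIV. \<Sum>r\<in>UNIV. c l * n k * (G l k r * n r))"
      by (rule sum.swap)
    also have "\<dots> = (\<Sum>k\<in>UNIV. \<Sum>r\<in>UNIV. \<Sum>l\<in>UNIV. c l * n k * (G l k r * n r))"
      by (rule sum.cong[OF refl]) (rule sum.swap)
    also have "\<dots> = (\<Sum>k\<in>UNIV. \<Sum>r\<in>UNIV. \<Sum>l\<in>UNIV. \<Sum>m\<in>UNIV. G m m l * G l k r * n k * n r)"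
      by (simp add: c_def sum_distrib_right sum_distrib_left mult_ac)
    also have "\<dots> = (\<Sum>k\<in>UNIV. \<Sum>r\<in>UNIV. \<Sum>m\<in>UNIV. \<Sum>l\<in>UNIV. G m m l * G l k r * n k * n r)"
      by (rule sum.cong[OF refl], rule sum.cong[OF refl], rule sum.swap)
    finally show ?thesis .
  qed
  also have "(\<Sum>l\<in>UNIV. \<Sum>k\<in>UNIV. \<Sum>m\<in>UNIV. \<Sum>r\<in>UNIV. G k l m * n m * (G l k r * n r))
      = (\<Sum>j\<in>UNIV. \<Sum>k\<in>UNIV. \<Sum>l\<in>UNIV. \<Sum>m\<in>UNIV. G l j m * G m l k * n j * n k)" (is "_ = ?R4")
  proof -
    define F where "F l k m r = G k m l * G l k r * n m * n r" for l k m r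
    have "(\<Sum>l\<in>UNIV. \<Sum>k\<in>UNIV. \<Sum>m\<in>UNIV. \<Sum>r\<in>UNIV. G k l m * n m * (G l k r * n r))
        = (\<Sum>l\<in>UNIV. \<Sum>k\<in>UNIV. \<Sum>m\<in>UNIV. \<Sum>r\<in>UNIV. F l k m r)"
    proof -
      have "G k l m * n m * (G l k r * n r) = F l k m r" for l k m r
        by (simp add: F_def Gs[of k l m])
      then show ?thesis by (simp only:)
    qed
    also have "\<dots> = (\<Sum>l\<in>UNIV. \<Sum>m\<in>UNIV. \<Sum>r\<in>UNIV. \<Sum>k\<in>UNIV. F l k m r)"
      by (rule sum.cong[OF refl], subst sum.swap, rule sum.cong[OF refl], rule sum.swap)
    also have "\<dots> = (\<Sum>m\<in>UNIV. \<Sum>r\<in>UNIV. \<Sum>l\<in>UNIV. \<Sum>k\<in>UNIV. F l k m r)"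
      by (subst sum.swap, rule sum.cong[OF refl], rule sum.swap)
    also have "\<dots> = (\<Sum>m\<in>UNIV. \<Sum>r\<in>UNIV. \<Sum>k\<in>UNIV. \<Sum>l\<in>UNIV. F l k m r)"
      by (rule sum.cong[OF refl], rule sum.cong[OF refl], rule sum.swap)
    finally show ?thesis unfolding F_def .
  qed
  also have "?R1 - ?R2 + ?R3 - ?R4 = (\<Sum>j\<in>UNIV. \<Sum>k\<in>UNIV. (\<Sum>l\<in>UNIV. dG l l j k - dG j l l k +
      (\<Sum>m\<in>UNIV. G l l m * G m j k - G l j m * G m l k)) * n j * n k)"
    by (simp add: sum.distrib sum_subtractf sum_distrib_right distrib_right left_diff_distrib)
  finally show ?thesis unfolding c_def t_def .
qed

section \<open>The covariant derivative of a vector field and its divergence formula\<close>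

context
  fixes M :: "(real^'m::finite) set" and h :: "'m metric" and N :: "real^'m \<Rightarrow> real^'m"
  assumes M: "open M" and h: "pseudo_riemannian_metric M h" and N: "\<And>k. smooth_on M (\<lambda>x. N x $ k)"
begin

lemma smooth_on_cov_diff: "smooth_on M (cov_diff h N k l)"
  unfolding cov_diff_def[abs_def]
  by (intro smooth_intros smooth_on_christoffel M h N)

text \<open>The derivative is collected on the lowered field. For the normal field of the foliation
  the lowered leaf components vanish identically, so that for a leaf index \<open>m\<close> no
  derivative of \<open>N\<close> is left; lowering also avoids the inverse metric.\<close>

lemma cov_diff_lower:
  assumes x: "x \<in> M"
  shows "(\<Sum>l\<in>UNIV. h x $ m $ l * cov_diff h N k l x) = pd k (\<lambda>z. \<Sum>l\<in>UNIV. h z $ m $ l * N z $ l) x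
    + 1/2 * (\<Sum>p\<in>UNIV. N x $ p * (pd p (\<lambda>z. h z $ k $ m) x - pd k (\<lambda>z. h z $ p $ m) x
        - pd m (\<lambda>z. h z $ k $ p) x))"
proof -
  note hd = smooth_on_differentiable[OF pseudo_riemannian_metricD(1)[OF h] x]
  note nd = smooth_on_differentiable[OF N x]
  have 1: "pd k (\<lambda>z. \<Sum>l\<in>UNIV. h z $ m $ l * N z $ l) x
      = (\<Sum>l\<in>UNIV. h x $ m $ l * pd k (\<lambda>z. N z $ l) x) + (\<Sum>p\<in>UNIV. pd k (\<lambda>z. h z $ p $ m) x * N x $ p)"
    by (simp add: pd_sum pd_mult hd nd differentiable_mult sum.distrib
        pd_metric_commute[OF M h x, of k m])
  have "(\<Sum>l\<in>UNIV. h x $ m $ l * (\<Sum>p\<in>UNIV. christoffel h l k p x * N x $ p))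
      = (\<Sum>p\<in>UNIV. (\<Sum>l\<in>UNIV. h x $ m $ l * christoffel h l k p x) * N x $ p)"
    unfolding sum_distrib_left sum_distrib_right by (subst sum.swap) (simp add: mult_ac)
  also have "\<dots> = (\<Sum>p\<in>UNIV. 1/2 * (pd k (\<lambda>z. h z $ p $ m) x + pd p (\<lambda>z. h z $ k $ m) x
      - pd m (\<lambda>z. h z $ k $ p) x) * N x $ p)"
    by (simp only: christoffel_lower[OF M h x])
  also have "\<dots> = (\<Sum>p\<in>UNIV. pd k (\<lambda>z. h z $ p $ m) x * N x $ p)
     + 1/2 * (\<Sum>p\<in>UNIV. N x $ p * (pd p (\<lambda>z. h z $ k $ m) x - pd k (\<lambda>z. h z $ p $ m) x
        - pd m (\<lambda>z. h z $ k $ p) x))"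
    unfolding sum_distrib_left sum.distrib[symmetric] by (intro sum.cong refl) (simp add: field_simps)
  finally show ?thesis
    unfolding 1 cov_diff_def by (simp only: distrib_left sum.distrib add.assoc)
qed

text \<open>Compatibility of the connection with the metric, tested on \<open>N\<close> itself:
  after contraction with \<open>N\<close> the two derivatives of the metric other than the one in
  direction \<open>k\<close> cancel.\<close>

lemma cov_diff_normal:
  assumes x: "x \<in> M"
  shows "(\<Sum>l\<in>UNIV. (\<Sum>m\<in>UNIV. h x $ l $ m * N x $ m) * cov_diff h N k l x)
    = 1/2 * pd k (\<lambda>z. gform (h z) (N z) (N z)) x"
proof -
  note hd = smooth_on_differentiable[OF pseudo_riemannian_metricD(1)[OF h] x]
  note nd = smooth_on_differentiable[OF N x]
  have hs: "h x $ i $ j = h x $ j $ i" for i j by (rule pseudo_riemannian_metricD(4)[OF h x])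
  define A where "A = (\<Sum>m\<in>UNIV. \<Sum>p\<in>UNIV. N x $ m * (h x $ m $ p * pd k (\<lambda>z. N z $ p) x))"
  define H where "H = (\<Sum>m\<in>UNIV. \<Sum>p\<in>UNIV. N x $ m * (pd k (\<lambda>z. h z $ m $ p) x * N x $ p))"
  have A': "(\<Sum>m\<in>UNIV. \<Sum>p\<in>UNIV. h x $ m $ p * pd k (\<lambda>z. N z $ m) x * N x $ p) = A"
  proof -
    have "h x $ m $ p * pd k (\<lambda>z. N z $ m) x * N x $ p = N x $ p * (h x $ p $ m * pd k (\<lambda>z. N z $ m) x)" for m p
      by (simp add: hs[of m p])
    then show ?thesis unfolding A_def by (simp only:) (rule sum.swap)
  qed
  have low: "pd k (\<lambda>z. \<Sum>l\<in>UNIV. h z $ m $ l * N z $ l) x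
      = (\<Sum>p\<in>UNIV. h x $ m $ p * pd k (\<lambda>z. N z $ p) x + pd k (\<lambda>z. h z $ m $ p) x * N x $ p)" for m
    by (simp add: pd_sum pd_mult hd nd differentiable_mult)
  have "pd k (\<lambda>z. gform (h z) (N z) (N z)) x
      = (\<Sum>m\<in>UNIV. \<Sum>p\<in>UNIV. h x $ m $ p * N x $ m * pd k (\<lambda>z. N z $ p) x
        + (h x $ m $ p * pd k (\<lambda>z. N z $ m) x + pd k (\<lambda>z. h z $ m $ p) x * N x $ m) * N x $ p)"
    unfolding gform_sum by (simp add: pd_sum pd_mult hd nd differentiable_mult differentiable_sum)
  also have "\<dots> = A + (\<Sum>m\<in>UNIV. \<Sum>p\<in>UNIV. h x $ m $ p * pd k (\<lambda>z. N z $ m) x * N x $ p) + H"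
    unfolding A_def H_def by (simp add: sum.distrib distrib_right distrib_left mult_ac)
  finally have R: "pd k (\<lambda>z. gform (h z) (N z) (N z)) x = 2 * A + H" unfolding A' by simp
  define X where "X = (\<Sum>m\<in>UNIV. \<Sum>p\<in>UNIV. N x $ m * (N x $ p * pd p (\<lambda>z. h z $ k $ m) x))"
  have X': "(\<Sum>m\<in>UNIV. \<Sum>p\<in>UNIV. N x $ m * (N x $ p * pd m (\<lambda>z. h z $ k $ p) x)) = X"
    unfolding X_def by (subst sum.swap) (simp add: mult_ac)
  have H': "(\<Sum>m\<in>UNIV. \<Sum>p\<in>UNIV. N x $ m * (N x $ p * pd k (\<lambda>z. h z $ p $ m) x)) = H"
  proof -
    have "N x $ m * (N x $ p * pd k (\<lambda>z. h z $ p $ m) x) = N x $ m * (pd k (\<lambda>z. h z $ m $ p) x * N x $ p)" for m p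
      by (simp add: pd_metric_commute[OF M h x, of k p m])
    then show ?thesis unfolding H_def by (simp only:)
  qed
  have "(\<Sum>l\<in>UNIV. (\<Sum>m\<in>UNIV. h x $ l $ m * N x $ m) * cov_diff h N k l x)
      = (\<Sum>m\<in>UNIV. N x $ m * (\<Sum>l\<in>UNIV. h x $ m $ l * cov_diff h N k l x))"
  proof -
    have "h x $ l $ m * N x $ m * cov_diff h N k l x = N x $ m * (h x $ m $ l * cov_diff h N k l x)" for l m
      by (simp add: hs[of l m])
    then show ?thesis unfolding sum_distrib_left sum_distrib_right by (simp only:) (rule sum.swap)
  qed
  also have "\<dots> = (\<Sum>m\<in>UNIV. \<Sum>p\<in>UNIV. N x $ m * (h x $ m $ p * pd k (\<lambda>z. N z $ p) x)
        + N x $ m * (pd k (\<lambda>z. h z $ m $ p) x * N x $ p)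
      + 1/2 * (N x $ m * (N x $ p * pd p (\<lambda>z. h z $ k $ m) x) - N x $ m * (N x $ p * pd k (\<lambda>z. h z $ p $ m) x)
          - N x $ m * (N x $ p * pd m (\<lambda>z. h z $ k $ p) x)))"
    unfolding cov_diff_lower[OF x] low
    by (simp add: sum_distrib_left sum.distrib distrib_left right_diff_distrib)
  also have "\<dots> = A + H + 1/2 * (X - H - X)"
  proof -
    have "(\<Sum>m\<in>UNIV. \<Sum>p\<in>UNIV. a m p + b m p + 1/2 * (c m p - d m p - e m p))
      = (\<Sum>m\<in>UNIV. \<Sum>p\<in>UNIV. a m p) + (\<Sum>m\<in>UNIV. \<Sum>p\<in>UNIV. b m p)
        + 1/2 * ((\<Sum>m\<in>UNIV. \<Sum>p\<in>UNIV. c m p) - (\<Sum>m\<in>UNIV. \<Sum>p\<in>UNIV. d m p)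
          - (\<Sum>m\<in>UNIV. \<Sum>p\<in>UNIV. e m p))" for a b c d e :: "'m \<Rightarrow> 'm \<Rightarrow> real"
      by (simp only: sum.distrib sum_subtractf sum_distrib_left[symmetric])
    then show ?thesis by (simp only: A_def[symmetric] H_def[symmetric] X_def[symmetric] H' X')
  qed
  finally show ?thesis unfolding R by simp
qed

text \<open>The algebraic identity times the volume density. The sum over \<open>G m m l\<close> in
  it is the logarithmic derivative of the density, which is thereby absorbed into the partial
  derivatives.\<close>

lemma ricci_divergence:
  assumes x: "x \<in> M" and det_pos: "\<And>x. x \<in> M \<Longrightarrow> det (h x) > 0"
  shows "vol_density h x * (\<Sum>j\<in>UNIV. \<Sum>k\<in>UNIV. ricci h j k x * N x $ j * N x $ k)
    = (\<Sum>l\<in>UNIV. pd l (\<lambda>z. vol_density h z * ((\<Sum>k\<in>UNIV. N z $ k * cov_diff h N k l z)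
          - N z $ l * (\<Sum>k\<in>UNIV. cov_diff h N k k z))) x)
      + vol_density h x * ((\<Sum>k\<in>UNIV. cov_diff h N k k x)\<^sup>2
          - (\<Sum>l\<in>UNIV. \<Sum>k\<in>UNIV. cov_diff h N l k x * cov_diff h N k l x))"
proof -
  define W where "W = vol_density h"
  define B where "B = cov_diff h N"
  define p where "p k l = pd k (\<lambda>z. N z $ l) x" for k l
  define q where "q i k l = pd i (pd k (\<lambda>z. N z $ l)) x" for i k l
  define G where "G l j k = christoffel h l j k x" for l j k
  define dG where "dG i l j k = pd i (christoffel h l j k) x" for i l j k
  define db where "db i k l = pd i (B k l) x" for i k l
  note sd = smooth_on_differentiable[OF _ x]
  note nd = sd[OF N] and cd = sd[OF smooth_on_christoffel[OF M h]]
    and bd = sd[OF smooth_on_cov_diff, folded B_def] and pdd = sd[OF smooth_on_pd[OF N]]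
    and wd = sd[OF smooth_on_vol_density[OF M h det_pos], folded W_def]
  have db: "db i k l = q i k l + (\<Sum>m\<in>UNIV. G l k m * p i m + dG i l k m * N x $ m)" for i k l
    unfolding db_def B_def cov_diff_def[abs_def] q_def G_def p_def dG_def
    by (simp add: pd_add pd_sum pd_mult nd cd pdd differentiable_mult differentiable_sum)
  have b: "B k l x = p k l + (\<Sum>m\<in>UNIV. G l k m * N x $ m)" for k l
    by (simp add: B_def cov_diff_def p_def G_def)
  have V: "pd l (\<lambda>z. (\<Sum>k\<in>UNIV. N z $ k * B k l z) - N z $ l * (\<Sum>k\<in>UNIV. B k k z)) x
     = (\<Sum>k\<in>UNIV. N x $ k * db l k l + p l k * B k l x)
       - (N x $ l * (\<Sum>k\<in>UNIV. db l k k) + p l l * (\<Sum>k\<in>UNIV. B k k x))" for l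
    unfolding db_def p_def
    by (simp add: pd_diff pd_sum pd_mult nd bd differentiable_mult differentiable_sum)
  have "pd l (\<lambda>z. W z * ((\<Sum>k\<in>UNIV. N z $ k * B k l z) - N z $ l * (\<Sum>k\<in>UNIV. B k k z))) x
     = W x * ((\<Sum>m\<in>UNIV. G m m l) * ((\<Sum>k\<in>UNIV. N x $ k * B k l x) - N x $ l * (\<Sum>k\<in>UNIV. B k k x))
       + ((\<Sum>k\<in>UNIV. N x $ k * db l k l + p l k * B k l x)
       - (N x $ l * (\<Sum>k\<in>UNIV. db l k k) + p l l * (\<Sum>k\<in>UNIV. B k k x))))" for l
  proof -
    have "pd l W x = W x * (\<Sum>m\<in>UNIV. G m m l)"
      unfolding W_def G_def by (rule pd_vol_density[OF M h det_pos x])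
    then show ?thesis
      by (subst pd_mult) (auto simp: wd V nd bd differentiable_mult differentiable_sum differentiable_diff distrib_left mult.assoc)
  qed
  then have "(\<Sum>l\<in>UNIV. pd l (\<lambda>z. W z * ((\<Sum>k\<in>UNIV. N z $ k * B k l z) - N z $ l * (\<Sum>k\<in>UNIV. B k k z))) x)
      + W x * ((\<Sum>k\<in>UNIV. B k k x)\<^sup>2 - (\<Sum>l\<in>UNIV. \<Sum>k\<in>UNIV. B l k x * B k l x))
    = W x * (\<Sum>j\<in>UNIV. \<Sum>k\<in>UNIV. (\<Sum>l\<in>UNIV. dG l l j k - dG j l l k +
      (\<Sum>m\<in>UNIV. G l l m * G m j k - G l j m * G m l k)) * N x $ j * N x $ k)"
    by (subst ricci_identity_algebra[where q = q and b = "\<lambda>k l. B k l x" and db = db and p = p, symmetric])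
      (auto simp: db b q_def G_def sum_distrib_left distrib_left intro: pd_commute[OF M N x] christoffel_commute[OF M h x])
  then show ?thesis
    unfolding ricci_def W_def B_def G_def dG_def by simp
qed

end

section \<open>The mixed scalar curvature of a codimension-one foliation\<close>

lemma subspace_leaf_dist: "subspace leaf_dist"
  by (simp add: subspace_def leaf_dist_def)

lemma axis_Some_leaf_dist: "axis (Some i) 1 \<in> leaf_dist"
  by (simp add: leaf_dist_def axis_def)

text \<open>Gram-Schmidt by induction over the index set. The additional invariant that the vectors
  built so far have no component outside \<open>A\<close> gives the new vector component 1 at
  \<open>c\<close>, hence makes it nonzero.\<close>

lemma orthonormal_leaf_frame_exists:
  fixes g :: "'n::finite option metric"
  assumes sym: "transpose (g x) = g x"
    and pos: "\<And>v. v \<in> leaf_dist \<Longrightarrow> v \<noteq> 0 \<Longrightarrow> gform (g x) v v > 0"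
  shows "\<exists>E. orthonormal_leaf_frame g x E"
proof -
  have "\<exists>E. (\<forall>a\<in>A. E a \<in> leaf_dist \<and> gform (g x) (E a) (E a) = 1 \<and> (\<forall>i. i \<notin> A \<longrightarrow> E a $ Some i = 0)) \<and>
      (\<forall>a\<in>A. \<forall>b\<in>A. a \<noteq> b \<longrightarrow> gform (g x) (E a) (E b) = 0)" if "finite A" for A :: "'n set"
    using that
  proof (induction A)
    case empty
    then show ?case by simp
  next
    case (insert c A)
    from insert.IH obtain E :: "'n \<Rightarrow> real^'n option" where
      E1: "\<forall>a\<in>A. E a \<in> leaf_dist \<and> gform (g x) (E a) (E a) = 1 \<and> (\<forall>i. i \<notin> A \<longrightarrow> E a $ Some i = 0)"
      and E2: "\<forall>a\<in>A. \<forall>b\<in>A. a \<noteq> b \<longrightarrow> gform (g x) (E a) (E b) = 0"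
      by (elim exE conjE)
    have E: "\<And>a. a \<in> A \<Longrightarrow> E a \<in> leaf_dist" "\<And>a. a \<in> A \<Longrightarrow> gform (g x) (E a) (E a) = 1"
      "\<And>a i. a \<in> A \<Longrightarrow> i \<notin> A \<Longrightarrow> E a $ Some i = 0"
      "\<And>a b. a \<in> A \<Longrightarrow> b \<in> A \<Longrightarrow> a \<noteq> b \<Longrightarrow> gform (g x) (E a) (E b) = 0"
      using E1 E2 by auto
    define e :: "real^'n option" where "e = axis (Some c) 1"
    define v where "v = e - (\<Sum>a\<in>A. gform (g x) e (E a) *\<^sub>R E a)"
    have vl: "v \<in> leaf_dist"
      unfolding v_def e_def
      by (intro subspace_diff subspace_sum subspace_scale subspace_leaf_dist axis_Some_leaf_dist E)
    have "v $ Some c = 1"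
      using insert.hyps by (simp add: v_def e_def E(3))
    then have v0: "v \<noteq> 0" by auto
    have vi: "v $ Some i = 0" if "i \<notin> insert c A" for i
      using that by (simp add: v_def e_def E(3) axis_def)
    define r where "r = gform (g x) v v"
    have r: "r > 0" unfolding r_def by (rule pos[OF vl v0])
    have vE: "gform (g x) (E b) v = 0" if b: "b \<in> A" for b
    proof -
      have "(\<Sum>a\<in>A. gform (g x) e (E a) * gform (g x) (E b) (E a))
          = (\<Sum>a\<in>A. if b = a then gform (g x) e (E b) else 0)"
        using E(2,4) b by (intro sum.cong) auto
      also have "\<dots> = gform (g x) e (E b)"
        using b insert.hyps by simp
      finally show ?thesis
        by (simp add: v_def gform_diff gform_sum_right gform_scaleR gform_commute[OF sym, of "E b" e])
    qed
    define E' where "E' = E(c := (1 / sqrt r) *\<^sub>R v)"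
    have E'c: "E' c = (1 / sqrt r) *\<^sub>R v" and E'a: "\<And>a. a \<in> A \<Longrightarrow> E' a = E a"
      using insert.hyps by (auto simp: E'_def)
    have "E' a \<in> leaf_dist" if "a \<in> insert c A" for a
      using that E(1) vl by (auto simp: E'c E'a intro: subspace_scale[OF subspace_leaf_dist])
    moreover have "gform (g x) (E' a) (E' a) = 1" if "a \<in> insert c A" for a
      using that E(2) r by (auto simp: E'c E'a gform_scaleR r_def[symmetric])
    moreover have "E' a $ Some i = 0" if "a \<in> insert c A" "i \<notin> insert c A" for a i
      using that E(3) vi by (auto simp: E'c E'a)
    moreover have "gform (g x) (E' a) (E' b) = 0" if "a \<in> insert c A" "b \<in> insert c A" "a \<noteq> b" for a b
      using that E(4) vE gform_commute[OF sym, of v] by (auto simp: E'c E'a gform_scaleR)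
    ultimately show ?case by blast
  qed
  from this[OF finite[of UNIV]] obtain E :: "'n \<Rightarrow> real^'n option" where
    "\<forall>a. E a \<in> leaf_dist \<and> gform (g x) (E a) (E a) = 1"
    "\<forall>a b. a \<noteq> b \<longrightarrow> gform (g x) (E a) (E b) = 0"
    by auto
  then show ?thesis
    unfolding orthonormal_leaf_frame_def by (intro exI[of _ E]) simp
qed

text \<open>By antisymmetry in the first two arguments. It allows the normal to be added to a leaf
  frame without changing the trace of X \<mapsto> R(X, N)N.\<close>

lemma riemann_same: "riemann h x X X Z = 0"
proof -
  define K where "K l i j k = pd i (christoffel h l j k) x - pd j (christoffel h l i k) x +
      (\<Sum>m\<in>UNIV. christoffel h l i m x * christoffel h m j k x
              - christoffel h l j m x * christoffel h m i k x)" for l i j k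
  have K: "K l i j k = - K l j i k" for l i j k
    by (simp add: K_def sum_subtractf)
  have "(\<Sum>i\<in>UNIV. \<Sum>j\<in>UNIV. \<Sum>k\<in>UNIV. K l i j k * X $ i * X $ j * Z $ k) = 0" (is "?S = 0") for l
  proof -
    have "?S = (\<Sum>j\<in>UNIV. \<Sum>i\<in>UNIV. \<Sum>k\<in>UNIV. K l i j k * X $ i * X $ j * Z $ k)"
      by (rule sum.swap)
    also have "\<dots> = (\<Sum>j\<in>UNIV. \<Sum>i\<in>UNIV. \<Sum>k\<in>UNIV. - (K l j i k * X $ j * X $ i * Z $ k))"
    proof (intro sum.cong refl)
      fix i j k
      show "K l i j k * X $ i * X $ j * Z $ k = - (K l j i k * X $ j * X $ i * Z $ k)"
        by (simp add: K[of l i j k])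
    qed
    finally show ?thesis by (simp add: sum_negf)
  qed
  then show ?thesis
    unfolding riemann_def K_def[symmetric] by (simp add: vec_eq_iff)
qed

lemma riemann_scaleR:
  "riemann h x X (r *\<^sub>R Y) (r *\<^sub>R Y) = r\<^sup>2 *\<^sub>R riemann h x X Y Y"
  by (simp add: riemann_def vec_eq_iff sum_distrib_left power2_eq_square mult_ac)

text \<open>For an orthonormal basis \<open>P\<close> (the columns) of a positive definite form \<open>H\<close>, the matrix
  \<open>transpose P ** H\<close> is the inverse of \<open>P\<close>.\<close>

lemma trace_orthonormal:
  fixes H T P :: "real^'m::finite^'m"
  assumes P: "\<And>c d. gform H (column c P) (column d P) = (if c = d then 1 else 0)"
  shows "trace T = (\<Sum>c\<in>UNIV. gform H (column c P) (T *v column c P))"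
proof -
  have entry: "(transpose P ** H ** A) $ c $ d = gform H (column c P) (column d A)" for A :: "real^'m^'m" and c d
    unfolding gform_sum
    by (subst sum.swap) (simp add: matrix_matrix_mult_def transpose_def column_def sum_distrib_right sum_distrib_left mult_ac)
  have "transpose P ** H ** P = mat 1"
    by (simp add: vec_eq_iff entry P mat_def)
  then have inv: "P ** (transpose P ** H) = mat 1"
    using matrix_left_right_inverse by blast
  have "trace T = trace (T ** P ** (transpose P ** H))"
    by (simp add: matrix_mul_assoc[symmetric] inv)
  also have "\<dots> = trace (transpose P ** H ** (T ** P))"
    by (rule trace_mul_sym)
  also have "\<dots> = (\<Sum>c\<in>UNIV. gform H (column c P) (T *v column c P))"
    unfolding trace_def entry
    by (simp add: column_def matrix_matrix_mult_def matrix_vector_mult_def)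
  finally show ?thesis .
qed

text \<open>\<open>N\<close> and a leaf frame together form an orthonormal basis, the columns of
  \<open>P\<close>, so the sum is the trace of X \<mapsto> R(X, N)N. Positivity on the leaves
  excludes frame vectors of square -1 and determines the unit normal up to sign, to which the
  curvature is insensitive; hence the value depends neither on \<open>E\<close> nor on
  \<open>N'\<close>.\<close>

lemma sum_sectional_curvature_ricci:
  fixes g :: "'n::finite option metric"
  assumes sym: "transpose (g x) = g x"
    and pos: "\<And>v. v \<in> leaf_dist \<Longrightarrow> v \<noteq> 0 \<Longrightarrow> gform (g x) v v > 0"
    and N: "N \<in> normal_dist g x" "gform (g x) N N = 1"
    and E: "orthonormal_leaf_frame g x E" and N': "unit_normal g x N'"
  shows "(\<Sum>a\<in>UNIV. sectional_curvature g x (E a) N')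
    = (\<Sum>j\<in>UNIV. \<Sum>k\<in>UNIV. ricci g j k x * N $ j * N $ k)"
proof -
  have NE: "gform (g x) N (E a) = 0" "gform (g x) N' (E a) = 0" for a
    using N E N' by (auto simp: normal_dist_def orthonormal_leaf_frame_def unit_normal_def)
  have EE: "gform (g x) (E a) (E a) = 1" for a
  proof -
    have "\<bar>gform (g x) (E a) (E a)\<bar> = 1" "E a \<in> leaf_dist"
      using E by (auto simp: orthonormal_leaf_frame_def)
    moreover from this have "gform (g x) (E a) (E a) > 0"
      by (intro pos) (auto simp: gform_zero)
    ultimately show ?thesis by simp
  qed
  have N0: "N $ None \<noteq> 0"
  proof
    assume "N $ None = 0"
    then have "N \<in> leaf_dist" by (simp add: leaf_dist_def)
    then show False using N by (auto simp: normal_dist_def)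
  qed
  \<comment> \<open>With this ratio \<open>N' - r *\<^sub>R N\<close> is tangent to the leaves;
    being normal as well, it vanishes.\<close>
  define r where "r = N' $ None / N $ None"
  have N'r: "N' = r *\<^sub>R N"
  proof -
    define u where "u = N' - r *\<^sub>R N"
    have u: "u \<in> leaf_dist" using N0 by (simp add: leaf_dist_def u_def r_def)
    have "gform (g x) u w = gform (g x) N' w - r * gform (g x) N w" for w
      by (simp add: u_def gform_diff gform_scaleR)
    then have "gform (g x) u u = 0"
      using N N' u by (simp add: normal_dist_def unit_normal_def)
    then have "u = 0" using pos[OF u] by force
    then show ?thesis by (simp add: u_def)
  qed
  have r: "r\<^sup>2 = 1"
  proof -
    have "\<bar>gform (g x) N' N'\<bar> = 1" using N' by (simp add: unit_normal_def)
    then show ?thesis by (simp add: N'r gform_scaleR N(2) power2_eq_square)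
  qed
  define K where "K l i j k = pd i (christoffel g l j k) x - pd j (christoffel g l i k) x +
      (\<Sum>m\<in>UNIV. christoffel g l i m x * christoffel g m j k x
              - christoffel g l j m x * christoffel g m i k x)" for l i j k
  define T :: "real^'n option^'n option" where "T = (\<chi> l i. \<Sum>j\<in>UNIV. \<Sum>k\<in>UNIV. K l i j k * N $ j * N $ k)"
  have T: "riemann g x X N N = T *v X" for X
    unfolding riemann_def K_def[symmetric] T_def matrix_vector_mult_def
    by (simp add: vec_eq_iff sum_distrib_right sum_distrib_left mult_ac)
  define P :: "real^'n option^'n option" where "P = (\<chi> r c. case c of None \<Rightarrow> N $ r | Some a \<Rightarrow> E a $ r)"
  have col: "column None P = N" "column (Some a) P = E a" for a
    by (simp_all add: column_def P_def vec_eq_iff)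
  have "gform (g x) (column c P) (column d P) = (if c = d then 1 else 0)" for c d
  proof -
    have "gform (g x) (E a) N = 0" for a
      using NE(1)[of a] gform_commute[OF sym, of "E a" N] by simp
    then show ?thesis
      using NE(1) EE N(2) E by (cases c; cases d) (auto simp: col orthonormal_leaf_frame_def)
  qed
  then have "trace T = gform (g x) N (T *v N) + (\<Sum>a\<in>UNIV. gform (g x) (E a) (T *v E a))"
    by (subst trace_orthonormal[where P = P and H = "g x"]) (simp_all add: sum_UNIV_option col)
  also have "T *v N = 0" by (simp add: T[symmetric] riemann_same)
  also have "(\<Sum>a\<in>UNIV. gform (g x) (E a) (T *v E a)) = (\<Sum>a\<in>UNIV. sectional_curvature g x (E a) N')"
  proof (rule sum.cong[OF refl])
    fix a
    have "gform (g x) (E a) N' = 0" using NE(2)[of a] gform_commute[OF sym, of "E a" N'] by simp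
    moreover have "gform (g x) N' N' = 1" using r by (simp add: N'r gform_scaleR N(2) power2_eq_square)
    moreover have "riemann g x (E a) N' N' = T *v E a"
      by (simp add: N'r riemann_scaleR r T)
    ultimately show "gform (g x) (E a) (T *v E a) = sectional_curvature g x (E a) N'"
      using gform_commute[OF sym, of "E a" "T *v E a"] by (simp add: sectional_curvature_def EE)
  qed
  finally have "trace T = (\<Sum>a\<in>UNIV. sectional_curvature g x (E a) N')"
    by (simp add: gform_zero)
  moreover have "trace T = (\<Sum>j\<in>UNIV. \<Sum>k\<in>UNIV. ricci g j k x * N $ j * N $ k)"
  proof -
    have "trace T = (\<Sum>l\<in>UNIV. \<Sum>j\<in>UNIV. \<Sum>k\<in>UNIV. K l l j k * N $ j * N $ k)"
      by (simp add: trace_def T_def)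
    also have "\<dots> = (\<Sum>j\<in>UNIV. \<Sum>l\<in>UNIV. \<Sum>k\<in>UNIV. K l l j k * N $ j * N $ k)"
      by (rule sum.swap)
    also have "\<dots> = (\<Sum>j\<in>UNIV. \<Sum>k\<in>UNIV. \<Sum>l\<in>UNIV. K l l j k * N $ j * N $ k)"
      by (rule sum.cong[OF refl]) (rule sum.swap)
    finally show ?thesis by (simp add: ricci_def K_def sum_distrib_right)
  qed
  ultimately show ?thesis by simp
qed

section \<open>Metrics with a unit normal to the leaves and the integral formula for the
  action\<close>

locale foliated_metric =
  fixes M :: "(real^'n::finite option) set" and h :: "'n option metric"
    and N :: "real^'n option \<Rightarrow> real^'n option"
  assumes open_M: "open M" and metric: "pseudo_riemannian_metric M h"
    and det_pos: "\<And>x. x \<in> M \<Longrightarrow> det (h x) > 0"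
    and leaf_pos: "\<And>x v. x \<in> M \<Longrightarrow> v \<in> leaf_dist \<Longrightarrow> v \<noteq> 0 \<Longrightarrow> gform (h x) v v > 0"
    and N_smooth: "\<And>k. smooth_on M (\<lambda>x. N x $ k)"
    and N_normal: "\<And>x. x \<in> M \<Longrightarrow> N x \<in> normal_dist h x"
    and N_unit: "\<And>x. x \<in> M \<Longrightarrow> gform (h x) (N x) (N x) = 1"
begin

text \<open>The predicate under the choice operator in \<open>S_mix\<close> holds for exactly one
  number: a frame exists, and every frame and unit normal give the same sum.\<close>

lemma S_mix_eq:
  assumes x: "x \<in> M"
  shows "S_mix h x = (\<Sum>j\<in>UNIV. \<Sum>k\<in>UNIV. ricci h j k x * N x $ j * N x $ k)" (is "_ = ?v")
proof -
  have sym: "transpose (h x) = h x" by (rule pseudo_riemannian_metricD(2)[OF metric x])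
  obtain E where E: "orthonormal_leaf_frame h x E"
    using orthonormal_leaf_frame_exists[of h x, OF sym leaf_pos[OF x]] by blast
  have N: "unit_normal h x (N x)"
    by (simp add: unit_normal_def N_normal N_unit x)
  have *: "(\<Sum>a\<in>UNIV. sectional_curvature h x (E a) N') = ?v"
    if "orthonormal_leaf_frame h x E" "unit_normal h x N'" for E N'
    by (rule sum_sectional_curvature_ricci[OF sym leaf_pos[OF x] N_normal[OF x] N_unit[OF x] that])
  have "(\<exists>E N'. orthonormal_leaf_frame h x E \<and> unit_normal h x N' \<and>
      s = (\<Sum>a\<in>UNIV. sectional_curvature h x (E a) N')) \<longleftrightarrow> s = ?v" for s
  proof
    assume "\<exists>E N'. orthonormal_leaf_frame h x E \<and> unit_normal h x N' \<and>
      s = (\<Sum>a\<in>UNIV. sectional_curvature h x (E a) N')"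
    then obtain E N' where "orthonormal_leaf_frame h x E" "unit_normal h x N'"
      "s = (\<Sum>a\<in>UNIV. sectional_curvature h x (E a) N')" by (elim exE conjE)
    then show "s = ?v" by (simp only: *)
  next
    assume "s = ?v"
    then show "\<exists>E N'. orthonormal_leaf_frame h x E \<and> unit_normal h x N' \<and>
      s = (\<Sum>a\<in>UNIV. sectional_curvature h x (E a) N')"
      by (intro exI[of _ E] exI[of _ "N x"] conjI E N) (simp only: *[OF E N])
  qed
  then show ?thesis unfolding S_mix_def by (simp only: some_eq_trivial)
qed

lemma lower_leaf: "x \<in> M \<Longrightarrow> (\<Sum>m\<in>UNIV. h x $ Some i $ m * N x $ m) = 0"
proof -
  assume x: "x \<in> M"
  have "gform (h x) (N x) (axis (Some i) 1) = 0"
    using N_normal[OF x] axis_Some_leaf_dist by (auto simp: normal_dist_def)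
  then show ?thesis
    unfolding gform_commute[OF pseudo_riemannian_metricD(2)[OF metric x], of "N x"] gform_axis_left .
qed

lemma lower_None: "x \<in> M \<Longrightarrow> (\<Sum>m\<in>UNIV. h x $ None $ m * N x $ m) \<noteq> 0"
proof
  assume x: "x \<in> M" and 0: "(\<Sum>m\<in>UNIV. h x $ None $ m * N x $ m) = 0"
  have "gform (h x) (N x) (N x) = (\<Sum>l\<in>UNIV. N x $ l * (\<Sum>m\<in>UNIV. h x $ l $ m * N x $ m))"
    by (simp add: gform_sum sum_distrib_left mult_ac)
  also have "\<dots> = 0" by (simp add: sum_UNIV_option[where f = "\<lambda>l. N x $ l * _ l"] 0 lower_leaf[OF x])
  finally show False using N_unit[OF x] by simp
qed

text \<open>Constant length makes the derivative of \<open>N\<close> orthogonal to \<open>N\<close>.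
  The lowered normal has only a \<open>None\<close> component, and that is nonzero, so the
  derivative is tangent to the leaves.\<close>

lemma cov_diff_None:
  assumes x: "x \<in> M"
  shows "cov_diff h N k None x = 0"
proof -
  have "pd k (\<lambda>z. gform (h z) (N z) (N z)) x = pd k (\<lambda>z. 1) x"
    by (rule pd_cong[OF open_M x]) (rule N_unit)
  then have "(\<Sum>l\<in>UNIV. (\<Sum>m\<in>UNIV. h x $ l $ m * N x $ m) * cov_diff h N k l x) = 0"
    using cov_diff_normal[OF open_M metric N_smooth x, of k] by simp
  then have "(\<Sum>m\<in>UNIV. h x $ None $ m * N x $ m) * cov_diff h N k None x = 0"
    by (subst (asm) sum_UNIV_option) (simp add: lower_leaf[OF x])
  then show ?thesis using lower_None[OF x] by simp
qed

lemma cov_diff_leaf: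
  assumes x: "x \<in> M"
  shows "(\<Sum>l\<in>UNIV. h x $ Some i $ Some l * cov_diff h N k (Some l) x)
    = 1/2 * (\<Sum>p\<in>UNIV. N x $ p * (pd p (\<lambda>z. h z $ k $ Some i) x - pd k (\<lambda>z. h z $ p $ Some i) x
        - pd (Some i) (\<lambda>z. h z $ k $ p) x))"
proof -
  have "pd k (\<lambda>z. \<Sum>l\<in>UNIV. h z $ Some i $ l * N z $ l) x = pd k (\<lambda>z. 0) x"
    by (rule pd_cong[OF open_M x]) (rule lower_leaf)
  then have "pd k (\<lambda>z. \<Sum>l\<in>UNIV. h z $ Some i $ l * N z $ l) x = 0" by simp
  from cov_diff_lower[OF open_M metric N_smooth x, of "Some i" k, unfolded this] show ?thesis
    by (subst (asm) sum_UNIV_option) (simp add: cov_diff_None[OF x])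
qed

lemma trace_cov_diff:
  "x \<in> M \<Longrightarrow> (\<Sum>k\<in>UNIV. cov_diff h N k k x) = (\<Sum>i\<in>UNIV. cov_diff h N (Some i) (Some i) x)"
  by (subst sum_UNIV_option) (simp add: cov_diff_None)

text \<open>The square of the trace of the Weingarten operator minus the trace of its square; the
  sign of the operator does not matter.\<close>

definition extrinsic where
  "extrinsic x = (\<Sum>i\<in>UNIV. cov_diff h N (Some i) (Some i) x)\<^sup>2
    - (\<Sum>i\<in>UNIV. \<Sum>j\<in>UNIV. cov_diff h N (Some i) (Some j) x * cov_diff h N (Some j) (Some i) x)"

text \<open>The field under the divergence is the derivative of \<open>N\<close> along itself minus
  \<open>N\<close> times the trace of the derivative. \<open>geodesic\<close> removes the first part
  off \<open>K\<close> and \<open>minimal\<close> the second. Agreement with the base metric off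
  \<open>K\<close> would be too much to ask, since the normalisation destroys it.\<close>

lemma J_action_eq:
  assumes \<Omega>: "relatively_compact_in M \<Omega>" "open \<Omega>" and K: "compact K" "K \<subseteq> \<Omega>"
    and geodesic: "\<And>x l. x \<in> M - K \<Longrightarrow> (\<Sum>k\<in>UNIV. N x $ k * cov_diff h N k l x) = 0"
    and minimal: "\<And>x. x \<in> M - K \<Longrightarrow> (\<Sum>i\<in>UNIV. cov_diff h N (Some i) (Some i) x) = 0"
  shows "J_action \<Omega> h = (LINT x:\<Omega>|lborel. vol_density h x * extrinsic x)"
    (is "_ = (LINT x:\<Omega>|lborel. ?f x)")
proof -
  have \<Omega>M: "\<Omega> \<subseteq> M" using \<Omega> by (simp add: relatively_compact_in_def)
  note sm = smooth_intros smooth_on_vol_density[OF open_M metric det_pos] smooth_on_cov_diff[OF open_M metric N_smooth]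
    open_M N_smooth
  define V where "V l z = vol_density h z * ((\<Sum>k\<in>UNIV. N z $ k * cov_diff h N k l z)
          - N z $ l * (\<Sum>k\<in>UNIV. cov_diff h N k k z))" for l z
  have Vs: "smooth_on M (V l)" for l
    unfolding V_def[abs_def] by (intro sm)
  have V0: "V l z = 0" if "z \<in> M - K" for l z
    using that geodesic minimal by (simp add: V_def trace_cov_diff)
  have fi: "set_integrable lborel \<Omega> ?f"
    unfolding extrinsic_def power2_eq_square by (intro relatively_compact_integrable_smooth[OF \<Omega>] sm)
  have eq: "S_mix h x * vol_density h x = (\<Sum>l\<in>UNIV. pd l (V l) x) + ?f x" if x: "x \<in> M" for x
  proof -
    have "(\<Sum>l\<in>UNIV. \<Sum>k\<in>UNIV. cov_diff h N l k x * cov_diff h N k l x)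
      = (\<Sum>i\<in>UNIV. \<Sum>j\<in>UNIV. cov_diff h N (Some i) (Some j) x * cov_diff h N (Some j) (Some i) x)"
      unfolding sum_UNIV_option by (simp add: cov_diff_None[OF x])
    then show ?thesis
      unfolding S_mix_eq[OF x] V_def[abs_def] extrinsic_def
      using ricci_divergence[OF open_M metric N_smooth x det_pos]
      by (simp add: mult.commute[of _ "vol_density h x"] trace_cov_diff[OF x])
  qed
  have "J_action \<Omega> h = (LINT x:\<Omega>|lborel. (\<Sum>l\<in>UNIV. pd l (V l) x) + ?f x)"
    unfolding J_action_def
    by (rule set_lebesgue_integral_cong) (use \<Omega> \<Omega>M eq in auto)
  also have "\<dots> = (LINT x:\<Omega>|lborel. (\<Sum>l\<in>UNIV. pd l (V l) x)) + (LINT x:\<Omega>|lborel. ?f x)"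
    by (intro set_integral_add fi relatively_compact_integrable_smooth[OF \<Omega>] smooth_on_sum smooth_on_pd Vs open_M)
  also have "(LINT x:\<Omega>|lborel. (\<Sum>l\<in>UNIV. pd l (V l) x)) = 0"
    using integral_sum_pd_compact_support[where f = V and a = "\<lambda>l. 1" and p = "\<lambda>l. l" and I = UNIV, OF open_M Vs K \<Omega> V0]
    by simp
  finally show "J_action \<Omega> h = (LINT x:\<Omega>|lborel. ?f x)" by simp
qed

end

section \<open>The metric with constant principal curvatures\<close>

text \<open>A diagonal leaf metric with coefficients f_i(x_0) and unit lapse has principal
  curvatures - f_i' / (2 f_i). Equating these with y_i fixes f_i up to a constant factor.\<close>

definition base_metric :: "('n \<Rightarrow> real) \<Rightarrow> 'n::finite option metric" where
  "base_metric y x = (\<chi> i j. if i = j then (case i of None \<Rightarrow> 1 | Some a \<Rightarrow> exp (-2 * y a * x $ None)) else 0)"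

lemma base_metric_simps [simp]:
  "base_metric y x $ None $ None = 1" "base_metric y x $ None $ Some a = 0" "base_metric y x $ Some a $ None = 0"
  "base_metric y x $ Some a $ Some b = (if a = b then exp (-2 * y a * x $ None) else 0)"
  by (auto simp: base_metric_def)

lemma smooth_on_base_metric:
  fixes y :: "'n::finite \<Rightarrow> real"
  assumes "open M"
  shows "smooth_on M (\<lambda>x. base_metric y x $ i $ j)"
proof -
  have "smooth_on M (\<lambda>x :: real^'n option. exp (-2 * y a * x $ None))" for a
    by (intro smooth_on_exp smooth_intros assms)
  then show ?thesis
    by (cases i; cases j; cases "i = j") (auto simp: smooth_on_const)
qed

lemma pd_exp_None: "pd p (\<lambda>z. exp (r * z $ None)) x = (if p = None then r * exp (r * x $ None) else 0)"
  using pd_real_compose[of "\<lambda>z. r * z $ None" x exp, OF _ DERIV_exp, of p]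
    pd_cmult[OF smooth_on_differentiable[OF smooth_on_coord[of UNIV None], of x], of p r]
    smooth_on_differentiable[OF smooth_on_mult[OF open_UNIV smooth_on_const smooth_on_coord], of x r None]
  by (simp add: pd_coord)

lemma pd_base_metric:
  "pd p (\<lambda>z. base_metric y z $ i $ j) x
    = (case i of None \<Rightarrow> 0 | Some a \<Rightarrow> if p = None \<and> i = j then -2 * y a * exp (-2 * y a * x $ None) else 0)"
  using pd_exp_None[of p "-2 * y (the i)" x] by (cases i; cases j; cases "i = j") auto

lemma det_base_metric:
  assumes "(\<Sum>i\<in>UNIV. y i) = 0"
  shows "det (base_metric y x) = 1"
proof -
  have "det (base_metric y x) = (\<Prod>i\<in>UNIV. base_metric y x $ i $ i)"
    by (rule det_diagonal) (simp add: base_metric_def)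
  also have "\<dots> = exp (\<Sum>a\<in>UNIV. -2 * y a * x $ None)"
    by (simp add: prod_UNIV_option exp_sum)
  also have "(\<Sum>a\<in>UNIV. -2 * y a * x $ None) = -2 * (\<Sum>a\<in>UNIV. y a) * x $ None"
    by (simp add: sum_distrib_left sum_distrib_right)
  finally show ?thesis by (simp add: assms)
qed

lemma gform_base_metric:
  "gform (base_metric y x) v w = v $ None * w $ None + (\<Sum>a\<in>UNIV. exp (-2 * y a * x $ None) * v $ Some a * w $ Some a)"
  by (simp add: gform_sum sum_UNIV_option if_distrib[of "\<lambda>a. a * _"] cong: if_cong)

lemma base_metric_pos:
  assumes "v \<noteq> 0"
  shows "gform (base_metric y x) v v > 0"
proof -
  have s: "0 \<le> (\<Sum>a\<in>UNIV. exp (-2 * y a * x $ None) * v $ Some a * v $ Some a)"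
    by (intro sum_nonneg) (simp add: mult.assoc)
  show ?thesis
  proof (cases "v $ None = 0")
    case True
    then obtain a where a: "v $ Some a \<noteq> 0" using assms by (metis vec_eq_iff zero_index option.exhaust)
    then have "0 < (\<Sum>a\<in>UNIV. exp (-2 * y a * x $ None) * v $ Some a * v $ Some a)"
      by (intro sum_pos2[of _ a]) (auto simp: mult.assoc zero_less_mult_iff linorder_neq_iff)
    then show ?thesis by (simp add: gform_base_metric True)
  next
    case False
    then have "0 < v $ None * v $ None" by (auto simp: zero_less_mult_iff linorder_neq_iff)
    then show ?thesis using s by (simp add: gform_base_metric)
  qed
qed

lemma pseudo_riemannian_base_metric:
  assumes "open M" "(\<Sum>i\<in>UNIV. y i) = 0"
  shows "pseudo_riemannian_metric M (base_metric y)"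
proof -
  have "transpose (base_metric y x) = base_metric y x" for x
    by (auto simp: vec_eq_iff transpose_def base_metric_def)
  then show ?thesis
    unfolding pseudo_riemannian_metric_def
    by (simp add: invertible_det_nz det_base_metric[OF assms(2)] smooth_on_base_metric[OF assms(1)])
qed

lemma normal_dist_base_metric: "normal_dist (base_metric y) x = {v. \<forall>a. v $ Some a = 0}"
proof -
  have "gform (base_metric y x) v (axis (Some a) 1) = exp (-2 * y a * x $ None) * v $ Some a" for v a
    by (simp add: gform_axis_right sum_UNIV_option if_distrib[of "\<lambda>a. a * _"] cong: if_cong)
  moreover have "gform (base_metric y x) v (axis (Some a) 1) = 0" if "v \<in> normal_dist (base_metric y) x" for v a
    using that axis_Some_leaf_dist[of a] by (simp add: normal_dist_def)
  ultimately have "v $ Some a = 0" if "v \<in> normal_dist (base_metric y) x" for v a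
    using that by simp
  then show ?thesis
    by (auto simp: normal_dist_def gform_base_metric leaf_dist_def)
qed

lemma foliated_base_metric:
  fixes M :: "(real^'n::finite option) set"
  assumes "open M" "(\<Sum>i\<in>UNIV. y i) = 0"
  shows "foliated_metric M (base_metric y) (\<lambda>x. axis None 1)"
proof
  show "smooth_on M (\<lambda>x. axis None 1 $ k)" for k :: "'n option"
    by (rule smooth_on_const)
  show "axis None 1 \<in> normal_dist (base_metric y) x" and "gform (base_metric y x) (axis None 1) (axis None 1) = 1" for x
    by (simp_all add: normal_dist_base_metric gform_base_metric axis_def)
qed (simp_all add: assms pseudo_riemannian_base_metric det_base_metric base_metric_pos)

lemma cov_diff_base_metric:
  fixes M :: "(real^'n::finite option) set"
  assumes "open M" "(\<Sum>i\<in>UNIV. y i) = 0" "x \<in> M"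
  shows "cov_diff (base_metric y) (\<lambda>x. axis None 1) (Some j) k x = (if k = Some j then - y j else 0)"
proof (cases k)
  case None
  then show ?thesis
    using foliated_metric.cov_diff_None[OF foliated_base_metric[OF assms(1,2)] assms(3)] by simp
next
  case (Some i)
  have "(\<Sum>p\<in>UNIV. axis None 1 $ p * f p) = f None" for f :: "'n option \<Rightarrow> real"
    by (simp add: sum_UNIV_option axis_def)
  note * = foliated_metric.cov_diff_leaf[OF foliated_base_metric[OF assms(1,2)] assms(3), of i "Some j",
      unfolded this pd_base_metric]
  have "(\<Sum>l\<in>UNIV. base_metric y x $ Some i $ Some l * f l) = exp (-2 * y i * x $ None) * f i" for f
    by (simp add: if_distrib[of "\<lambda>a. a * _"] cong: if_cong)
  note ** = *[unfolded this]
  define c where "c = cov_diff (base_metric y) (\<lambda>x. axis None 1) (Some j) (Some i) x"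
  define r where "r = exp (-2 * y i * x $ None)"
  have r: "r \<noteq> 0" by (simp add: r_def)
  have "r * c = r * (if i = j then - y j else 0)"
    using **[folded c_def r_def] by (cases "i = j") (simp_all add: r_def)
  then have "c = (if i = j then - y j else 0)"
    by (simp only: mult_left_cancel[OF r])
  then show ?thesis using Some by (cases "i = j") (simp_all only: c_def option.inject if_True if_False)
qed

section \<open>Variations with fixed leaf metric\<close>

lemma sum_delta_mult:
  fixes f g :: "'n::finite \<Rightarrow> real"
  shows "(\<Sum>i\<in>UNIV. (if i = a then f i else 0) * g i) = f a * g a"
    and "(\<Sum>i\<in>UNIV. (if a = i then f i else 0) * g i) = f a * g a"
    and "(\<Sum>i\<in>UNIV. g i * (if i = a then f i else 0)) = g a * f a"
    and "(\<Sum>i\<in>UNIV. g i * (if a = i then f i else 0)) = g a * f a"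
  by (simp_all add: if_distrib[of "\<lambda>z. z * _"] if_distrib[of "\<lambda>z. _ * z"] cong: if_cong)

lemma gform_axis_axis: "gform G (axis i 1) (axis j 1) = G $ i $ j"
  unfolding gform_axis_left by (simp add: axis_def sum_delta_mult)

text \<open>The support is closed only relative to \<open>M\<close>. Since the closure of \<Omega>
  is compact and contained in \<open>M\<close>, the full closure lies in \<open>M\<close> too, and
  the support is compact.\<close>

lemma variation_support:
  assumes "relatively_compact_in M \<Omega>" "variation M \<Omega> g \<epsilon> G"
  obtains K where "compact K" "K \<subseteq> \<Omega>" "\<And>t x. t \<in> {-\<epsilon><..<\<epsilon>} \<Longrightarrow> x \<in> M - K \<Longrightarrow> G t x = g x"
proof
  let ?S = "{x \<in> M. \<exists>t\<in>{-\<epsilon><..<\<epsilon>}. G t x \<noteq> g x}"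
  have sub: "M \<inter> closure ?S \<subseteq> \<Omega>" and \<Omega>: "\<Omega> \<subseteq> M" "compact (closure \<Omega>)" "closure \<Omega> \<subseteq> M"
    using assms by (auto simp: variation_def relatively_compact_in_def)
  have "?S \<subseteq> M \<inter> closure ?S" using closure_subset[of ?S] by auto
  then have "closure ?S \<subseteq> closure \<Omega>" using sub by (intro closure_mono) auto
  then have "closure \<Omega> \<inter> closure ?S = closure ?S" by blast
  then show "compact (closure ?S)"
    using compact_Int_closed[OF \<Omega>(2) closed_closure[of ?S]] by simp
  show "closure ?S \<subseteq> \<Omega>"
    using sub \<Omega> \<open>closure ?S \<subseteq> closure \<Omega>\<close> by blast
  show "G t x = g x" if "t \<in> {-\<epsilon><..<\<epsilon>}" "x \<in> M - closure ?S" for t x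
    using that closure_subset[of ?S] by blast
qed

text \<open>The bound at t = 0 forces \<open>J 0 = c\<close>, and the difference quotient is then at
  most \<open>C * \<bar>t\<bar>\<close>. Nothing is needed about the regularity of \<open>J\<close>
  away from 0.\<close>

lemma has_real_derivative_0_quadratic_bound:
  fixes J :: "real \<Rightarrow> real"
  assumes "\<delta> > 0" and bound: "\<And>t. \<bar>t\<bar> < \<delta> \<Longrightarrow> \<bar>J t - c\<bar> \<le> C * t\<^sup>2"
  shows "(J has_real_derivative 0) (at 0)"
proof -
  have J0: "J 0 = c" using bound[of 0] assms(1) by simp
  have "((\<lambda>h. (J (0 + h) - J 0) / h) \<longlongrightarrow> 0) (at 0)"
  proof (rule Lim_null_comparison)
    show "((\<lambda>h. C * \<bar>h\<bar>) \<longlongrightarrow> 0) (at (0::real))"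
      by (auto intro!: tendsto_eq_intros)
    have "norm ((J (0 + h) - J 0) / h) \<le> C * \<bar>h\<bar>" if "\<bar>h\<bar> < \<delta>" "h \<noteq> 0" for h
    proof -
      have "\<bar>J h - c\<bar> \<le> C * \<bar>h\<bar> * \<bar>h\<bar>" using bound[OF that(1)] by (simp add: power2_eq_square mult.assoc)
      then show ?thesis using that(2) by (simp add: J0 abs_divide pos_divide_le_eq)
    qed
    then show "\<forall>\<^sub>F h in at 0. norm ((J (0 + h) - J 0) / h) \<le> C * \<bar>h\<bar>"
      unfolding eventually_at using \<open>\<delta> > 0\<close> by (auto simp: dist_real_def)
  qed
  then show ?thesis by (simp add: DERIV_def)
qed

lemma normal_dist_diff:
  "u \<in> normal_dist h x \<Longrightarrow> v \<in> normal_dist h x \<Longrightarrow> u - v \<in> normal_dist h x"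
  by (simp add: normal_dist_def gform_diff)

lemma leaf_part_eq:
  assumes "leaf_dist \<inter> normal_dist h x = {0}" "u \<in> leaf_dist" "v - u \<in> normal_dist h x"
  shows "leaf_part h x v = u"
  unfolding leaf_part_def
proof (rule the_equality)
  fix w assume w: "w \<in> leaf_dist \<and> v - w \<in> normal_dist h x"
  have "(v - u) - (v - w) \<in> normal_dist h x"
    using normal_dist_diff[OF assms(3)] w by blast
  then have "w - u \<in> leaf_dist \<inter> normal_dist h x"
    using w assms(2) subspace_diff[OF subspace_leaf_dist, of w u] by simp
  then show "w = u" using assms(1) by auto
qed (use assms in auto)

lemma vol_density_base_metric: "(\<Sum>i\<in>UNIV. y i) = 0 \<Longrightarrow> vol_density (base_metric y) x = 1"
  by (simp add: vol_density_def det_base_metric)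

lemma Vol_base_metric: "(\<Sum>i\<in>UNIV. y i) = 0 \<Longrightarrow> Vol \<Omega> (base_metric y) = measure lborel \<Omega>"
  by (simp add: Vol_def vol_density_base_metric set_lebesgue_integral_def)

text \<open>The trace of the square of diag(y) + S, split by degree in S. The linear part has to
  integrate to zero or to second order; the quadratic part goes into the error.\<close>

lemma sum_diagonal_perturbation:
  fixes y :: "'n::finite \<Rightarrow> real" and S :: "'n \<Rightarrow> 'n \<Rightarrow> real"
  shows "(\<Sum>i\<in>UNIV. \<Sum>j\<in>UNIV. ((if j = i then y j else 0) + S j i) * ((if i = j then y i else 0) + S i j))
    = (\<Sum>i\<in>UNIV. (y i)\<^sup>2) + 2 * (\<Sum>i\<in>UNIV. y i * S i i) + (\<Sum>i\<in>UNIV. \<Sum>j\<in>UNIV. S i j * S j i)"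
proof -
  define d where "d i j = (if i = j then y i else 0)" for i j
  have d: "(\<Sum>j\<in>UNIV. d i j * z j) = y i * z i" "(\<Sum>j\<in>UNIV. d j i * z j) = y i * z i" for i z
    by (simp_all add: d_def sum_delta_mult)
  have "(\<Sum>i\<in>UNIV. \<Sum>j\<in>UNIV. (d j i + S j i) * (d i j + S i j))
    = (\<Sum>i\<in>UNIV. \<Sum>j\<in>UNIV. d j i * d i j + d j i * S i j + d i j * S j i + S i j * S j i)"
    by (intro sum.cong refl) (simp add: distrib_left distrib_right)
  also have "\<dots> = (\<Sum>i\<in>UNIV. y i * d i i) + (\<Sum>i\<in>UNIV. y i * S i i) + (\<Sum>i\<in>UNIV. y i * S i i)
      + (\<Sum>i\<in>UNIV. \<Sum>j\<in>UNIV. S i j * S j i)"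
    by (simp only: sum.distrib d)
  finally show ?thesis by (simp add: d_def power2_eq_square)
qed

text \<open>The metric $a\,dx_0^2 + \sum_i e^{-2y_ix_0}(dx_i + \beta_i\,dx_0)^2$ with
  $b_i = e^{-2y_ix_0}\beta_i$: squared lapse \<open>a\<close>, shift $\beta$.\<close>

locale shifted_metric =
  fixes M :: "(real^'n::finite option) set" and y :: "'n \<Rightarrow> real" and h :: "'n option metric"
    and a :: "real^'n option \<Rightarrow> real" and b :: "'n \<Rightarrow> real^'n option \<Rightarrow> real"
  assumes open_M: "open M" and y: "(\<Sum>i\<in>UNIV. y i) = 0"
    and smooth_a: "smooth_on M a" and smooth_b: "\<And>i. smooth_on M (b i)"
    and a_pos: "\<And>x. x \<in> M \<Longrightarrow> a x > 0"
    and h_None: "\<And>x. x \<in> M \<Longrightarrow> h x $ None $ None = a x + (\<Sum>i\<in>UNIV. exp (2 * y i * x $ None) * (b i x)\<^sup>2)"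
    and h_mixed: "\<And>x i. x \<in> M \<Longrightarrow> h x $ None $ Some i = b i x" "\<And>x i. x \<in> M \<Longrightarrow> h x $ Some i $ None = b i x"
    and h_leaf: "\<And>x i j. x \<in> M \<Longrightarrow> h x $ Some i $ Some j = base_metric y x $ Some i $ Some j"
begin

text \<open>The coordinate vector of x_0 minus the shift vector: orthogonal to the leaves, of
  squared length \<open>a\<close>.\<close>

definition normal where
  "normal x = (\<chi> k. case k of None \<Rightarrow> 1 | Some i \<Rightarrow> - exp (2 * y i * x $ None) * b i x)"

lemma normal_simps [simp]: "normal x $ None = 1" "normal x $ Some i = - exp (2 * y i * x $ None) * b i x"
  by (simp_all add: normal_def)

definition N where "N x = (1 / sqrt (a x)) *\<^sub>R normal x"

text \<open>The symmetrised derivative of the shift along the leaf, with its first index raised by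
  the leaf metric. That metric depends on x_0 alone and is flat on each leaf, so partial derivatives
  suffice.\<close>

definition shear where
  "shear i j x = exp (2 * y i * x $ None) * (pd (Some j) (b i) x + pd (Some i) (b j) x) / 2"

lemma exp_cancel: "exp (- (2 * y i * r)) * (exp (2 * y i * r) * z) = z"
  "exp (2 * y i * r) * (exp (- (2 * y i * r)) * z) = z"
  by (simp_all add: mult.assoc[symmetric] flip: exp_add)

lemma gform_normal:
  assumes x: "x \<in> M"
  shows "gform (h x) (normal x) v = a x * v $ None"
proof -
  have "(\<Sum>k\<in>UNIV. h x $ k $ l * normal x $ k) = (if l = None then a x else 0)" for l
    unfolding sum_UNIV_option
    by (cases l) (simp_all add: h_None[OF x] h_mixed[OF x] h_leaf[OF x] power2_eq_square sum_negf
        mult.left_commute[of "b _ x"] exp_cancel sum_delta_mult)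
  moreover have "gform (h x) (normal x) v = (\<Sum>l\<in>UNIV. (\<Sum>k\<in>UNIV. h x $ k $ l * normal x $ k) * v $ l)"
    unfolding gform_sum by (subst sum.swap) (simp add: sum_distrib_right)
  ultimately show ?thesis by (simp add: sum_UNIV_option)
qed

lemma gform_leaf:
  assumes "x \<in> M" "v \<in> leaf_dist"
  shows "gform (h x) v v = gform (base_metric y x) v v"
  using assms by (simp add: gform_sum sum_UNIV_option leaf_dist_def h_leaf)

lemma transpose_h: "x \<in> M \<Longrightarrow> transpose (h x) = h x"
proof -
  assume x: "x \<in> M"
  have "h x $ j $ i = h x $ i $ j" for i j
    by (cases i; cases j) (simp_all add: h_mixed[OF x] h_leaf[OF x])
  then show ?thesis by (simp add: vec_eq_iff transpose_def)
qed

text \<open>In the unimodular frame consisting of the normal and the leaf coordinate vectors the metric is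
  diagonal.\<close>

lemma det_h:
  assumes x: "x \<in> M"
  shows "det (h x) = a x"
proof -
  \<comment> \<open>The rows are the normal and the leaf coordinate vectors. \<open>R\<close> arises
    from the identity by adding multiples of the other rows to the row \<open>None\<close>, so its
    determinant is 1.\<close>
  define R :: "real^'n option^'n option" where
    "R = (\<chi> k. if k = None then row None (mat 1) + (normal x - axis None 1) else row k (mat 1))"
  have row1: "row k (mat 1 :: real^'n option^'n option) = axis k 1" for k
    by (simp add: row_def mat_def axis_def vec_eq_iff)
  have "normal x - axis None 1 = (\<Sum>i\<in>UNIV. normal x $ Some i *s row (Some i) (mat 1))"
  proof -
    have "(normal x - axis None 1) $ k = (\<Sum>i\<in>UNIV. normal x $ Some i *s row (Some i) (mat 1)) $ k" for k
      unfolding row1 by (cases k) (simp_all add: axis_def sum_delta_mult sum_negf del: minus_mult_left mult_minus_left)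
    then show ?thesis by (simp add: vec_eq_iff)
  qed
  also have "\<dots> \<in> vec.span {row j (mat 1 :: real^'n option^'n option) |j. j \<noteq> None}"
    by (intro vec.span_sum vec.span_scale vec.span_base) blast
  finally have "det R = det (mat 1 :: real^'n option^'n option)"
    unfolding R_def by (rule det_row_span)
  then have R1: "det R = 1" by simp
  have "row k R = R $ k" for k by (simp add: row_def)
  then have R: "row None R = normal x" "row (Some i) R = axis (Some i) 1" for i
    by (simp_all add: R_def row1)
  have entry: "(R ** h x ** transpose R) $ c $ d = gform (h x) (row c R) (row d R)" for c d
    unfolding gform_sum
    by (subst sum.swap) (simp add: matrix_matrix_mult_def transpose_def row_def sum_distrib_right sum_distrib_left mult_ac)
  have n: "gform (h x) v (normal x) = a x * v $ None" for v
    using gform_normal[OF x, of v] gform_commute[OF transpose_h[OF x], of v] by simp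
  have D: "(R ** h x ** transpose R) $ c $ d
      = (if c = d then (case c of None \<Rightarrow> a x | Some i \<Rightarrow> exp (-2 * y i * x $ None)) else 0)" for c d
    unfolding entry
    by (cases c; cases d) (simp_all add: R gform_normal[OF x] n gform_axis_axis h_leaf[OF x],
      simp_all add: axis_def)
  have "det (R ** h x ** transpose R) = (\<Prod>c\<in>UNIV. (R ** h x ** transpose R) $ c $ c)"
    by (rule det_diagonal) (simp add: D)
  also have "\<dots> = a x * exp (\<Sum>i\<in>UNIV. -2 * y i * x $ None)"
    by (simp add: D prod_UNIV_option exp_sum)
  also have "(\<Sum>i\<in>UNIV. -2 * y i * x $ None) = -2 * (\<Sum>i\<in>UNIV. y i) * x $ None"
    by (simp add: sum_distrib_left sum_distrib_right)
  finally show ?thesis by (simp add: det_mul R1 y)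
qed

lemma vol_density_h: "x \<in> M \<Longrightarrow> vol_density h x = sqrt (a x)"
  using a_pos by (simp add: vol_density_def det_h abs_of_pos)

lemma smooth_exp: "smooth_on M (\<lambda>x. exp (2 * y i * x $ None))"
  by (intro smooth_on_exp smooth_intros open_M)

lemma smooth_on_h: "smooth_on M (\<lambda>x. h x $ i $ j)"
proof -
  have "smooth_on M (\<lambda>x. a x + (\<Sum>i\<in>UNIV. exp (2 * y i * x $ None) * (b i x)\<^sup>2))"
    unfolding power2_eq_square by (intro smooth_intros smooth_exp smooth_a smooth_b open_M)
  then have "smooth_on M (\<lambda>x. h x $ None $ None)"
    by (rule smooth_on_cong[THEN iffD1, rotated 2]) (simp_all add: open_M h_None)
  moreover have "smooth_on M (\<lambda>x. h x $ None $ Some i)" "smooth_on M (\<lambda>x. h x $ Some i $ None)" for i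
    by (rule smooth_on_cong[THEN iffD1, rotated 2, OF smooth_b[of i]]; simp add: open_M h_mixed)+
  moreover have "smooth_on M (\<lambda>x. h x $ Some i $ Some j)" for i j
    by (rule smooth_on_cong[THEN iffD1, rotated 2, OF smooth_on_base_metric[OF open_M, of y "Some i" "Some j"]])
      (simp_all add: open_M h_leaf del: base_metric_simps)
  ultimately show ?thesis by (cases i; cases j) simp_all
qed

sublocale foliated_metric M h N
proof
  show "pseudo_riemannian_metric M h"
    using a_pos by (force simp: pseudo_riemannian_metric_def smooth_on_h transpose_h invertible_det_nz det_h)
  show "det (h x) > 0" if "x \<in> M" for x using that by (simp add: det_h a_pos)
  show "gform (h x) v v > 0" if "x \<in> M" "v \<in> leaf_dist" "v \<noteq> 0" for x v
    using that by (simp add: gform_leaf base_metric_pos)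
  show "smooth_on M (\<lambda>x. N x $ k)" for k
  proof -
    have "smooth_on M (\<lambda>x. normal x $ k)"
      by (cases k) (simp_all, (intro smooth_intros smooth_exp smooth_b open_M)+)
    moreover have "smooth_on M (\<lambda>x. sqrt (a x))"
      by (intro smooth_on_sqrt smooth_a open_M a_pos)
    moreover have "sqrt (a x) \<noteq> 0" if "x \<in> M" for x
      using a_pos[OF that] by simp
    ultimately have "smooth_on M (\<lambda>x. normal x $ k / sqrt (a x))"
      by (intro smooth_on_divide open_M)
    then show ?thesis by (simp add: N_def)
  qed
  show "N x \<in> normal_dist h x" if "x \<in> M" for x
    using that by (simp add: normal_dist_def N_def gform_scaleR gform_normal leaf_dist_def)
  show "gform (h x) (N x) (N x) = 1" if "x \<in> M" for x
    using that a_pos[OF that] by (simp add: N_def gform_scaleR gform_normal)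
qed (rule open_M)

lemma pd_h_leaf:
  assumes x: "x \<in> M"
  shows "pd p (\<lambda>z. h z $ Some i $ Some j) x = (if p = None \<and> i = j then -2 * y i * exp (-2 * y i * x $ None) else 0)"
proof -
  have "pd p (\<lambda>z. h z $ Some i $ Some j) x = pd p (\<lambda>z. base_metric y z $ Some i $ Some j) x"
    by (rule pd_cong[OF open_M x]) (rule h_leaf)
  then show ?thesis unfolding pd_base_metric by simp
qed

lemma pd_h_mixed:
  assumes x: "x \<in> M"
  shows "pd p (\<lambda>z. h z $ None $ Some j) x = pd p (b j) x" "pd p (\<lambda>z. h z $ Some j $ None) x = pd p (b j) x"
  by (rule pd_cong[OF open_M x], rule h_mixed(1), assumption)
    (rule pd_cong[OF open_M x], rule h_mixed(2))

lemma N_simps: "N x $ None = 1 / sqrt (a x)" "N x $ Some i = - exp (2 * y i * x $ None) * b i x / sqrt (a x)"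
  by (simp_all add: N_def)

lemma sum_h_leaf: "x \<in> M \<Longrightarrow> (\<Sum>l\<in>UNIV. h x $ Some i $ Some l * f l) = exp (-2 * y i * x $ None) * f i"
  by (simp add: h_leaf if_distrib[of "\<lambda>z. z * _"] cong: if_cong)

text \<open>The leaf block of the metric depends on x_0 alone, so in \<open>cov_diff_leaf\<close>
  every summand with a leaf component of \<open>N\<close> vanishes; the \<open>None\<close> summand
  contains the x_0-derivative of the leaf metric, which gives \<open>y\<close>, and the derivatives
  of the shift, which give the shear.\<close>

lemma cov_diff_shifted:
  assumes x: "x \<in> M"
  shows "cov_diff h N (Some j) (Some i) x = - (1 / sqrt (a x)) * ((if i = j then y i else 0) + shear i j x)"
proof -
  define c where "c = cov_diff h N (Some j) (Some i) x"
  have "exp (-2 * y i * x $ None) * c = 1/2 * (1 / sqrt (a x) *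
      ((if i = j then -2 * y i * exp (-2 * y i * x $ None) else 0) - pd (Some j) (b i) x - pd (Some i) (b j) x))"
    using cov_diff_leaf[OF x, of i "Some j"]
    unfolding sum_h_leaf[OF x] sum_UNIV_option pd_h_leaf[OF x] pd_h_mixed[OF x] c_def[symmetric]
    by (cases "i = j") (simp_all add: N_simps)
  from arg_cong[OF this, of "\<lambda>z. exp (2 * y i * x $ None) * z"]
  have "c = exp (2 * y i * x $ None) * (1/2 * (1 / sqrt (a x) *
      ((if i = j then -2 * y i * exp (-2 * y i * x $ None) else 0) - pd (Some j) (b i) x - pd (Some i) (b j) x)))"
    by (simp add: exp_cancel)
  also have "\<dots> = - (1 / sqrt (a x)) * ((if i = j then exp (2 * y i * x $ None) * (exp (- (2 * y i * x $ None)) * y i) else 0) + shear i j x)"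
    by (simp add: shear_def algebra_simps diff_divide_distrib add_divide_distrib)
  also have "\<dots> = - (1 / sqrt (a x)) * ((if i = j then y i else 0) + shear i j x)"
    unfolding exp_cancel ..
  finally show ?thesis unfolding c_def .
qed

lemma shear_zero:
  assumes "closed K" "x \<in> M - K" "\<And>x i. x \<in> M - K \<Longrightarrow> b i x = 0"
  shows "shear i j x = 0"
proof -
  have "pd p (b i) x = pd p (\<lambda>z. 0) x" for p i
    by (rule pd_cong[of "M - K"]) (use assms open_M in \<open>auto intro: open_Diff\<close>)
  then show ?thesis by (simp add: shear_def)
qed

text \<open>Off \<open>K\<close> the shift is zero and the lapse constant, so the normal is a
  constant multiple of a coordinate vector and geodesic; the trace of the shape operator reduces to
  that of the shear because the \<open>y i\<close> sum to 0. The density contributes sqrt a and the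
  squared shape operator 1/a, whence the prefactor.\<close>

lemma J_action_shifted:
  assumes \<Omega>: "relatively_compact_in M \<Omega>" "open \<Omega>" and K: "compact K" "K \<subseteq> \<Omega>"
    and b0: "\<And>x i. x \<in> M - K \<Longrightarrow> b i x = 0" and a0: "\<And>x. x \<in> M - K \<Longrightarrow> a x = a0"
  defines "f \<equiv> \<lambda>x. 1 / sqrt (a x) * ((\<Sum>i\<in>UNIV. shear i i x)\<^sup>2 - (\<Sum>i\<in>UNIV. \<Sum>j\<in>UNIV. shear i j x * shear j i x)
        - (\<Sum>i\<in>UNIV. (y i)\<^sup>2) - 2 * (\<Sum>i\<in>UNIV. y i * shear i i x))"
  shows "J_action \<Omega> h = (LINT x:\<Omega>|lborel. f x)"
proof -
  have oK: "open (M - K)" using K open_M by (simp add: compact_imp_closed open_Diff)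
  have cK: "closed K" using K by (simp add: compact_imp_closed)
  have tr: "(\<Sum>i\<in>UNIV. cov_diff h N (Some i) (Some i) x) = - (1 / sqrt (a x)) * (\<Sum>i\<in>UNIV. shear i i x)"
    if "x \<in> M" for x
    using that by (simp add: cov_diff_shifted sum_distrib_left[symmetric] sum.distrib y sum_negf sum_divide_distrib[symmetric])
  have minimal: "(\<Sum>i\<in>UNIV. cov_diff h N (Some i) (Some i) x) = 0" if "x \<in> M - K" for x
    using that tr shear_zero[OF cK that b0] by simp
  have geodesic: "(\<Sum>k\<in>UNIV. N x $ k * cov_diff h N k l x) = 0" if x: "x \<in> M - K" for x l
  proof -
    have N0: "N x $ Some i = 0" for i using b0[OF x] by (simp add: N_simps)
    have xM: "x \<in> M" using x by simp
    have "cov_diff h N None l x = 0"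
    proof (cases l)
      case None
      then show ?thesis using cov_diff_None[OF xM] by simp
    next
      case (Some i)
      have "pd (Some i) (\<lambda>z. h z $ None $ None) x = pd (Some i) (\<lambda>z. a0) x"
        by (rule pd_cong[OF oK x]) (simp add: h_None b0 a0)
      then have "exp (-2 * y i * x $ None) * cov_diff h N None (Some i) x = 0"
        using cov_diff_leaf[OF xM, of i None]
        unfolding sum_h_leaf[OF xM] sum_UNIV_option pd_h_mixed[OF xM] by (simp add: N0)
      then show ?thesis using Some by simp
    qed
    then show ?thesis by (simp add: sum_UNIV_option N0)
  qed
  have eq: "vol_density h x * extrinsic x = f x"
    if x: "x \<in> M" for x
  proof -
    define r where "r = sqrt (a x)"
    have r: "r > 0" using a_pos[OF x] by (simp add: r_def)
    have "(\<Sum>i\<in>UNIV. \<Sum>j\<in>UNIV. cov_diff h N (Some i) (Some j) x * cov_diff h N (Some j) (Some i) x)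
        = (1/r)\<^sup>2 * (\<Sum>i\<in>UNIV. \<Sum>j\<in>UNIV. ((if j = i then y j else 0) + shear j i x) * ((if i = j then y i else 0) + shear i j x))"
      by (simp add: cov_diff_shifted[OF x] r_def[symmetric] sum_distrib_left power2_eq_square mult_ac)
    note 2 = this[unfolded sum_diagonal_perturbation[of y "\<lambda>i j. shear i j x"]]
    show ?thesis
      unfolding f_def extrinsic_def 2 tr[OF x] vol_density_h[OF x] r_def[symmetric]
      using r by (simp add: power_mult_distrib power2_eq_square field_simps)
  qed
  have \<Omega>M: "\<Omega> \<subseteq> M" using \<Omega> by (simp add: relatively_compact_in_def)
  show ?thesis
    by (rule trans[OF J_action_eq[OF \<Omega> K geodesic minimal] set_lebesgue_integral_cong]) (use eq \<Omega>M \<Omega> in auto)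
qed

end

section \<open>Uniform estimates and the normalised metric for fixed leaf metric\<close>

lemma smooth_families_lipschitz:
  fixes F :: "'k::finite \<Rightarrow> real \<times> (real ^ 'm::finite) \<Rightarrow> real"
  assumes "\<And>k. smooth_on ({-\<epsilon><..<\<epsilon>} \<times> M) (F k)" "\<epsilon> > 0" "compact C" "C \<subseteq> M"
  obtains L where "L \<ge> 0" "\<And>k t x. \<bar>t\<bar> \<le> \<epsilon> / 2 \<Longrightarrow> x \<in> C \<Longrightarrow> \<bar>F k (t, x) - F k (0, x)\<bar> \<le> L * \<bar>t\<bar>"
proof -
  have "\<forall>k. \<exists>L\<ge>0. \<forall>t x. \<bar>t\<bar> \<le> \<epsilon> / 2 \<and> x \<in> C \<longrightarrow> \<bar>F k (t, x) - F k (0, x)\<bar> \<le> L * \<bar>t\<bar>"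
    using smooth_family_lipschitz[OF assms] by blast
  then obtain l where l: "\<And>k. l k \<ge> 0"
    "\<And>k t x. \<bar>t\<bar> \<le> \<epsilon> / 2 \<Longrightarrow> x \<in> C \<Longrightarrow> \<bar>F k (t, x) - F k (0, x)\<bar> \<le> l k * \<bar>t\<bar>"
    unfolding choice_iff by auto
  show ?thesis
  proof (rule that[of "\<Sum>k\<in>UNIV. l k"])
    show "(\<Sum>k\<in>UNIV. l k) \<ge> 0" by (intro sum_nonneg l)
    show "\<bar>F k (t, x) - F k (0, x)\<bar> \<le> (\<Sum>k\<in>UNIV. l k) * \<bar>t\<bar>" if "\<bar>t\<bar> \<le> \<epsilon> / 2" "x \<in> C" for k t x
    proof -
      have "l k * \<bar>t\<bar> \<le> (\<Sum>k\<in>UNIV. l k) * \<bar>t\<bar>"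
        by (intro mult_right_mono member_le_sum l) auto
      then show ?thesis using l(2)[OF that, of k] by linarith
    qed
  qed
qed

lemma measure_open_pos:
  fixes \<Omega> :: "'a::euclidean_space set"
  assumes "open \<Omega>" "\<Omega> \<noteq> {}" "emeasure lborel \<Omega> < \<infinity>"
  shows "measure lborel \<Omega> > 0"
proof -
  obtain c r where r: "r > 0" "ball c r \<subseteq> \<Omega>"
    using assms by (meson ex_in_conv open_contains_ball)
  have "0 < measure lborel (ball c r)" using content_ball_pos[OF r(1)] by simp
  also have "\<dots> \<le> measure lborel \<Omega>"
    using assms r by (intro measure_mono_fmeasurable) (auto simp: fmeasurable_def)
  finally show ?thesis .
qed

lemma (in shifted_metric) nondegenerate: "x \<in> M \<Longrightarrow> leaf_dist \<inter> normal_dist h x = {0}"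
proof -
  assume x: "x \<in> M"
  have "v = 0" if "v \<in> leaf_dist" "v \<in> normal_dist h x" for v
    using that leaf_pos[OF x, of v] by (force simp: normal_dist_def)
  moreover have "0 \<in> leaf_dist \<inter> normal_dist h x"
    by (simp add: leaf_dist_def normal_dist_def gform_zero)
  ultimately show ?thesis by blast
qed

text \<open>The normal line of \<open>h\<close> is kept and only lengths along it are rescaled, so
  the shift is unchanged and the squared lapse acquires the factor \<open>c\<close>.\<close>

lemma (in shifted_metric) bar_perp_shifted:
  assumes c: "vol_factor 1 \<Omega> (base_metric y) h = c" "c > 0"
  shows "shifted_metric M y (bar_perp \<Omega> (base_metric y) h) (\<lambda>x. c * a x) b"
proof
  have lp: "leaf_part h x (axis None 1) = axis None 1 - normal x" "leaf_part h x (axis (Some i) 1) = axis (Some i) 1"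
    if x: "x \<in> M" for x i
  proof -
    have "axis None 1 - normal x \<in> leaf_dist" by (simp add: leaf_dist_def axis_def)
    then show "leaf_part h x (axis None 1) = axis None 1 - normal x"
      by (rule leaf_part_eq[OF nondegenerate[OF x]])
        (simp add: normal_dist_def gform_normal[OF x] leaf_dist_def)
    show "leaf_part h x (axis (Some i) 1) = axis (Some i) 1"
      by (rule leaf_part_eq[OF nondegenerate[OF x] axis_Some_leaf_dist]) (simp add: normal_dist_def gform_zero)
  qed
  note bar = bar_perp_def c(1)[unfolded One_nat_def] normal_part_def
  show "open M" "(\<Sum>i\<in>UNIV. y i) = 0" "smooth_on M (b i)" for i
    by (rule open_M y smooth_b)+
  show "smooth_on M (\<lambda>x. c * a x)" by (intro smooth_on_mult smooth_on_const smooth_a open_M)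
  show "c * a x > 0" if "x \<in> M" for x using a_pos[OF that] c by simp
  fix x assume x: "x \<in> M"
  have n: "gform (h x) (normal x) (normal x) = a x" using gform_normal[OF x, of "normal x"] by simp
  have s: "gform (base_metric y x) (axis None 1 - normal x) (axis (Some i) 1) = b i x"
    "gform (base_metric y x) (axis (Some i) 1) (axis None 1 - normal x) = b i x" for i
    unfolding gform_axis_right gform_axis_left sum_UNIV_option
    by (simp_all add: axis_def sum_delta_mult exp_cancel)
  have s0: "gform (base_metric y x) (axis None 1 - normal x) (axis None 1 - normal x)
      = (\<Sum>i\<in>UNIV. exp (2 * y i * x $ None) * (b i x)\<^sup>2)"
    by (simp add: gform_base_metric axis_def exp_cancel) (simp add: power2_eq_square mult_ac)
  show "bar_perp \<Omega> (base_metric y) h x $ None $ None = c * a x + (\<Sum>i\<in>UNIV. exp (2 * y i * x $ None) * (b i x)\<^sup>2)"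
    by (simp add: bar lp[OF x] n s0)
  show "bar_perp \<Omega> (base_metric y) h x $ None $ Some i = b i x"
    "bar_perp \<Omega> (base_metric y) h x $ Some i $ None = b i x" for i
    by (simp_all add: bar lp[OF x] s gform_zero)
  show "bar_perp \<Omega> (base_metric y) h x $ Some i $ Some j = base_metric y x $ Some i $ Some j" for i j
    by (simp add: bar lp[OF x] gform_zero gform_axis_axis del: base_metric_simps)
qed

text \<open>Expansion of the integrand of $J(\bar g_t)$ for the lapse $\alpha = 1 + O(\tau)$ and a shear of
  order \<open>\<tau>\<close>; \<open>s\<close> is $\sum_i y_i^2$.\<close>

lemma shifted_integrand_bound:
  fixes \<alpha> Q Y s \<tau> :: real
  assumes \<alpha>: "\<bar>\<alpha> - 1\<bar> \<le> \<tau>" "\<tau> \<le> 1/2" and Q: "\<bar>Q\<bar> \<le> A * \<tau>\<^sup>2" and Y: "\<bar>Y\<bar> \<le> B * \<tau>" and s: "s \<ge> 0"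
  shows "\<bar>1 / \<alpha> * (Q - s - 2 * Y) + s * (2 - \<alpha>) + 2 * Y\<bar> \<le> (2 * A + 2 * s + 4 * B) * \<tau>\<^sup>2"
proof -
  have a2: "\<alpha> \<ge> 1/2" using \<alpha> by linarith
  then have inv: "0 < 1 / \<alpha>" "1 / \<alpha> \<le> 2" by (auto simp: field_simps)
  have \<tau>: "\<tau> \<ge> 0" using \<alpha> by linarith
  \<comment> \<open>By 1/\<alpha> - (2 - \<alpha>) = (\<alpha> - 1)^2 / \<alpha> and 1 - 1/\<alpha>
    = (\<alpha> - 1)/\<alpha> every term is of second order.\<close>
  have "\<bar>1 / \<alpha> * (Q - s - 2 * Y) + s * (2 - \<alpha>) + 2 * Y\<bar>
      = \<bar>1 / \<alpha> * Q - s * (1 / \<alpha> * (\<alpha> - 1)\<^sup>2) + 2 * Y * (1 / \<alpha> * (\<alpha> - 1))\<bar>"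
    using a2 by (intro arg_cong[where f = abs]) (simp add: field_simps power2_eq_square)
  also have "\<dots> \<le> \<bar>1 / \<alpha> * Q\<bar> + \<bar>s * (1 / \<alpha> * (\<alpha> - 1)\<^sup>2)\<bar> + \<bar>2 * Y * (1 / \<alpha> * (\<alpha> - 1))\<bar>"
  proof -
    have "\<bar>a - b + c\<bar> \<le> \<bar>a\<bar> + \<bar>b\<bar> + \<bar>c\<bar>" for a b c :: real by linarith
    then show ?thesis .
  qed
  also have "\<bar>1 / \<alpha> * Q\<bar> \<le> 2 * (A * \<tau>\<^sup>2)"
    unfolding abs_mult using inv Q by (intro mult_mono) auto
  also have "\<bar>s * (1 / \<alpha> * (\<alpha> - 1)\<^sup>2)\<bar> \<le> s * (2 * \<tau>\<^sup>2)"
    unfolding abs_mult using inv s power_mono[OF \<alpha>(1), of 2] by (intro mult_mono) auto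
  also have "\<bar>2 * Y * (1 / \<alpha> * (\<alpha> - 1))\<bar> \<le> 2 * (B * \<tau>) * (2 * \<tau>)"
    unfolding abs_mult using inv Y \<alpha>(1) \<tau> by (intro mult_mono) auto
  finally show ?thesis by (simp add: algebra_simps power2_eq_square)
qed

text \<open>If $V = vm$ then $v(R - s(2m - V)) + sm = vR + sm(v-1)^2$.\<close>

lemma action_bound:
  fixes m V R s \<tau> C :: real
  assumes m: "m > 0" and V: "\<bar>V - m\<bar> \<le> \<tau> * m" and \<tau>: "\<tau> \<le> 1/2" and R: "\<bar>R\<bar> \<le> C * \<tau>\<^sup>2 * m" and s: "s \<ge> 0"
  shows "\<bar>V / m * (R - s * (2 * m - V)) - (- s * m)\<bar> \<le> (2 * C * m + s * m) * \<tau>\<^sup>2"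
proof -
  define v where "v = V / m"
  have Vm: "V = v * m" using m by (simp add: v_def)
  have "V - m = (v - 1) * m" by (simp add: Vm left_diff_distrib)
  then have "\<bar>v - 1\<bar> * m \<le> \<tau> * m" using V m by (simp add: abs_mult)
  then have v: "\<bar>v - 1\<bar> \<le> \<tau>" by (rule mult_right_le_imp_le[OF _ m])
  then have v2: "\<bar>v\<bar> \<le> 2" using \<tau> by linarith
  have "V / m * (R - s * (2 * m - V)) - (- s * m) = v * (R - s * (2 * m - v * m)) + s * m"
    using m by (simp add: v_def)
  also have "\<dots> = v * R + s * m * (v - 1)\<^sup>2"
    by (simp add: algebra_simps power2_eq_square)
  also have "\<bar>\<dots>\<bar> \<le> \<bar>v * R\<bar> + \<bar>s * m * (v - 1)\<^sup>2\<bar>" by (rule abs_triangle_ineq)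
  also have "\<bar>v * R\<bar> \<le> 2 * (C * \<tau>\<^sup>2 * m)"
    unfolding abs_mult using v2 R by (intro mult_mono) auto
  also have "\<bar>s * m * (v - 1)\<^sup>2\<bar> \<le> s * m * \<tau>\<^sup>2"
    unfolding abs_mult using s m power_mono[OF v, of 2] by (intro mult_mono) auto
  finally show ?thesis by (simp add: algebra_simps)
qed

text \<open>With the lapse \<open>\<alpha>\<close> of g_t, the normalised action is V/m times the
  integral of (1/\<alpha>)(Q - s - 2 ye). Up to second order this integrand is - s (2 - \<alpha>) -
  2 ye. The part \<open>ye\<close> integrates to zero, and the integral of 2 - \<alpha> is 2m - V,
  whose product with V/m differs from m only by (V - m)^2 / m.\<close>

lemma critical_perp_base_metric:
  fixes M :: "(real^'n::finite option) set" and y :: "'n \<Rightarrow> real"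
  assumes M: "open M" and y: "(\<Sum>i\<in>UNIV. y i) = 0" and \<Omega>: "relatively_compact_in M \<Omega>" "open \<Omega>"
  shows "critical_perp M \<Omega> (base_metric y)"
  unfolding critical_perp_def
proof (intro allI impI)
  fix \<epsilon> :: real and G assume pv: "perp_variation M \<Omega> (base_metric y) \<epsilon> G"
  show "((\<lambda>t. J_action \<Omega> (bar_perp \<Omega> (base_metric y) (G t))) has_real_derivative 0) (at 0)"
  proof (cases "\<Omega> = {}")
    case True
    then show ?thesis by (simp add: J_action_def set_lebesgue_integral_def)
  next
    case False
    let ?T = "{-\<epsilon><..<\<epsilon>}"
    have var: "variation M \<Omega> (base_metric y) \<epsilon> G" using pv by (simp add: perp_variation_def)
    have \<epsilon>: "\<epsilon> > 0" and G0: "\<And>x. x \<in> M \<Longrightarrow> G 0 x = base_metric y x"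
      and Gs: "\<And>i j. smooth_on (?T \<times> M) (\<lambda>(t, x). G t x $ i $ j)"
      and Gm: "\<And>t. t \<in> ?T \<Longrightarrow> pseudo_riemannian_metric M (G t)"
      using var by (auto simp: variation_def)
    obtain K where K: "compact K" "K \<subseteq> \<Omega>" and GK: "\<And>t x. t \<in> ?T \<Longrightarrow> x \<in> M - K \<Longrightarrow> G t x = base_metric y x"
      by (rule variation_support[OF \<Omega>(1) var]) blast
    have \<Omega>M: "\<Omega> \<subseteq> M" and C: "compact (closure \<Omega>)" "closure \<Omega> \<subseteq> M" and \<Omega>C: "\<Omega> \<subseteq> closure \<Omega>"
      using \<Omega>(1) closure_subset by (auto simp: relatively_compact_in_def)
    define m where "m = measure lborel \<Omega>"
    have m: "m > 0" unfolding m_def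
      by (rule measure_open_pos[OF \<Omega>(2) False relatively_compact_emeasure[OF \<Omega>]])
    define s where "s = (\<Sum>i\<in>UNIV. (y i)\<^sup>2)"
    have s: "s \<ge> 0" by (simp add: s_def sum_nonneg)

    \<comment> \<open>\<open>b\<close>, \<open>q\<close> and \<open>e\<close> are the shift
      covector, the squared lapse and the shear of \<open>G t\<close>, written as functions of t and
      x so that Lipschitz bounds are available before positivity of \<open>q\<close> is
      known.\<close>
    define b where "b t i x = G t x $ None $ Some i" for t i x
    define q where "q t x = G t x $ None $ None - (\<Sum>i\<in>UNIV. exp (2 * y i * x $ None) * (b t i x * b t i x))" for t x
    define e where "e t i j x = exp (2 * y i * x $ None) * (pd (Some j) (b t i) x + pd (Some i) (b t j) x) / 2" for t i j x

    have oTM: "open (?T \<times> M)" using M by (simp add: open_Times)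
    have Gs': "smooth_on (?T \<times> M) (\<lambda>z. G (fst z) (snd z) $ i $ j)" for i j
      using Gs[of i j] by (simp add: case_prod_beta')
    have es: "smooth_on (?T \<times> M) (\<lambda>z. exp (2 * y i * snd z $ None))" for i
      by (intro smooth_on_exp smooth_on_mult smooth_on_const smooth_on_linear oTM
          bounded_linear_compose[OF bounded_linear_vec_nth bounded_linear_snd])
    have bs: "smooth_on (?T \<times> M) (\<lambda>z. b (fst z) i (snd z))" for i
      unfolding b_def by (rule Gs')
    have pbs: "smooth_on (?T \<times> M) (\<lambda>z. pd p (b (fst z) i) (snd z))" for p i
      using smooth_on_joint_pd[OF _ M bs[of i], of p] by (simp add: case_prod_beta' open_greaterThanLessThan)
    have qs: "smooth_on (?T \<times> M) (\<lambda>z. q (fst z) (snd z))"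
      unfolding q_def by (intro smooth_on_diff smooth_on_sum smooth_on_mult Gs' es bs oTM)
    have es': "smooth_on (?T \<times> M) (\<lambda>z. e (fst z) i j (snd z))" for i j
    proof -
      have "smooth_on (?T \<times> M) (\<lambda>z. exp (2 * y i * snd z $ None) * (pd (Some j) (b (fst z) i) (snd z)
          + pd (Some i) (b (fst z) j) (snd z)) * (1/2))"
        by (intro smooth_on_mult smooth_on_add es pbs smooth_on_const oTM)
      then show ?thesis by (simp add: e_def)
    qed
    \<comment> \<open>One finite family of functions, so that a single constant \<open>L\<close>
      serves for the squared lapse and all entries of the shear.\<close>
    define F where "F k z = (case k of None \<Rightarrow> q (fst z) (snd z) | Some (i, j) \<Rightarrow> e (fst z) i j (snd z))"
      for k :: "('n \<times> 'n) option" and z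
    have Fs: "smooth_on (?T \<times> M) (F k)" for k
      unfolding F_def[abs_def] by (cases k) (auto simp: qs es' split: prod.split)
    obtain L where L: "L \<ge> 0" "\<And>k t x. \<bar>t\<bar> \<le> \<epsilon> / 2 \<Longrightarrow> x \<in> closure \<Omega> \<Longrightarrow> \<bar>F k (t, x) - F k (0, x)\<bar> \<le> L * \<bar>t\<bar>"
      by (rule smooth_families_lipschitz[of \<epsilon> M F, OF Fs \<epsilon> C]) blast
    have b0: "b 0 i x = 0" if "x \<in> M" for i x
      using that by (simp add: b_def G0)
    have q0: "q 0 x = 1" if "x \<in> M" for x
      using that by (simp add: q_def b0 G0)
    have e0: "e 0 i j x = 0" if "x \<in> M" for i j x
    proof -
      have "pd p (b 0 i) x = pd p (\<lambda>z. 0) x" for p i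
        by (rule pd_cong[OF M that]) (rule b0)
      then show ?thesis by (simp add: e_def)
    qed
    have qL: "\<bar>q t x - 1\<bar> \<le> L * \<bar>t\<bar>" and eL: "\<bar>e t i j x\<bar> \<le> L * \<bar>t\<bar>"
      if "\<bar>t\<bar> \<le> \<epsilon> / 2" "x \<in> \<Omega>" for t x i j
      using L(2)[OF that(1) subsetD[OF \<Omega>C that(2)], of None]
        L(2)[OF that(1) subsetD[OF \<Omega>C that(2)], of "Some (i, j)"] subsetD[OF \<Omega>M that(2)]
      by (simp_all add: F_def q0 e0)

    define Y where "Y = (\<Sum>i\<in>UNIV. \<bar>y i\<bar>)"
    define n where "n = real CARD('n)"
    \<comment> \<open>The constant of \<open>shifted_integrand_bound\<close> with
      \<open>2 * n\<^sup>2\<close> bounding the quadratic shear terms and \<open>Y\<close> the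
      weighted trace of the shear.\<close>
    define R where "R = 2 * (2 * n\<^sup>2) + 2 * s + 4 * Y"
    \<comment> \<open>The second entry makes \<open>L * \<bar>t\<bar>\<close> at most 1/2; the
      summand 1 covers the case \<open>L = 0\<close>.\<close>
    define \<delta> where "\<delta> = min (\<epsilon> / 2) (1 / (2 * (L + 1)))"
    have \<delta>: "\<delta> > 0" using \<epsilon> L(1) by (simp add: \<delta>_def)
    show ?thesis
    proof (rule has_real_derivative_0_quadratic_bound[OF \<delta>, where c = "- s * m" and C = "(2 * R * m + s * m) * L\<^sup>2"])
      fix t assume t\<delta>: "\<bar>t\<bar> < \<delta>"
      then have t: "\<bar>t\<bar> \<le> \<epsilon> / 2" "t \<in> ?T" using \<epsilon> by (auto simp: \<delta>_def)
      define \<tau> where "\<tau> = L * \<bar>t\<bar>"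
      have \<tau>: "0 \<le> \<tau>" "\<tau> \<le> 1/2"
      proof -
        have "\<bar>t\<bar> * (2 * (L + 1)) \<le> 1"
          using t\<delta> L(1) by (simp add: \<delta>_def pos_less_divide_eq less_imp_le)
        then show "\<tau> \<le> 1/2" using abs_ge_zero[of t] by (simp add: \<tau>_def algebra_simps)
        show "0 \<le> \<tau>" using L(1) by (simp add: \<tau>_def)
      qed
      have q\<tau>: "\<bar>q t x - 1\<bar> \<le> \<tau>" and e\<tau>: "\<bar>e t i j x\<bar> \<le> \<tau>" if "x \<in> \<Omega>" for x i j
        unfolding \<tau>_def by (rule qL[OF t(1) that], rule eL[OF t(1) that])
      have bK: "b t i x = 0" and qK: "q t x = 1" if "x \<in> M - K" for i x
        using GK[OF t(2) that] by (simp_all add: b_def q_def)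
      have qpos: "q t x > 0" if "x \<in> M" for x
      proof (cases "x \<in> \<Omega>")
        case True
        then show ?thesis using q\<tau>[of x] \<tau> by linarith
      next
        case False
        then have "x \<in> M - K" using that K by blast
        then show ?thesis using qK by simp
      qed
      note Gt = pseudo_riemannian_metricD[OF Gm[OF t(2)]]
      interpret G: shifted_metric M y "G t" "q t" "b t"
      proof
        show "smooth_on M (b t i)" for i unfolding b_def by (rule Gt(1))
        then show "smooth_on M (q t)"
          unfolding q_def by (intro smooth_on_diff smooth_on_sum smooth_on_mult smooth_on_exp smooth_on_coord smooth_on_const Gt(1) M)
        show "G t x $ Some i $ Some j = base_metric y x $ Some i $ Some j" if "x \<in> M" for x i j
        proof -
          have "gform (G t x) (axis (Some i) 1) (axis (Some j) 1) = gform (base_metric y x) (axis (Some i) 1) (axis (Some j) 1)"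
            by (rule bspec[OF bspec[OF bspec[OF bspec[OF conjunct2[OF pv[unfolded perp_variation_def]] t(2)] that]
              axis_Some_leaf_dist] axis_Some_leaf_dist])
          then show ?thesis by (simp only: gform_axis_axis)
        qed
        show "G t x $ Some i $ None = b t i x" if "x \<in> M" for x i
          unfolding b_def by (rule Gt(4)[OF that])
        show "G t x $ None $ None = q t x + (\<Sum>i\<in>UNIV. exp (2 * y i * x $ None) * (b t i x)\<^sup>2)" for x
          by (simp add: q_def power2_eq_square)
        show "G t x $ None $ Some i = b t i x" for x i by (simp add: b_def)
      qed (rule M y qpos, assumption?)+

      define \<alpha> where "\<alpha> x = sqrt (q t x)" for x
      have \<alpha>: "\<bar>\<alpha> x - 1\<bar> \<le> \<tau>" if "x \<in> \<Omega>" for x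
      proof -
        have "q t x \<ge> 0" using qpos[of x] that \<Omega>M by (simp add: subset_iff less_imp_le)
        from sqrt_minus_1_bound[OF this] show ?thesis using q\<tau>[OF that] unfolding \<alpha>_def by linarith
      qed
      have \<alpha>s: "smooth_on M \<alpha>" unfolding \<alpha>_def[abs_def] by (intro smooth_on_sqrt G.smooth_a M qpos)
      note si = relatively_compact_integrable_smooth[OF \<Omega>]
      define V where "V = Vol \<Omega> (G t)"
      have V: "V = (LINT x:\<Omega>|lborel. \<alpha> x)"
        unfolding V_def Vol_def
        by (rule set_lebesgue_integral_cong) (use \<Omega> \<Omega>M G.vol_density_h in \<open>auto simp: \<alpha>_def\<close>)
      have Vm: "\<bar>V - m\<bar> \<le> \<tau> * m"
        unfolding V m_def by (rule set_integral_near_measure[OF \<Omega> si[OF \<alpha>s] \<alpha>])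
      have "\<tau> * m \<le> 1/2 * m" using \<tau> m by (intro mult_right_mono) auto
      then have Vpos: "V > 0" using Vm m by linarith
      define c where "c = (m / V)\<^sup>2"
      have c: "c > 0" using m Vpos by (simp add: c_def)
      have vf: "vol_factor 1 \<Omega> (base_metric y) (G t) = c"
      proof -
        have "V / m > 0" using m Vpos by simp
        then have "(V / m) powr (- 2) = c"
          by (simp add: powr_minus powr_numeral c_def inverse_eq_divide power_divide)
        then show ?thesis
          by (simp add: vol_factor_def Vol_base_metric[OF y] m_def[symmetric] V_def[symmetric])
      qed
      interpret B: shifted_metric M y "bar_perp \<Omega> (base_metric y) (G t)" "\<lambda>x. c * q t x" "b t"
        by (rule G.bar_perp_shifted[OF vf c])
      have shear: "B.shear i j x = e t i j x" for i j x
        by (simp add: B.shear_def e_def)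
      define Q where "Q x = (\<Sum>i\<in>UNIV. e t i i x)\<^sup>2 - (\<Sum>i\<in>UNIV. \<Sum>j\<in>UNIV. e t i j x * e t j i x)" for x
      define ye where "ye x = (\<Sum>i\<in>UNIV. y i * e t i i x)" for x
      \<comment> \<open>The integrand of the action without the factor V/m, minus its approximation
        - s (2 - \<alpha>) - 2 ye; only \<open>r\<close> has to be estimated, the approximation is
        integrated exactly.\<close>
      define r where "r x = 1 / \<alpha> x * (Q x - s - 2 * ye x) + s * (2 - \<alpha> x) + 2 * ye x" for x
      have ets: "smooth_on M (e t i j)" for i j
        unfolding e_def[abs_def] divide_inverse
        by (intro smooth_on_mult smooth_on_add smooth_on_pd smooth_on_exp smooth_on_coord smooth_on_const G.smooth_b M)
      have Qs: "smooth_on M Q" unfolding Q_def[abs_def] power2_eq_square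
        by (intro smooth_on_diff smooth_on_sum smooth_on_mult ets M)
      have yes: "smooth_on M ye" unfolding ye_def[abs_def]
        by (intro smooth_on_sum smooth_on_mult smooth_on_const ets M)
      have \<alpha>n: "\<alpha> x \<noteq> 0" if "x \<in> M" for x using qpos[OF that] by (simp add: \<alpha>_def)
      have rs: "smooth_on M r" unfolding r_def[abs_def]
        by (intro smooth_on_add smooth_on_diff smooth_on_mult smooth_on_divide smooth_on_const Qs yes \<alpha>s M \<alpha>n)
      have rb: "\<bar>r x\<bar> \<le> R * \<tau>\<^sup>2" if x: "x \<in> \<Omega>" for x
        unfolding r_def R_def
      proof (rule shifted_integrand_bound[OF \<alpha>[OF x] \<tau>(2) _ _ s])
        have "\<bar>\<Sum>i\<in>UNIV. e t i i x\<bar> \<le> (\<Sum>i\<in>(UNIV::'n set). \<tau>)"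
          by (rule order_trans[OF sum_abs]) (intro sum_mono e\<tau>[OF x])
        then have 1: "\<bar>\<Sum>i\<in>UNIV. e t i i x\<bar> \<le> n * \<tau>" by (simp add: n_def)
        have "\<bar>\<Sum>i\<in>UNIV. \<Sum>j\<in>UNIV. e t i j x * e t j i x\<bar> \<le> (\<Sum>i\<in>(UNIV::'n set). \<Sum>j\<in>(UNIV::'n set). \<tau> * \<tau>)"
          by (rule order_trans[OF sum_abs], rule sum_mono, rule order_trans[OF sum_abs], rule sum_mono)
            (unfold abs_mult, intro mult_mono e\<tau>[OF x] \<tau> abs_ge_zero)
        then have 2: "\<bar>\<Sum>i\<in>UNIV. \<Sum>j\<in>UNIV. e t i j x * e t j i x\<bar> \<le> n\<^sup>2 * \<tau>\<^sup>2"
          by (simp add: n_def power2_eq_square mult_ac)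
        have "\<bar>(\<Sum>i\<in>UNIV. e t i i x)\<^sup>2\<bar> \<le> (n * \<tau>)\<^sup>2"
          using power_mono[OF 1, of 2] by simp
        then show "\<bar>Q x\<bar> \<le> (2 * n\<^sup>2) * \<tau>\<^sup>2"
          unfolding Q_def power_mult_distrib using 2 by linarith
        have "\<bar>ye x\<bar> \<le> (\<Sum>i\<in>UNIV. \<bar>y i\<bar> * \<tau>)"
          unfolding ye_def
          by (rule order_trans[OF sum_abs], rule sum_mono) (unfold abs_mult, intro mult_left_mono e\<tau>[OF x] abs_ge_zero)
        then show "\<bar>ye x\<bar> \<le> Y * \<tau>" by (simp add: Y_def sum_distrib_right)
      qed
      have ye0: "(LINT x:\<Omega>|lborel. ye x) = 0"
      proof -
        have bes: "smooth_on M (\<lambda>z. exp (2 * y i * z $ None) * b t i z)" for i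
          by (intro smooth_on_mult smooth_on_exp smooth_on_coord smooth_on_const G.smooth_b M)
        have "ye x = (\<Sum>i\<in>UNIV. y i * pd (Some i) (\<lambda>z. exp (2 * y i * z $ None) * b t i z) x)" if x: "x \<in> M" for x
        proof -
          \<comment> \<open>The exponential depends on x_0 only and may be moved under the
            derivative along the leaf.\<close>
          have "pd (Some i) (\<lambda>z. exp (2 * y i * z $ None) * b t i z) x = e t i i x" for i
            by (subst pd_mult)
              (auto simp: e_def pd_exp_None intro!: smooth_on_differentiable[OF _ x] smooth_on_exp smooth_on_mult smooth_on_const smooth_on_coord M G.smooth_b)
          then show ?thesis by (simp add: ye_def)
        qed
        then have "(LINT x:\<Omega>|lborel. ye x) = (LINT x:\<Omega>|lborel. (\<Sum>i\<in>UNIV. y i * pd (Some i) (\<lambda>z. exp (2 * y i * z $ None) * b t i z) x))"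
          using \<Omega>M \<Omega> by (intro set_lebesgue_integral_cong) auto
        also have "\<dots> = 0"
          by (rule integral_sum_pd_compact_support[OF M bes K \<Omega>]) (simp add: bK)
        finally show ?thesis .
      qed
      have "J_action \<Omega> (bar_perp \<Omega> (base_metric y) (G t)) = (LINT x:\<Omega>|lborel. V / m * (r x - (s * (2 - \<alpha> x) + 2 * ye x)))"
      proof -
        have "1 / sqrt (c * q t x) = V / m * (1 / \<alpha> x)" for x
          using m Vpos by (simp add: c_def real_sqrt_mult \<alpha>_def)
        then have "1 / sqrt (c * q t x) * (Q x - s - 2 * ye x) = V / m * (r x - (s * (2 - \<alpha> x) + 2 * ye x))" for x
          by (simp add: r_def)
        then show ?thesis
          using B.J_action_shifted[OF \<Omega> K bK, of c] qK
          by (simp add: shear Q_def[symmetric] ye_def[symmetric] s_def[symmetric])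
      qed
      also have "\<dots> = V / m * ((LINT x:\<Omega>|lborel. r x) - s * (2 * m - V))"
      proof -
        have "(LINT x:\<Omega>|lborel. r x - (s * (2 - \<alpha> x) + 2 * ye x))
            = (LINT x:\<Omega>|lborel. r x) - (s * ((LINT x:\<Omega>|lborel. 2) - (LINT x:\<Omega>|lborel. \<alpha> x)) + 2 * (LINT x:\<Omega>|lborel. ye x))"
          by (subst set_integral_diff(2) set_integral_add(2) set_integral_mult_right |
            (intro si rs smooth_on_add smooth_on_diff smooth_on_mult smooth_on_const \<alpha>s yes M; fail))+ simp
        then show ?thesis
          unfolding relatively_compact_integral_const[OF \<Omega>] m_def[symmetric] V[symmetric] ye0 by simp
      qed
      finally have J: "J_action \<Omega> (bar_perp \<Omega> (base_metric y) (G t)) = V / m * ((LINT x:\<Omega>|lborel. r x) - s * (2 * m - V))" .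
      have "\<bar>LINT x:\<Omega>|lborel. r x\<bar> \<le> R * \<tau>\<^sup>2 * m"
        unfolding m_def by (rule set_integral_bound[OF \<Omega> si[OF rs] rb])
      from action_bound[OF m Vm \<tau>(2) this s]
      show "\<bar>J_action \<Omega> (bar_perp \<Omega> (base_metric y) (G t)) - (- s * m)\<bar> \<le> (2 * R * m + s * m) * L\<^sup>2 * t\<^sup>2"
        unfolding J by (simp add: \<tau>_def power_mult_distrib mult.assoc)
    qed
  qed
qed

section \<open>Variations with fixed normal distribution\<close>

text \<open>The metric $dx_0^2 + c\,\gamma$ with $\gamma$ the restriction of \<open>Gm\<close> to the leaves.\<close>

locale spatial_metric =
  fixes M :: "(real^'n::finite option) set" and y :: "'n \<Rightarrow> real" and Gm h :: "'n option metric" and c :: real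
  assumes open_M: "open M" and y: "(\<Sum>i\<in>UNIV. y i) = 0" and c: "c > 0"
    and Gm: "pseudo_riemannian_metric M Gm"
    and Gm_det: "\<And>x. x \<in> M \<Longrightarrow> det (Gm x) > 0"
    and Gm_pos: "\<And>x v. x \<in> M \<Longrightarrow> v \<in> leaf_dist \<Longrightarrow> v \<noteq> 0 \<Longrightarrow> gform (Gm x) v v > 0"
    and Gm_None: "\<And>x. x \<in> M \<Longrightarrow> Gm x $ None $ None = 1" "\<And>x i. x \<in> M \<Longrightarrow> Gm x $ None $ Some i = 0"
      "\<And>x i. x \<in> M \<Longrightarrow> Gm x $ Some i $ None = 0"
    and h_None: "\<And>x. x \<in> M \<Longrightarrow> h x $ None $ None = 1" "\<And>x i. x \<in> M \<Longrightarrow> h x $ None $ Some i = 0"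
      "\<And>x i. x \<in> M \<Longrightarrow> h x $ Some i $ None = 0"
    and h_leaf: "\<And>x i j. x \<in> M \<Longrightarrow> h x $ Some i $ Some j = c * Gm x $ Some i $ Some j"
begin

abbreviation N :: "real^'n option \<Rightarrow> real^'n option" where "N \<equiv> \<lambda>x. axis None 1"

text \<open>diag(y) minus the Weingarten operator, since \<open>cov_diff\<close> carries the
  opposite sign; it vanishes for the base metric.\<close>

definition deviation where
  "deviation i j x = cov_diff h N (Some j) (Some i) x + (if i = j then y i else 0)"

lemma sum_axis_None: "(\<Sum>p\<in>UNIV. axis None 1 $ p * f p) = (f None :: real)" for f :: "'n option \<Rightarrow> real"
  by (simp add: sum_UNIV_option axis_def)

lemma det_h:
  assumes x: "x \<in> M"
  shows "det (h x) = c ^ CARD('n) * det (Gm x)"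
proof -
  define k where "k i = (case i of None \<Rightarrow> 1 | Some (j::'n) \<Rightarrow> c)" for i
  have "h x $ i $ j = (\<chi> i. k i *s Gm x $ i) $ i $ j" for i j
    by (cases i; cases j) (simp_all add: k_def h_None[OF x] h_leaf[OF x] Gm_None[OF x])
  then have "h x = (\<chi> i. k i *s Gm x $ i)"
    by (simp add: vec_eq_iff)
  then have "det (h x) = (\<Prod>i\<in>UNIV. k i) * det (\<chi> i. Gm x $ i)"
    by (simp only: det_rows_mul)
  then show ?thesis by (simp add: prod_UNIV_option k_def)
qed

lemma vol_density_h: "x \<in> M \<Longrightarrow> vol_density h x = sqrt (c ^ CARD('n)) * vol_density Gm x"
  using c by (simp add: vol_density_def det_h abs_mult real_sqrt_mult)

lemma gform_h_leaf:
  assumes "x \<in> M" "v \<in> leaf_dist"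
  shows "gform (h x) v v = c * gform (Gm x) v v"
  using assms by (simp add: gform_sum sum_UNIV_option leaf_dist_def h_leaf sum_distrib_left mult.assoc)

sublocale foliated_metric M h N
proof
  have tr: "transpose (h x) = h x" if x: "x \<in> M" for x
  proof -
    have "h x $ j $ i = h x $ i $ j" for i j
      using pseudo_riemannian_metricD(4)[OF Gm x]
      by (cases i; cases j) (simp_all add: h_None[OF x] h_leaf[OF x])
    then show ?thesis by (simp add: vec_eq_iff transpose_def)
  qed
  have sm: "smooth_on M (\<lambda>x. h x $ i $ j)" for i j
  proof -
    have sc: "smooth_on M (\<lambda>x. c * Gm x $ Some i $ Some j)" for i j
      by (intro smooth_on_mult smooth_on_const pseudo_riemannian_metricD(1)[OF Gm] open_M)
    have "smooth_on M (\<lambda>x. h x $ Some i $ Some j)" for i j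
      by (rule smooth_on_cong[THEN iffD1, rotated 2, OF sc[of i j]]) (simp_all add: open_M h_leaf)
    moreover have "smooth_on M (\<lambda>x. h x $ None $ None)" "smooth_on M (\<lambda>x. h x $ None $ Some i)"
      "smooth_on M (\<lambda>x. h x $ Some i $ None)" for i
      by (subst smooth_on_cong[OF open_M], erule h_None, rule smooth_on_const)+
    ultimately show ?thesis by (cases i; cases j) simp_all
  qed
  show det: "det (h x) > 0" if "x \<in> M" for x
    using c Gm_det[OF that] by (simp add: det_h that)
  show "pseudo_riemannian_metric M h"
    using det by (force simp: pseudo_riemannian_metric_def sm tr invertible_det_nz)
  show "gform (h x) v v > 0" if "x \<in> M" "v \<in> leaf_dist" "v \<noteq> 0" for x v
    using c Gm_pos[OF that] by (simp add: gform_h_leaf that)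
  have e0: "gform (h x) (axis None 1) v = v $ None" if x: "x \<in> M" for x v
    unfolding gform_axis_left sum_UNIV_option by (simp add: h_None[OF x])
  show "axis None 1 \<in> normal_dist h x" if "x \<in> M" for x
    using that by (simp add: normal_dist_def e0 leaf_dist_def)
  show "gform (h x) (axis None 1) (axis None 1) = 1" if "x \<in> M" for x
    unfolding e0[OF that] by (simp add: axis_def)
qed (simp_all add: open_M smooth_on_const)

lemma pd_h_None:
  assumes x: "x \<in> M"
  shows "pd p (\<lambda>z. h z $ None $ k) x = 0" "pd p (\<lambda>z. h z $ k $ None) x = 0"
proof -
  have "pd p (\<lambda>z. h z $ None $ k) x = pd p (\<lambda>z. if k = None then 1 else 0) x"
    "pd p (\<lambda>z. h z $ k $ None) x = pd p (\<lambda>z. if k = None then 1 else 0) x"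
    by (rule pd_cong[OF open_M x]; cases k; simp add: h_None)+
  then show "pd p (\<lambda>z. h z $ None $ k) x = 0" "pd p (\<lambda>z. h z $ k $ None) x = 0" by simp_all
qed

text \<open>The factor \<open>c\<close> cancels: with one index raised, the shape operator does not
  notice a constant rescaling of the leaf metric. The leaf block need not be diagonal here, so the
  operator is determined only through this linear system.\<close>

lemma cov_diff_spatial:
  assumes x: "x \<in> M"
  shows "(\<Sum>l\<in>UNIV. Gm x $ Some i $ Some l * cov_diff h N (Some j) (Some l) x) = 1/2 * pd None (\<lambda>z. Gm z $ Some i $ Some j) x"
proof -
  have "pd None (\<lambda>z. h z $ Some j $ Some i) x = pd None (\<lambda>z. c * Gm z $ Some i $ Some j) x"
    by (rule pd_cong[OF open_M x]) (simp add: h_leaf pseudo_riemannian_metricD(4)[OF Gm, of _ "Some i"])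
  also have "\<dots> = c * pd None (\<lambda>z. Gm z $ Some i $ Some j) x"
    by (intro pd_cmult smooth_on_differentiable[OF pseudo_riemannian_metricD(1)[OF Gm] x])
  finally have "c * (\<Sum>l\<in>UNIV. Gm x $ Some i $ Some l * cov_diff h N (Some j) (Some l) x)
      = c * (1/2 * pd None (\<lambda>z. Gm z $ Some i $ Some j) x)"
    using cov_diff_leaf[OF x, of i "Some j"]
    by (simp add: sum_axis_None pd_h_None[OF x] h_leaf[OF x] sum_distrib_left mult.assoc)
  then show ?thesis using c by (simp only: mult_left_cancel[OF less_imp_neq[OF c, symmetric]])
qed

text \<open>Unit lapse and zero shift everywhere make the lowered derivative vanish on the leaves;
  positivity of the leaf metric then gives the derivative itself. No restriction to the complement
  of the support is needed.\<close>

lemma cov_diff_geodesic: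
  assumes x: "x \<in> M"
  shows "cov_diff h N None l x = 0"
proof -
  define v :: "real^'n option" where "v = (\<chi> l. cov_diff h N None l x)"
  have vN: "v $ None = 0" by (simp add: v_def cov_diff_None[OF x])
  have 0: "(\<Sum>l\<in>UNIV. h x $ Some i $ Some l * v $ Some l) = 0" for i
    using cov_diff_leaf[OF x, of i None, unfolded sum_axis_None] by (simp add: pd_h_None[OF x] v_def)
  have "gform (h x) v v = (\<Sum>i\<in>UNIV. v $ Some i * (\<Sum>l\<in>UNIV. h x $ Some i $ Some l * v $ Some l))"
    by (simp add: gform_sum sum_UNIV_option vN sum_distrib_left mult_ac)
  then have "gform (h x) v v = 0" by (simp add: 0)
  then have "v = 0" using leaf_pos[OF x, of v] vN by (force simp: leaf_dist_def)
  then show ?thesis by (simp add: v_def vec_eq_iff)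
qed

lemma deviation_eq:
  assumes x: "x \<in> M"
  shows "(\<Sum>l\<in>UNIV. Gm x $ Some i $ Some l * deviation l j x)
    = 1/2 * pd None (\<lambda>z. Gm z $ Some i $ Some j) x + y j * Gm x $ Some i $ Some j"
proof -
  have "(\<Sum>l\<in>UNIV. Gm x $ Some i $ Some l * (if l = j then y l else 0)) = y j * Gm x $ Some i $ Some j"
    by (simp add: sum_delta_mult)
  then show ?thesis
    by (simp add: deviation_def distrib_left sum.distrib cov_diff_spatial[OF x])
qed

lemma smooth_on_deviation: "smooth_on M (deviation i j)"
  unfolding deviation_def[abs_def]
  by (intro smooth_on_add smooth_on_const smooth_on_cov_diff[OF open_M metric N_smooth] open_M)

text \<open>The extrinsic integrand is unaffected by \<open>c\<close>, so the normalisation enters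
  only through the volume density, with the power given by the dimension of the leaves.\<close>

lemma J_action_spatial:
  assumes \<Omega>: "relatively_compact_in M \<Omega>" "open \<Omega>" and K: "compact K" "K \<subseteq> \<Omega>"
    and base: "\<And>x. x \<in> M - K \<Longrightarrow> Gm x = base_metric y x"
  shows "J_action \<Omega> h = (LINT x:\<Omega>|lborel. sqrt (c ^ CARD('n)) * (vol_density Gm x *
    ((\<Sum>i\<in>UNIV. deviation i i x)\<^sup>2 - (\<Sum>i\<in>UNIV. \<Sum>j\<in>UNIV. deviation i j x * deviation j i x)
      - (\<Sum>i\<in>UNIV. (y i)\<^sup>2) + 2 * (\<Sum>i\<in>UNIV. y i * deviation i i x))))"
proof -
  have oK: "open (M - K)" using K open_M by (simp add: compact_imp_closed open_Diff)
  have cov: "cov_diff h N (Some j) (Some i) x = deviation i j x - (if i = j then y i else 0)" for i j x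
    by (simp add: deviation_def)
  have tr: "(\<Sum>i\<in>UNIV. cov_diff h N (Some i) (Some i) x) = (\<Sum>i\<in>UNIV. deviation i i x)" for x
    by (simp add: cov sum_subtractf y)
  have geodesic: "(\<Sum>k\<in>UNIV. N x $ k * cov_diff h N k l x) = 0" if "x \<in> M - K" for x l
    using that by (simp add: sum_axis_None cov_diff_geodesic)
  have minimal: "(\<Sum>i\<in>UNIV. cov_diff h N (Some i) (Some i) x) = 0" if x: "x \<in> M - K" for x
  proof -
    have xM: "x \<in> M" using x by simp
    have "exp (-2 * y i * x $ None) * deviation i i x = 0" for i
    proof -
      have "pd None (\<lambda>z. Gm z $ Some i $ Some i) x = pd None (\<lambda>z. base_metric y z $ Some i $ Some i) x"
        by (rule pd_cong[OF oK x]) (simp only: base)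
      then show ?thesis
        using deviation_eq[OF xM, of i i] unfolding pd_base_metric base[OF x]
        by (simp add: sum_delta_mult)
    qed
    then have "deviation i i x = 0" for i by simp
    then show ?thesis unfolding tr by simp
  qed
  have eq: "vol_density h x * extrinsic x
    = sqrt (c ^ CARD('n)) * (vol_density Gm x *
    ((\<Sum>i\<in>UNIV. deviation i i x)\<^sup>2 - (\<Sum>i\<in>UNIV. \<Sum>j\<in>UNIV. deviation i j x * deviation j i x)
      - (\<Sum>i\<in>UNIV. (y i)\<^sup>2) + 2 * (\<Sum>i\<in>UNIV. y i * deviation i i x)))"
    if x: "x \<in> M" for x
  proof -
    have S: "(\<Sum>i\<in>UNIV. \<Sum>j\<in>UNIV. cov_diff h N (Some i) (Some j) x * cov_diff h N (Some j) (Some i) x)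
        = (\<Sum>i\<in>UNIV. (y i)\<^sup>2) - 2 * (\<Sum>i\<in>UNIV. y i * deviation i i x)
          + (\<Sum>i\<in>UNIV. \<Sum>j\<in>UNIV. deviation i j x * deviation j i x)"
    proof -
      have "cov_diff h N (Some i) (Some j) x * cov_diff h N (Some j) (Some i) x
          = ((if j = i then y j else 0) + - deviation j i x) * ((if i = j then y i else 0) + - deviation i j x)" for i j
        by (simp add: cov algebra_simps)
      then show ?thesis
        by (simp only: sum_diagonal_perturbation[of y "\<lambda>i j. - deviation i j x"]) (simp add: sum_negf)
    qed
    show ?thesis
      unfolding extrinsic_def S tr vol_density_h[OF x] by (simp add: algebra_simps)
  qed
  have \<Omega>M: "\<Omega> \<subseteq> M" using \<Omega> by (simp add: relatively_compact_in_def)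
  show ?thesis
    by (rule trans[OF J_action_eq[OF \<Omega> K geodesic minimal] set_lebesgue_integral_cong]) (use eq \<Omega>M \<Omega> in auto)
qed

end

text \<open>In the splitting of the base metric the coordinate vector of x_0 is normal and the
  others are tangent, so the normalisation multiplies the leaf block by \<open>c\<close> and keeps
  the remaining entries.\<close>

lemma bar_top_spatial:
  fixes M :: "(real^'n::finite option) set" and y :: "'n \<Rightarrow> real"
  assumes "open M" "(\<Sum>i\<in>UNIV. y i) = 0"
    and c: "vol_factor CARD('n) \<Omega> (base_metric y) Gm = c" "c > 0"
    and Gm: "pseudo_riemannian_metric M Gm" "\<And>x. x \<in> M \<Longrightarrow> det (Gm x) > 0"
      "\<And>x v. x \<in> M \<Longrightarrow> v \<in> leaf_dist \<Longrightarrow> v \<noteq> 0 \<Longrightarrow> gform (Gm x) v v > 0"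
    and Gm_None: "\<And>x. x \<in> M \<Longrightarrow> Gm x $ None $ None = 1" "\<And>x i. x \<in> M \<Longrightarrow> Gm x $ None $ Some i = 0"
      "\<And>x i. x \<in> M \<Longrightarrow> Gm x $ Some i $ None = 0"
  shows "spatial_metric M y Gm (bar_top \<Omega> (base_metric y) Gm) c"
proof -
  have nd: "leaf_dist \<inter> normal_dist (base_metric y) x = {0}" for x :: "real^'n option"
  proof -
    have "v = 0" if "v \<in> leaf_dist" "v \<in> normal_dist (base_metric y) x" for v
    proof -
      have "v $ k = 0" for k using that by (cases k) (auto simp: leaf_dist_def normal_dist_base_metric)
      then show ?thesis by (simp add: vec_eq_iff)
    qed
    then show ?thesis by (auto simp: leaf_dist_def normal_dist_base_metric)
  qed
  have lp: "leaf_part (base_metric y) x (axis None 1) = 0" "leaf_part (base_metric y) x (axis (Some i) 1) = axis (Some i) 1"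
    for x :: "real^'n option" and i
    by (rule leaf_part_eq[OF nd]; simp add: leaf_dist_def normal_dist_base_metric axis_def)+
  have g00: "gform (base_metric y x) (axis None 1) (axis None 1) = 1" for x :: "real^'n option"
    by (simp add: gform_axis_axis)
  note bar = bar_top_def c(1) normal_part_def lp gform_zero gform_axis_axis
  show ?thesis
    by standard (simp_all add: assms bar)
qed

text \<open>By Cauchy-Schwarz the perturbation changes the quadratic form by at most
  \<open>\<tau> * n\<close> times the sum of squares, which is half of the lower bound
  \<open>1 / E\<close>. This gives positivity of the perturbed leaf metric; testing
  \<open>A v\<close> against \<open>v\<close> gives the uniform bound for solutions of the linear
  system of the shape operator.\<close>

lemma near_diagonal_bounds:
  fixes A :: "'n::finite \<Rightarrow> 'n \<Rightarrow> real" and \<gamma> v :: "'n \<Rightarrow> real"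
  defines "n \<equiv> real CARD('n)"
  assumes E: "E > 0" "\<And>i. 1 / E \<le> \<gamma> i"
    and A: "\<And>i l. \<bar>A i l - (if i = l then \<gamma> i else 0)\<bar> \<le> \<tau>" and \<tau>: "\<tau> * n * E \<le> 1/2" "0 \<le> \<tau>"
  shows near_diagonal_form_lower_bound: "1 / (2 * E) * (\<Sum>i\<in>UNIV. (v i)\<^sup>2) \<le> (\<Sum>i\<in>UNIV. v i * (\<Sum>l\<in>UNIV. A i l * v l))"
    and near_diagonal_entry_bound: "(\<And>i. \<bar>\<Sum>l\<in>UNIV. A i l * v l\<bar> \<le> \<rho>) \<Longrightarrow> \<bar>v j\<bar> \<le> 2 * n * E * \<rho>"
proof -
  define S where "S = (\<Sum>i\<in>UNIV. \<bar>v i\<bar>)"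
  define Q where "Q = (\<Sum>i\<in>UNIV. (v i)\<^sup>2)"
  have S0: "S \<ge> 0" by (simp add: S_def sum_nonneg)
  have Q0: "Q \<ge> 0" by (simp add: Q_def sum_nonneg)
  have n0: "n > 0" by (simp add: n_def)
  have SQ: "S\<^sup>2 \<le> n * Q"
    using Cauchy_Schwarz_ineq_sum[of "\<lambda>i. \<bar>v i\<bar>" "\<lambda>i. 1" "UNIV :: 'n set"]
    by (simp add: S_def Q_def n_def mult.commute)
  define \<eta> where "\<eta> i l = A i l - (if i = l then \<gamma> i else 0)" for i l
  have "(\<Sum>i\<in>UNIV. v i * (\<Sum>l\<in>UNIV. A i l * v l)) = (\<Sum>i\<in>UNIV. \<gamma> i * (v i)\<^sup>2) + (\<Sum>i\<in>UNIV. \<Sum>l\<in>UNIV. v i * (\<eta> i l * v l))"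
  proof -
    have "(\<Sum>l\<in>UNIV. A i l * v l) = \<gamma> i * v i + (\<Sum>l\<in>UNIV. \<eta> i l * v l)" for i
      by (simp add: \<eta>_def left_diff_distrib sum_subtractf sum_delta_mult)
    then show ?thesis
      by (simp add: distrib_left sum.distrib sum_distrib_left power2_eq_square mult_ac)
  qed
  moreover have "1 / E * Q \<le> (\<Sum>i\<in>UNIV. \<gamma> i * (v i)\<^sup>2)"
    unfolding Q_def sum_distrib_left by (intro sum_mono mult_right_mono E) simp
  moreover have "\<bar>\<Sum>i\<in>UNIV. \<Sum>l\<in>UNIV. v i * (\<eta> i l * v l)\<bar> \<le> \<tau> * S\<^sup>2"
  proof -
    have "\<bar>\<Sum>i\<in>UNIV. \<Sum>l\<in>UNIV. v i * (\<eta> i l * v l)\<bar> \<le> (\<Sum>i\<in>UNIV. \<Sum>l\<in>UNIV. \<bar>v i\<bar> * (\<tau> * \<bar>v l\<bar>))"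
      by (rule order_trans[OF sum_abs], rule sum_mono, rule order_trans[OF sum_abs], rule sum_mono)
        (unfold abs_mult, intro mult_left_mono mult_right_mono A[folded \<eta>_def] abs_ge_zero)
    also have "\<dots> = \<tau> * S\<^sup>2"
      unfolding power2_eq_square S_def sum_product by (simp add: sum_distrib_left mult_ac)
    finally show ?thesis .
  qed
  moreover have "\<tau> * S\<^sup>2 \<le> 1 / (2 * E) * Q"
  proof -
    have "\<tau> * S\<^sup>2 \<le> \<tau> * (n * Q)" using SQ \<tau>(2) by (rule mult_left_mono)
    also have "\<dots> = 1 / E * (\<tau> * n * E) * Q" using E by simp
    also have "\<dots> \<le> 1 / E * (1/2) * Q"
      using \<tau> E Q0 by (intro mult_right_mono mult_left_mono) auto
    finally show ?thesis by simp
  qed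
  moreover have "1 / E * Q = 1 / (2 * E) * Q + 1 / (2 * E) * Q" using E by (simp add: field_simps)
  ultimately show low: "1 / (2 * E) * (\<Sum>i\<in>UNIV. (v i)\<^sup>2) \<le> (\<Sum>i\<in>UNIV. v i * (\<Sum>l\<in>UNIV. A i l * v l))"
    unfolding Q_def[symmetric] by linarith
  assume \<rho>: "\<And>i. \<bar>\<Sum>l\<in>UNIV. A i l * v l\<bar> \<le> \<rho>"
  have "(\<Sum>i\<in>UNIV. v i * (\<Sum>l\<in>UNIV. A i l * v l)) \<le> (\<Sum>i\<in>UNIV. \<bar>v i\<bar> * \<rho>)"
  proof (rule sum_mono)
    fix i
    have "v i * (\<Sum>l\<in>UNIV. A i l * v l) \<le> \<bar>v i\<bar> * \<bar>\<Sum>l\<in>UNIV. A i l * v l\<bar>"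
      unfolding abs_mult[symmetric] by (rule abs_ge_self)
    also have "\<dots> \<le> \<bar>v i\<bar> * \<rho>" by (intro mult_left_mono \<rho>) simp
    finally show "v i * (\<Sum>l\<in>UNIV. A i l * v l) \<le> \<bar>v i\<bar> * \<rho>" .
  qed
  then have "1 / (2 * E) * Q \<le> S * \<rho>"
    using low by (simp add: S_def sum_distrib_right Q_def)
  then have "Q \<le> 2 * E * (S * \<rho>)" using E by (simp add: field_simps)
  then have "n * Q \<le> n * (2 * E * (S * \<rho>))" using n0 by (intro mult_left_mono) auto
  \<comment> \<open>One factor \<open>S\<close> is divided out at the end, with \<open>S = 0\<close>
    treated separately.\<close>
  then have "S * S \<le> S * (2 * n * E * \<rho>)"
    using SQ by (simp add: power2_eq_square mult_ac)
  moreover have "\<rho> \<ge> 0" using \<rho>[of j] by linarith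
  ultimately have "S \<le> 2 * n * E * \<rho>"
    using S0 n0 E by (cases "S = 0") (auto intro!: mult_nonneg_nonneg dest: mult_left_le_imp_le)
  moreover have "\<bar>v j\<bar> \<le> S" unfolding S_def by (intro member_le_sum) auto
  ultimately show "\<bar>v j\<bar> \<le> 2 * n * E * \<rho>" by linarith
qed

text \<open>The normalised action is m/V times the integral of w (Q + 2 yd - s) with
  \<open>w\<close> the density of g_t. The integral of \<open>w\<close> is V, so the last term gives
  - s m exactly. The linear term w yd agrees to second order with \<open>yz\<close>, which
  integrates to zero.\<close>

lemma critical_top_base_metric:
  fixes M :: "(real^'n::finite option) set" and y :: "'n \<Rightarrow> real"
  assumes M: "open M" and y: "(\<Sum>i\<in>UNIV. y i) = 0" and \<Omega>: "relatively_compact_in M \<Omega>" "open \<Omega>"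
  shows "critical_top M \<Omega> (base_metric y)"
  unfolding critical_top_def
proof (intro allI impI)
  fix \<epsilon> :: real and G assume tv: "top_variation M \<Omega> (base_metric y) \<epsilon> G"
  show "((\<lambda>t. J_action \<Omega> (bar_top \<Omega> (base_metric y) (G t))) has_real_derivative 0) (at 0)"
  proof (cases "\<Omega> = {}")
    case True
    then show ?thesis by (simp add: J_action_def set_lebesgue_integral_def)
  next
    case False
    let ?T = "{-\<epsilon><..<\<epsilon>}"
    have var: "variation M \<Omega> (base_metric y) \<epsilon> G" using tv by (simp add: top_variation_def)
    have \<epsilon>: "\<epsilon> > 0" and G0: "\<And>x. x \<in> M \<Longrightarrow> G 0 x = base_metric y x"
      and Gs: "\<And>i j. smooth_on (?T \<times> M) (\<lambda>(t, x). G t x $ i $ j)"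
      and Gm: "\<And>t. t \<in> ?T \<Longrightarrow> pseudo_riemannian_metric M (G t)"
      using var by (auto simp: variation_def)
    obtain K where K: "compact K" "K \<subseteq> \<Omega>" and GK: "\<And>t x. t \<in> ?T \<Longrightarrow> x \<in> M - K \<Longrightarrow> G t x = base_metric y x"
      by (rule variation_support[OF \<Omega>(1) var]) blast
    have \<Omega>M: "\<Omega> \<subseteq> M" and C: "compact (closure \<Omega>)" "closure \<Omega> \<subseteq> M" and \<Omega>C: "\<Omega> \<subseteq> closure \<Omega>"
      using \<Omega>(1) closure_subset by (auto simp: relatively_compact_in_def)
    define m where "m = measure lborel \<Omega>"
    have m: "m > 0" unfolding m_def
      by (rule measure_open_pos[OF \<Omega>(2) False relatively_compact_emeasure[OF \<Omega>]])
    define s where "s = (\<Sum>i\<in>UNIV. (y i)\<^sup>2)"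
    define Y where "Y = (\<Sum>i\<in>UNIV. \<bar>y i\<bar>)"
    have Y0: "Y \<ge> 0" by (simp add: Y_def sum_nonneg)
    define n where "n = real CARD('n)"
    have n0: "n > 0" by (simp add: n_def)

    obtain r where r: "\<And>x. x \<in> closure \<Omega> \<Longrightarrow> norm x \<le> r"
      using C(1) compact_imp_bounded bounded_iff by metis
    \<comment> \<open>A bound on \<Omega> for all exponentials of plus or minus 2 y_i x_0: |y_i| is
      at most \<open>Y\<close>, and |x_0| at most \<open>r\<close> on the bounded closure.\<close>
    define E where "E = exp (2 * Y * r)"
    have E: "E > 0" by (simp add: E_def)
    have expE: "exp (2 * y i * x $ None) \<le> E" "1 / E \<le> exp (-2 * y i * x $ None)" if "x \<in> \<Omega>" for i x
    proof -
      have "norm x \<le> r" using that \<Omega>C by (intro r) auto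
      then have "\<bar>x $ None\<bar> \<le> r" using component_le_norm_cart[of x None] by linarith
      moreover have "\<bar>y i\<bar> \<le> Y" unfolding Y_def by (intro member_le_sum) auto
      ultimately have "\<bar>y i * x $ None\<bar> \<le> Y * r"
        unfolding abs_mult using Y0 by (intro mult_mono) auto
      then have "2 * y i * x $ None \<le> 2 * Y * r" by (simp add: abs_le_iff mult.assoc)
      then show 1: "exp (2 * y i * x $ None) \<le> E" by (simp add: E_def)
      show "1 / E \<le> exp (-2 * y i * x $ None)"
        using le_imp_inverse_le[OF 1] by (simp add: inverse_eq_divide exp_minus)
    qed

    \<comment> \<open>The right-hand side of \<open>deviation_eq\<close>, explicit in g_t and zero
      at t = 0. The deviation itself is only the solution of a linear system, so the Lipschitz bound
      is taken for \<open>Z\<close>.\<close>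
    define Z where "Z t i j x = 1/2 * pd None (\<lambda>z. G t z $ Some i $ Some j) x + y j * G t x $ Some i $ Some j" for t i j x
    have oTM: "open (?T \<times> M)" using M by (simp add: open_Times)
    have Gs': "smooth_on (?T \<times> M) (\<lambda>z. G (fst z) (snd z) $ i $ j)" for i j
      using Gs[of i j] by (simp add: case_prod_beta')
    have pGs: "smooth_on (?T \<times> M) (\<lambda>z. pd p (\<lambda>x. G (fst z) x $ i $ j) (snd z))" for p i j
      using smooth_on_joint_pd[OF _ M Gs'[of i j], of p] by (simp add: case_prod_beta' open_greaterThanLessThan)
    have Zs: "smooth_on (?T \<times> M) (\<lambda>z. Z (fst z) i j (snd z))" for i j
      unfolding Z_def by (intro smooth_on_add smooth_on_mult smooth_on_const pGs Gs' oTM)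
    define F where "F k z = (case k of None \<Rightarrow> det (G (fst z) (snd z))
        | Some (i, j, p) \<Rightarrow> if p then G (fst z) (snd z) $ Some i $ Some j else Z (fst z) i j (snd z))"
      for k :: "('n \<times> 'n \<times> bool) option" and z
    have Fs: "smooth_on (?T \<times> M) (F k)" for k
    proof (cases k)
      case None
      then show ?thesis unfolding F_def[abs_def] by (simp add: smooth_on_det oTM Gs')
    next
      case (Some a)
      then show ?thesis unfolding F_def[abs_def]
        by (cases a; cases "snd (snd a)") (auto simp: Gs' Zs)
    qed
    obtain L where L: "L \<ge> 0" "\<And>k t x. \<bar>t\<bar> \<le> \<epsilon> / 2 \<Longrightarrow> x \<in> closure \<Omega> \<Longrightarrow> \<bar>F k (t, x) - F k (0, x)\<bar> \<le> L * \<bar>t\<bar>"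
      by (rule smooth_families_lipschitz[of \<epsilon> M F, OF Fs \<epsilon> C]) blast
    have Z0: "Z 0 i j x = 0" if x: "x \<in> M" for i j x
    proof -
      have "pd None (\<lambda>z. G 0 z $ Some i $ Some j) x = pd None (\<lambda>z. base_metric y z $ Some i $ Some j) x"
        by (rule pd_cong[OF M x]) (simp only: G0)
      then show ?thesis unfolding Z_def pd_base_metric G0[OF x] by simp
    qed
    have dL: "\<bar>det (G t x) - 1\<bar> \<le> L * \<bar>t\<bar>"
      and gL: "\<bar>G t x $ Some i $ Some j - (if i = j then exp (-2 * y i * x $ None) else 0)\<bar> \<le> L * \<bar>t\<bar>"
      and ZL: "\<bar>Z t i j x\<bar> \<le> L * \<bar>t\<bar>"
      if "\<bar>t\<bar> \<le> \<epsilon> / 2" "x \<in> \<Omega>" for t x i j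
      using L(2)[OF that(1) subsetD[OF \<Omega>C that(2)], of None]
        L(2)[OF that(1) subsetD[OF \<Omega>C that(2)], of "Some (i, j, True)"]
        L(2)[OF that(1) subsetD[OF \<Omega>C that(2)], of "Some (i, j, False)"] subsetD[OF \<Omega>M that(2)]
      by (simp_all add: F_def Z0 G0 det_base_metric[OF y])

    \<comment> \<open>The constant of \<open>near_diagonal_entry_bound\<close>: a right-hand side of
      size \<tau> yields a deviation of size at most \<open>D * \<tau>\<close>.\<close>
    define D where "D = 2 * n * E"
    have D: "D > 0" using n0 E by (simp add: D_def)
    \<comment> \<open>The three summands bound w Q, 2 (w - 1) yd and 2 (yz - yd), each up to the
      factor \<tau>^2.\<close>
    define R where "R = 2 * (2 * n\<^sup>2 * D\<^sup>2) + 2 * (Y * D) + 2 * (Y * (E * (n * D)))"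
    \<comment> \<open>Small enough for both \<open>\<tau> \<le> 1/2\<close> and
      \<open>\<tau> * n * E \<le> 1/2\<close>, the condition for inverting the leaf metric.\<close>
    define \<delta> where "\<delta> = min (\<epsilon> / 2) (1 / (2 * (L + 1) * (n * E + 1)))"
    have \<delta>: "\<delta> > 0" using \<epsilon> L(1) n0 E by (simp add: \<delta>_def add_nonneg_pos)
    show ?thesis
    proof (rule has_real_derivative_0_quadratic_bound[OF \<delta>, where c = "- s * m" and C = "2 * R * m * L\<^sup>2"])
      fix t assume t\<delta>: "\<bar>t\<bar> < \<delta>"
      then have t: "\<bar>t\<bar> \<le> \<epsilon> / 2" "t \<in> ?T" using \<epsilon> by (auto simp: \<delta>_def)
      define \<tau> where "\<tau> = L * \<bar>t\<bar>"
      have \<tau>: "0 \<le> \<tau>" "\<tau> \<le> 1/2" "\<tau> * n * E \<le> 1/2"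
      proof -
        show \<tau>0: "0 \<le> \<tau>" using L(1) by (simp add: \<tau>_def)
        have p: "2 * (L + 1) * (n * E + 1) > 0" using L(1) n0 E by (simp add: add_nonneg_pos)
        have nE: "n * E > 0" using n0 E by simp
        have "\<bar>t\<bar> * (2 * (L + 1) * (n * E + 1)) \<le> 1"
          using t\<delta> p by (simp add: \<delta>_def pos_less_divide_eq less_imp_le)
        moreover have "\<bar>t\<bar> * (2 * (L + 1) * (n * E + 1))
            = 2 * (\<tau> * n * E) + 2 * \<tau> + 2 * (\<bar>t\<bar> * (n * E)) + 2 * \<bar>t\<bar>"
          by (simp add: \<tau>_def algebra_simps)
        moreover have "0 \<le> \<tau> * n * E" "0 \<le> \<bar>t\<bar> * (n * E)" "0 \<le> \<bar>t\<bar>"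
          using \<tau>0 nE n0 E by simp_all
        ultimately show "\<tau> \<le> 1/2" "\<tau> * n * E \<le> 1/2" using \<tau>0 by linarith+
      qed
      have d\<tau>: "\<bar>det (G t x) - 1\<bar> \<le> \<tau>"
        and g\<tau>: "\<bar>G t x $ Some i $ Some j - (if i = j then exp (-2 * y i * x $ None) else 0)\<bar> \<le> \<tau>"
        and Z\<tau>: "\<bar>Z t i j x\<bar> \<le> \<tau>" if "x \<in> \<Omega>" for x i j
        unfolding \<tau>_def by (rule dL[OF t(1) that], rule gL[OF t(1) that], rule ZL[OF t(1) that])
      have dpos: "det (G t x) > 0" if "x \<in> M" for x
      proof (cases "x \<in> \<Omega>")
        case True
        then show ?thesis using d\<tau>[of x] \<tau> by linarith
      next
        case False
        then have "x \<in> M - K" using that K by blast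
        then show ?thesis using GK[OF t(2)] by (simp add: det_base_metric[OF y])
      qed
      have gpos: "gform (G t x) v v > 0" if "x \<in> M" "v \<in> leaf_dist" "v \<noteq> 0" for x v
      proof (cases "x \<in> \<Omega>")
        case True
        have "\<exists>i. v $ Some i \<noteq> 0"
        proof (rule ccontr)
          assume "\<nexists>i. v $ Some i \<noteq> 0"
          then have "v $ k = 0" for k using that(2) by (cases k) (auto simp: leaf_dist_def)
          then show False using that(3) by (simp add: vec_eq_iff)
        qed
        then obtain i where "v $ Some i \<noteq> 0" ..
        then have "0 < (\<Sum>i\<in>UNIV. (v $ Some i)\<^sup>2)" by (intro sum_pos2[of _ i]) auto
        then have "0 < 1 / (2 * E) * (\<Sum>i\<in>UNIV. (v $ Some i)\<^sup>2)" using E by simp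
        also have "\<dots> \<le> (\<Sum>i\<in>UNIV. v $ Some i * (\<Sum>l\<in>UNIV. G t x $ Some i $ Some l * v $ Some l))"
          using \<tau> by (intro near_diagonal_form_lower_bound[OF E expE(2)[OF True] g\<tau>[OF True]]) (simp_all add: n_def)
        also have "\<dots> = gform (G t x) v v"
          using that(2) by (simp add: gform_sum sum_UNIV_option leaf_dist_def sum_distrib_left mult_ac)
        finally show ?thesis .
      next
        case False
        then have "x \<in> M - K" using that K by blast
        then show ?thesis using GK[OF t(2)] that by (simp add: base_metric_pos)
      qed
      note Gt = pseudo_riemannian_metricD[OF Gm[OF t(2)]]
      have eN: "axis None 1 \<in> normal_dist (base_metric y) x" for x :: "real^'n option"
        by (simp add: normal_dist_base_metric axis_def)
      note tvt = bspec[OF bspec[OF conjunct2[OF tv[unfolded top_variation_def]] t(2)]]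
      have GNone: "G t x $ None $ None = 1" and GSome: "G t x $ Some i $ None = 0" "G t x $ None $ Some i = 0" if x: "x \<in> M" for x i
      proof -
        have "gform (G t x) (axis None 1) (axis None 1) = gform (base_metric y x) (axis None 1) (axis None 1)"
          by (rule bspec[OF bspec[OF conjunct1[OF tvt[OF x]] eN] eN])
        then show "G t x $ None $ None = 1" by (simp add: gform_axis_axis)
        have "gform (G t x) (axis (Some i) 1) (axis None 1) = 0"
          by (rule bspec[OF bspec[OF conjunct2[OF tvt[OF x]] axis_Some_leaf_dist] eN])
        then show "G t x $ Some i $ None = 0" by (simp add: gform_axis_axis)
        then show "G t x $ None $ Some i = 0" using Gt(4)[OF x, of None "Some i"] by simp
      qed

      define w where "w x = vol_density (G t) x" for x
      have w: "\<bar>w x - 1\<bar> \<le> \<tau>" if "x \<in> \<Omega>" for x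
      proof -
        have d: "det (G t x) \<ge> 0" using dpos[of x] that \<Omega>M by (simp add: subset_iff less_imp_le)
        then have "w x = sqrt (det (G t x))" by (simp add: w_def vol_density_def)
        then show ?thesis using sqrt_minus_1_bound[OF d] d\<tau>[OF that] by linarith
      qed
      have ws: "smooth_on M w"
        unfolding w_def by (rule smooth_on_vol_density[OF M Gm[OF t(2)] dpos])
      note si = relatively_compact_integrable_smooth[OF \<Omega>]
      define V where "V = Vol \<Omega> (G t)"
      have V: "V = (LINT x:\<Omega>|lborel. w x)" by (simp add: V_def Vol_def w_def)
      have Vm: "\<bar>V - m\<bar> \<le> \<tau> * m"
        unfolding V m_def by (rule set_integral_near_measure[OF \<Omega> si[OF ws] w])
      have "\<tau> * m \<le> 1/2 * m" using \<tau> m by (intro mult_right_mono) auto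
      then have V2: "V \<ge> m / 2" and Vpos: "V > 0" using Vm m by linarith+
      define c where "c = vol_factor CARD('n) \<Omega> (base_metric y) (G t)"
      have c: "c > 0" "sqrt (c ^ CARD('n)) = m / V"
      proof -
        have p: "V / m > 0" using m Vpos by simp
        have ceq: "c = (V / m) powr (- 2 / n)"
          by (simp add: c_def vol_factor_def Vol_base_metric[OF y] m_def[symmetric] V_def[symmetric] n_def)
        show cpos: "c > 0" unfolding ceq using m Vpos by simp
        have "c ^ CARD('n) = c powr n"
          unfolding n_def by (rule powr_realpow[OF cpos, symmetric])
        also have "\<dots> = (V / m) powr (- 2 / n * n)"
          unfolding ceq by (rule powr_powr)
        also have "\<dots> = (V / m) powr (- 2)" using n0 by simp
        also have "\<dots> = (m / V)\<^sup>2"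
          using p by (simp add: powr_minus powr_numeral inverse_eq_divide power_divide)
        finally show "sqrt (c ^ CARD('n)) = m / V" using m Vpos by simp
      qed
      interpret B: spatial_metric M y "G t" "bar_top \<Omega> (base_metric y) (G t)" c
        by (rule bar_top_spatial[OF M y c_def[symmetric] c(1) Gm[OF t(2)] dpos gpos GNone GSome(2,1)])
      \<comment> \<open>For fixed \<open>j\<close> the deviations \<open>B.deviation l j x\<close>
        solve a system whose matrix is the leaf block of \<open>G t x\<close>, nearly diagonal for
        small t.\<close>
      have dev: "(\<Sum>l\<in>UNIV. G t x $ Some i $ Some l * B.deviation l j x) = Z t i j x" if "x \<in> M" for x i j
        unfolding Z_def by (rule B.deviation_eq[OF that])
      have dev\<tau>: "\<bar>B.deviation i j x\<bar> \<le> D * \<tau>" if x: "x \<in> \<Omega>" for i j x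
        unfolding D_def n_def
        by (rule near_diagonal_entry_bound[OF E expE(2)[OF x] g\<tau>[OF x]])
          (use \<tau> x \<Omega>M Z\<tau>[OF x] in \<open>auto simp: n_def dev\<close>)

      define Q where "Q x = (\<Sum>i\<in>UNIV. B.deviation i i x)\<^sup>2 - (\<Sum>i\<in>UNIV. \<Sum>j\<in>UNIV. B.deviation i j x * B.deviation j i x)" for x
      define yd where "yd x = (\<Sum>i\<in>UNIV. y i * B.deviation i i x)" for x
      define yz where "yz x = (\<Sum>i\<in>UNIV. y i * (exp (2 * y i * x $ None) * Z t i i x))" for x
      define \<rho> where "\<rho> x = w x * Q x + 2 * (w x * yd x) - 2 * yz x" for x
      have Zts: "smooth_on M (Z t i j)" for i j
        unfolding Z_def[abs_def] by (intro smooth_on_add smooth_on_mult smooth_on_const smooth_on_pd Gt(1) M)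
      have yzs: "smooth_on M yz" unfolding yz_def[abs_def]
        by (intro smooth_on_sum smooth_on_mult smooth_on_const smooth_on_exp smooth_on_coord Zts M)
      have \<rho>s: "smooth_on M \<rho>" unfolding \<rho>_def[abs_def] Q_def yd_def power2_eq_square
        by (intro smooth_on_add smooth_on_diff smooth_on_mult smooth_on_sum smooth_on_const ws yzs B.smooth_on_deviation M)
      have \<rho>b: "\<bar>\<rho> x\<bar> \<le> R * \<tau>\<^sup>2" if x: "x \<in> \<Omega>" for x
      proof -
        have xM: "x \<in> M" using x \<Omega>M by blast
        \<comment> \<open>\<open>\<eta>\<close> is the perturbation of the leaf metric. Its product
          \<open>u\<close> with the deviation is of second order and is the whole difference between
          \<open>yz\<close> and \<open>yd\<close>.\<close>
        define \<eta> where "\<eta> i l = G t x $ Some i $ Some l - (if i = l then exp (-2 * y i * x $ None) else 0)" for i l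
        define u where "u i = (\<Sum>l\<in>UNIV. \<eta> i l * B.deviation l i x)" for i
        have "exp (2 * y i * x $ None) * Z t i i x = B.deviation i i x + exp (2 * y i * x $ None) * u i" for i
        proof -
          have "Z t i i x = exp (-2 * y i * x $ None) * B.deviation i i x + u i"
            unfolding dev[OF xM, symmetric] u_def \<eta>_def by (simp add: left_diff_distrib sum_subtractf sum_delta_mult)
          then show ?thesis by (simp add: distrib_left mult.assoc[symmetric] flip: exp_add)
        qed
        then have yz: "yz x = yd x + (\<Sum>i\<in>UNIV. y i * (exp (2 * y i * x $ None) * u i))"
          by (simp add: yz_def yd_def distrib_left sum.distrib)
        have "\<bar>u i\<bar> \<le> (\<Sum>l\<in>(UNIV::'n set). \<tau> * (D * \<tau>))" for i
          unfolding u_def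
          by (rule order_trans[OF sum_abs], rule sum_mono)
            (unfold abs_mult, intro mult_mono g\<tau>[OF x, folded \<eta>_def] dev\<tau>[OF x] \<tau> abs_ge_zero)
        then have u: "\<bar>u i\<bar> \<le> n * D * \<tau>\<^sup>2" for i by (simp add: n_def power2_eq_square mult_ac)
        have "\<bar>\<Sum>i\<in>UNIV. y i * (exp (2 * y i * x $ None) * u i)\<bar> \<le> (\<Sum>i\<in>UNIV. \<bar>y i\<bar> * (E * (n * D * \<tau>\<^sup>2)))"
        proof (rule order_trans[OF sum_abs], rule sum_mono)
          fix i
          have "\<bar>exp (2 * y i * x $ None) * u i\<bar> \<le> E * (n * D * \<tau>\<^sup>2)"
            unfolding abs_mult using expE(1)[OF x] u E by (intro mult_mono) auto
          then show "\<bar>y i * (exp (2 * y i * x $ None) * u i)\<bar> \<le> \<bar>y i\<bar> * (E * (n * D * \<tau>\<^sup>2))"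
            unfolding abs_mult[of "y i"] by (intro mult_left_mono) auto
        qed
        then have 3: "\<bar>\<Sum>i\<in>UNIV. y i * (exp (2 * y i * x $ None) * u i)\<bar> \<le> Y * (E * (n * D)) * \<tau>\<^sup>2"
          by (simp add: Y_def sum_distrib_right mult.assoc)
        have "\<bar>yd x\<bar> \<le> (\<Sum>i\<in>UNIV. \<bar>y i\<bar> * (D * \<tau>))"
          unfolding yd_def
          by (rule order_trans[OF sum_abs], rule sum_mono) (unfold abs_mult, intro mult_left_mono dev\<tau>[OF x] abs_ge_zero)
        then have yd: "\<bar>yd x\<bar> \<le> Y * D * \<tau>" by (simp add: Y_def sum_distrib_right mult.assoc)
        have 2: "\<bar>(w x - 1) * yd x\<bar> \<le> \<tau> * (Y * D * \<tau>)"
          unfolding abs_mult using w[OF x] yd \<tau> by (intro mult_mono) auto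
        have "\<bar>\<Sum>i\<in>UNIV. B.deviation i i x\<bar> \<le> (\<Sum>i\<in>(UNIV::'n set). D * \<tau>)"
          by (rule order_trans[OF sum_abs]) (intro sum_mono dev\<tau>[OF x])
        then have "\<bar>\<Sum>i\<in>UNIV. B.deviation i i x\<bar> \<le> n * (D * \<tau>)" by (simp add: n_def)
        from power_mono[OF this, of 2] have q1: "\<bar>(\<Sum>i\<in>UNIV. B.deviation i i x)\<^sup>2\<bar> \<le> n\<^sup>2 * D\<^sup>2 * \<tau>\<^sup>2"
          by (simp add: power_mult_distrib mult.assoc)
        have "\<bar>\<Sum>i\<in>UNIV. \<Sum>j\<in>UNIV. B.deviation i j x * B.deviation j i x\<bar>
            \<le> (\<Sum>i\<in>(UNIV::'n set). \<Sum>j\<in>(UNIV::'n set). (D * \<tau>) * (D * \<tau>))"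
          by (rule order_trans[OF sum_abs], rule sum_mono, rule order_trans[OF sum_abs], rule sum_mono)
            (unfold abs_mult, intro mult_mono dev\<tau>[OF x] abs_ge_zero mult_nonneg_nonneg \<tau>(1) less_imp_le[OF D])
        then have q2: "\<bar>\<Sum>i\<in>UNIV. \<Sum>j\<in>UNIV. B.deviation i j x * B.deviation j i x\<bar> \<le> n\<^sup>2 * D\<^sup>2 * \<tau>\<^sup>2"
          by (simp add: n_def power2_eq_square mult_ac)
        have Q: "\<bar>Q x\<bar> \<le> 2 * n\<^sup>2 * D\<^sup>2 * \<tau>\<^sup>2" unfolding Q_def using q1 q2 by linarith
        have 1: "\<bar>w x * Q x\<bar> \<le> 2 * (2 * n\<^sup>2 * D\<^sup>2 * \<tau>\<^sup>2)"
          unfolding abs_mult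
        proof (rule mult_mono)
          show "\<bar>w x\<bar> \<le> 2" using w[OF x] \<tau> by linarith
        qed (use Q in auto)
        have "\<rho> x = w x * Q x + 2 * ((w x - 1) * yd x) - 2 * (\<Sum>i\<in>UNIV. y i * (exp (2 * y i * x $ None) * u i))"
          unfolding \<rho>_def yz by (simp add: algebra_simps)
        then have "\<bar>\<rho> x\<bar> \<le> 2 * (2 * n\<^sup>2 * D\<^sup>2 * \<tau>\<^sup>2) + 2 * (\<tau> * (Y * D * \<tau>)) + 2 * (Y * (E * (n * D)) * \<tau>\<^sup>2)"
          using 1 2 3 by linarith
        also have "\<dots> = R * \<tau>\<^sup>2" by (simp add: R_def algebra_simps power2_eq_square)
        finally show ?thesis .
      qed
      have yz0: "(LINT x:\<Omega>|lborel. yz x) = 0"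
      proof -
        \<comment> \<open>Subtracting 1 makes this vanish off \<open>K\<close>, where the
          exponential cancels the diagonal entry; its x_0-derivative is twice the exponential times
          \<open>Z t i i\<close>.\<close>
        define f where "f i z = exp (2 * y i * z $ None) * G t z $ Some i $ Some i - 1" for i and z :: "real^'n option"
        have es: "smooth_on M (\<lambda>z. exp (2 * y i * z $ None))" for i
          by (intro smooth_on_exp smooth_on_mult smooth_on_const smooth_on_coord M)
        have fs: "smooth_on M (f i)" for i
          unfolding f_def[abs_def] by (intro smooth_on_diff smooth_on_mult es smooth_on_const Gt(1) M)
        have f0: "f i x = 0" if "x \<in> M - K" for i x
          by (simp add: f_def GK[OF t(2) that] flip: exp_add)
        have "yz x = (\<Sum>i\<in>UNIV. y i / 2 * pd None (f i) x)" if x: "x \<in> M" for x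
        proof -
          have "pd None (f i) x = 2 * (exp (2 * y i * x $ None) * Z t i i x)" for i
          proof -
            note ed = smooth_on_differentiable[OF es x] and gd = smooth_on_differentiable[OF Gt(1) x]
            have "pd None (f i) x = exp (2 * y i * x $ None) * pd None (\<lambda>z. G t z $ Some i $ Some i) x
                + pd None (\<lambda>z. exp (2 * y i * z $ None)) x * G t x $ Some i $ Some i"
              unfolding f_def[abs_def] by (simp add: pd_diff pd_mult ed gd differentiable_mult)
            then show ?thesis unfolding pd_exp_None Z_def by (simp add: algebra_simps)
          qed
          then show ?thesis by (simp add: yz_def)
        qed
        then have "(LINT x:\<Omega>|lborel. yz x) = (LINT x:\<Omega>|lborel. (\<Sum>i\<in>UNIV. y i / 2 * pd None (f i) x))"
          using \<Omega>M \<Omega> by (intro set_lebesgue_integral_cong) auto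
        also have "\<dots> = 0"
          by (rule integral_sum_pd_compact_support[OF M fs K \<Omega> f0])
        finally show ?thesis .
      qed
      have "J_action \<Omega> (bar_top \<Omega> (base_metric y) (G t)) = (LINT x:\<Omega>|lborel. m / V * (\<rho> x + 2 * yz x - s * w x))"
        using B.J_action_spatial[OF \<Omega> K GK[OF t(2)]]
        by (simp add: c(2) Q_def[symmetric] yd_def[symmetric] s_def[symmetric] w_def[symmetric] \<rho>_def algebra_simps)
      also have "\<dots> = m / V * ((LINT x:\<Omega>|lborel. \<rho> x) - s * V)"
      proof -
        have "(LINT x:\<Omega>|lborel. \<rho> x + 2 * yz x - s * w x)
            = (LINT x:\<Omega>|lborel. \<rho> x) + 2 * (LINT x:\<Omega>|lborel. yz x) - s * (LINT x:\<Omega>|lborel. w x)"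
          by (subst set_integral_diff(2) set_integral_add(2) set_integral_mult_right |
            (intro si \<rho>s smooth_on_add smooth_on_diff smooth_on_mult smooth_on_const ws yzs M; fail))+ simp
        then show ?thesis by (simp add: V yz0)
      qed
      also have "\<dots> = m / V * (LINT x:\<Omega>|lborel. \<rho> x) + (- s * m)"
        using Vpos by (simp add: right_diff_distrib)
      finally have J: "J_action \<Omega> (bar_top \<Omega> (base_metric y) (G t)) - (- s * m) = m / V * (LINT x:\<Omega>|lborel. \<rho> x)"
        by simp
      have "\<bar>LINT x:\<Omega>|lborel. \<rho> x\<bar> \<le> R * \<tau>\<^sup>2 * m"
        unfolding m_def by (rule set_integral_bound[OF \<Omega> si[OF \<rho>s] \<rho>b])
      moreover have "\<bar>m / V\<bar> \<le> 2" using V2 Vpos m by (simp add: pos_divide_le_eq)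
      ultimately have "\<bar>m / V * (LINT x:\<Omega>|lborel. \<rho> x)\<bar> \<le> 2 * (R * \<tau>\<^sup>2 * m)"
        unfolding abs_mult by (intro mult_mono) auto
      then show "\<bar>J_action \<Omega> (bar_top \<Omega> (base_metric y) (G t)) - (- s * m)\<bar> \<le> 2 * R * m * L\<^sup>2 * t\<^sup>2"
        unfolding J by (simp add: \<tau>_def power_mult_distrib mult_ac)
    qed
  qed
qed

section \<open>Existence of the critical metric\<close>

lemma weingarten_base_metric:
  fixes M :: "(real^'n::finite option) set"
  assumes "open M" "(\<Sum>i\<in>UNIV. y i) = 0" "x \<in> M" "X \<in> leaf_dist"
  shows "weingarten (base_metric y) (\<lambda>x. axis None 1) x X $ k = (case k of None \<Rightarrow> 0 | Some i \<Rightarrow> y i * X $ Some i)"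
proof -
  let ?N = "\<lambda>x. axis None 1 :: real^'n option"
  have "(\<Sum>j\<in>UNIV. christoffel (base_metric y) k i j x * X $ i * ?N x $ j) = X $ i * cov_diff (base_metric y) ?N i k x" for i
    by (simp add: cov_diff_def sum_distrib_left mult_ac)
  then have "cov_deriv (base_metric y) x X ?N $ k = (\<Sum>i\<in>UNIV. X $ i * cov_diff (base_metric y) ?N i k x)"
    by (simp add: cov_deriv_def)
  also have "\<dots> = (\<Sum>j\<in>UNIV. X $ Some j * (if k = Some j then - y j else 0))"
    using assms(4) by (simp add: sum_UNIV_option leaf_dist_def cov_diff_base_metric[OF assms(1-3)])
  also have "\<dots> = - (case k of None \<Rightarrow> 0 | Some i \<Rightarrow> y i * X $ Some i)"
    by (cases k) (simp_all add: sum_delta_mult)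
  finally show ?thesis by (simp add: weingarten_def)
qed

theorem proposition2p12:
  fixes M :: "(real ^ 'n::finite option) set"
    and y :: "'n \<Rightarrow> real"
  assumes "open M"
    and "(\<Sum>i\<in>UNIV. y i) = 0"
  shows "\<exists>g :: 'n option metric.
    riemannian_metric M g \<and> orthogonal_coordinates M g \<and>
    (\<forall>\<Omega>. open \<Omega> \<and> relatively_compact_in M \<Omega> \<longrightarrow> critical_perp M \<Omega> g \<and> critical_top M \<Omega> g) \<and>
    (\<exists>N. unit_normal_field M g N \<and>
      (\<forall>x\<in>M. minimal_at g N x \<and> has_principal_curvatures g N x y))"
proof (intro exI conjI)
  let ?g = "base_metric y :: 'n option metric" and ?N = "\<lambda>x :: real^'n option. axis None 1 :: real^'n option"
  interpret foliated_metric M ?g ?N by (rule foliated_base_metric[OF assms])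
  show "riemannian_metric M ?g"
    by (simp add: riemannian_metric_def metric base_metric_pos)
  show "orthogonal_coordinates M ?g"
    by (simp add: orthogonal_coordinates_def base_metric_def)
  show "\<forall>\<Omega>. open \<Omega> \<and> relatively_compact_in M \<Omega> \<longrightarrow> critical_perp M \<Omega> ?g \<and> critical_top M \<Omega> ?g"
    using critical_perp_base_metric[OF assms] critical_top_base_metric[OF assms] by blast
  show "unit_normal_field M ?g ?N"
    by (simp add: unit_normal_field_def smooth_on_const unit_normal_def N_normal N_unit)
  show "\<forall>x\<in>M. minimal_at ?g ?N x \<and> has_principal_curvatures ?g ?N x y"
  proof (intro ballI conjI)
    fix x assume x: "x \<in> M"
    note W = weingarten_base_metric[OF assms x]
    show "minimal_at ?g ?N x"
      by (simp add: minimal_at_def W[OF axis_Some_leaf_dist] assms(2))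
    show "has_principal_curvatures ?g ?N x y"
      unfolding has_principal_curvatures_def
    proof
      fix r
      \<comment> \<open>The eigenspace for \<open>r\<close> is the coordinate subspace spanned by
        the directions \<open>Some i\<close> with \<open>y i = r\<close>; for \<open>r\<close> not
        among the \<open>y i\<close> both sides are 0.\<close>
      let ?d = "Some ` {i. y i = r}"
      have "weingarten ?g ?N x X = r *\<^sub>R X \<longleftrightarrow> (\<forall>i. y i \<noteq> r \<longrightarrow> X $ Some i = 0)" if "X \<in> leaf_dist" for X
      proof -
        have "weingarten ?g ?N x X = r *\<^sub>R X \<longleftrightarrow> (\<forall>i. y i * X $ Some i = r * X $ Some i)"
          using that by (auto simp: vec_eq_iff W[OF that] leaf_dist_def split: option.split)
        then show ?thesis by auto
      qed
      then have "{X \<in> leaf_dist. weingarten ?g ?N x X = r *\<^sub>R X} = {X. \<forall>k. k \<notin> ?d \<longrightarrow> X $ k = 0}"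
        unfolding split_option_all leaf_dist_def by auto
      then have "dim {X \<in> leaf_dist. weingarten ?g ?N x X = r *\<^sub>R X} = card ?d"
        using dim_substandard_cart[of ?d, where 'a = real] by (simp only: dim_vec_eq)
      then show "dim {X \<in> leaf_dist. weingarten ?g ?N x X = r *\<^sub>R X} = card {i. y i = r}"
        by (simp add: card_image)
    qed
  qed
qed

end
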